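(* Let $\gamma$ be a regular, smooth, and simple curve, parameterized by arc length, on a smooth surface $\mathcal M\subset\mathbb R^3$, with $\dot{\mathbf n}\ne0$ everywhere, where $\mathbf n(s)$ is the unit normal to $\mathcal M$ at $\gamma(s)$. Let $\Sigma$ be a strip, around the trace of $\gamma$, of the envelope of the tangent planes to $\mathcal M$ along $\gamma$, so that $\Sigma$ is a surface with zero Gauss curvature. Then $$\mathrm{TC}_\Sigma(\gamma)=\int_\gamma|\mathfrak K_g|\,ds,$$ where $\mathfrak K_g$ is the geodesic curvature of $\gamma$ as a curve in $\mathcal M$.
   Context: The surface $\mathcal M$ is at least of class $C^3$, closed and compact. The envelope of the tangent planes to $\mathcal M$ along $\gamma:I\to\mathcal M$ is the ruled surface parameterized by $$X(s,v):=\gamma(s)+v\,\frac{\mathbf n(s)\times\dot{\mathbf n}(s)}{|\dot{\mathbf n}(s)|},$$ and $\Sigma$ is a (sufficiently narrow) tubular neighborhood of the trace of $\gamma$ in it, which is a surface with Gauss curvature equal to zero. The geodesic curvature is $\mathfrak K_g:=\dot{\mathbf t}\bullet\mathbf u$, with $\mathbf t=\dot\gamma$ (arc-length derivative), $\mathbf u=\mathbf n\times\mathbf t$, and $\bullet$ the scalar product of $\mathbb R^3$. Total intrinsic curvature in $\Sigma$: a polygonal in $\Sigma$ is a finite concatenation of geodesic arcs of $\Sigma$; its rotation $\mathbf k_\Sigma(\widetilde P)$ is the sum of the (non-negative) turning angles between consecutive geodesic arcs. $\widetilde P$ is inscribed in $\gamma:[a,b]\to\Sigma$ if it is obtained by choosing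 $a\le t_0<\dots<t_n\le b$ and connecting consecutive points $\gamma(t_i)$ by (length-minimizing) geodesic segments of $\Sigma$. The modulus $\mu_\gamma(\widetilde P)$ is the maximum of the geodesic diameters in $\Sigma$ of the arcs of $\gamma$ determined by consecutive vertices of $\widetilde P$. Then $$\mathrm{TC}_\Sigma(\gamma):=\lim_{\varepsilon\to0^+}\sup\{\mathbf k_\Sigma(\widetilde P)\mid\widetilde P\text{ inscribed in }\gamma,\ \mu_\gamma(\widetilde P)<\varepsilon\},$$ where only polygonals with sufficiently small modulus (according to the width of the strip $\Sigma$) are considered. *)

theory Defs
  imports "HOL-Analysis.Analysis"
begin

section \<open>Curves and surfaces of class C^k in Euclidean 3-space\<close>

text \<open>All derivatives are taken within the domain. The definition is used only for open sets,
  for nondegenerate compact intervals (one-sided derivatives at the end points) and for products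
  of a compact and an open interval, where derivatives within the set are unique.\<close>

primrec C_k_on :: "nat \<Rightarrow> ('a::euclidean_space \<Rightarrow> 'b::real_normed_vector) \<Rightarrow> 'a set \<Rightarrow> bool" where
  "C_k_on 0 = (\<lambda>f S. continuous_on S f)"
| "C_k_on (Suc k) = (\<lambda>f S. (\<forall>x\<in>S. f differentiable (at x within S)) \<and>
      (\<forall>i\<in>Basis. C_k_on k (\<lambda>x. frechet_derivative f (at x within S) i) S))"

definition regular_surface :: "nat \<Rightarrow> (real^3) set \<Rightarrow> bool" where
  "regular_surface k S \<longleftrightarrow>
     (\<forall>p\<in>S. \<exists>V U x y. open V \<and> p \<in> V \<and> open (U :: (real \<times> real) set) \<and>
        C_k_on k x U \<and> homeomorphism U (V \<inter> S) x y \<and>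
        (\<forall>q\<in>U. inj (frechet_derivative x (at q))))"

definition tangent_space :: "(real^3) set \<Rightarrow> real^3 \<Rightarrow> (real^3) set" where
  "tangent_space S p = {w. \<exists>c e. 0 < e \<and> c 0 = p \<and> (\<forall>t. \<bar>t\<bar> < e \<longrightarrow> c t \<in> S) \<and>
     (c has_vector_derivative w) (at (0::real))}"

text \<open>A continuous unit normal field; closed surfaces in 3-space are orientable, so it always
  exists.\<close>

definition unit_normal_field :: "(real^3) set \<Rightarrow> (real^3 \<Rightarrow> real^3) \<Rightarrow> bool" where
  "unit_normal_field S N \<longleftrightarrow> continuous_on S N \<and>
     (\<forall>p\<in>S. norm (N p) = 1 \<and> (\<forall>w\<in>tangent_space S p. N p \<bullet> w = 0))"

definition dot_on :: "real \<Rightarrow> real \<Rightarrow> (real \<Rightarrow> real^3) \<Rightarrow> real \<Rightarrow> real^3" where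
  "dot_on a b f s = vector_derivative f (at s within {a..b})"

text \<open>A simple curve may be an arc or a closed curve. In the closed case smoothness includes the
  junction, i.e. the periodic extension is smooth.\<close>

definition simple_curve :: "nat \<Rightarrow> real \<Rightarrow> real \<Rightarrow> (real \<Rightarrow> real^3) \<Rightarrow> bool" where
  "simple_curve k a b \<gamma> \<longleftrightarrow> C_k_on k \<gamma> {a..b} \<and>
     (inj_on \<gamma> {a..b} \<or>
      inj_on \<gamma> {a..<b} \<and>
        (\<exists>\<Gamma>. C_k_on k \<Gamma> UNIV \<and> (\<forall>s. \<Gamma> (s + (b - a)) = \<Gamma> s) \<and> (\<forall>s\<in>{a..b}. \<Gamma> s = \<gamma> s)))"

definition geodesic_curvature ::
    "(real^3 \<Rightarrow> real^3) \<Rightarrow> real \<Rightarrow> real \<Rightarrow> (real \<Rightarrow> real^3) \<Rightarrow> real \<Rightarrow> real" where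
  "geodesic_curvature N a b \<gamma> s =
     dot_on a b (dot_on a b \<gamma>) s \<bullet> cross3 (N (\<gamma> s)) (dot_on a b \<gamma> s)"


section \<open>The envelope of the tangent planes along a curve\<close>

definition envelope ::
    "(real^3 \<Rightarrow> real^3) \<Rightarrow> real \<Rightarrow> real \<Rightarrow> (real \<Rightarrow> real^3) \<Rightarrow> real \<times> real \<Rightarrow> real^3" where
  "envelope N a b \<gamma> = (\<lambda>(s, v). let n = N \<circ> \<gamma>; n' = dot_on a b n s
     in \<gamma> s + (v / norm n') *\<^sub>R cross3 (n s) n')"

definition strip_domain :: "real \<Rightarrow> real \<Rightarrow> real \<Rightarrow> (real \<times> real) set" where
  "strip_domain a b \<delta> = {a..b} \<times> {-\<delta><..<\<delta>}"

definition strip ::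
    "(real^3 \<Rightarrow> real^3) \<Rightarrow> real \<Rightarrow> real \<Rightarrow> (real \<Rightarrow> real^3) \<Rightarrow> real \<Rightarrow> (real^3) set" where
  "strip N a b \<gamma> \<delta> = envelope N a b \<gamma> ` strip_domain a b \<delta>"

text \<open>The strip of half-width delta is a surface: the parametrization is a C^1 immersion, carries
  the quotient topology to the subspace topology, and identifies two points only if they lie at
  the same height on rulings through the same point of the curve. If the curve is an arc, this
  says that the parametrization is a homeomorphism onto its image; if it is closed, that the two
  end rulings are glued and the result is embedded. The Gauss curvature then vanishes, because
  the normal is constant along the rulings. A nonzero derivative of the normal alone does not
  give this: on the curve, the parametrization is an immersion only where the normal curvature
  of the curve is nonzero.\<close>

definition strip_is_surface ::
    "(real^3 \<Rightarrow> real^3) \<Rightarrow> real \<Rightarrow> real \<Rightarrow> (real \<Rightarrow> real^3) \<Rightarrow> real \<Rightarrow> bool" where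
  "strip_is_surface N a b \<gamma> \<delta> \<longleftrightarrow>
     (let X = envelope N a b \<gamma>; D = strip_domain a b \<delta> in
        C_k_on 1 X D \<and>
        (\<forall>p\<in>D. inj (frechet_derivative X (at p within D))) \<and>
        quotient_map (top_of_set D) (top_of_set (X ` D)) X \<and>
        (\<forall>s v s' v'. (s, v) \<in> D \<and> (s', v') \<in> D \<and> X (s, v) = X (s', v') \<longrightarrow>
           v = v' \<and> \<gamma> s = \<gamma> s'))"


section \<open>Intrinsic distance and minimizing geodesics of a subset\<close>

definition path_length :: "(real \<Rightarrow> 'a::metric_space) \<Rightarrow> ennreal" where
  "path_length g = (SUP ts \<in> {ts. sorted ts \<and> set ts \<subseteq> {0..1}}.
     \<Sum>i<length ts - 1. ennreal (dist (g (ts ! i)) (g (ts ! Suc i))))"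

definition intrinsic_dist :: "'a::metric_space set \<Rightarrow> 'a \<Rightarrow> 'a \<Rightarrow> ennreal" where
  "intrinsic_dist S p q =
     (INF g \<in> {g. path g \<and> path_image g \<subseteq> S \<and> pathstart g = p \<and> pathfinish g = q}. path_length g)"

definition intrinsic_diameter :: "'a::metric_space set \<Rightarrow> 'a set \<Rightarrow> ennreal" where
  "intrinsic_diameter S A = (SUP p \<in> A. SUP q \<in> A. intrinsic_dist S p q)"

text \<open>An arc is given by its length and its parametrization by arc length.\<close>

type_synonym unit_speed_arc = "real \<times> (real \<Rightarrow> real^3)"

definition start_tangent :: "unit_speed_arc \<Rightarrow> real^3" where
  "start_tangent = (\<lambda>(L, g). vector_derivative g (at 0 within {0..L}))"

definition end_tangent :: "unit_speed_arc \<Rightarrow> real^3" where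
  "end_tangent = (\<lambda>(L, g). vector_derivative g (at L within {0..L}))"

text \<open>Length-minimizing geodesic segment: a C^1 curve of unit speed whose length is the intrinsic
  distance of its end points.\<close>

definition geodesic_segment :: "(real^3) set \<Rightarrow> real^3 \<Rightarrow> real^3 \<Rightarrow> unit_speed_arc \<Rightarrow> bool" where
  "geodesic_segment S p q = (\<lambda>(L, g). 0 < L \<and> C_k_on 1 g {0..L} \<and>
     (\<forall>r\<in>{0..L}. norm (vector_derivative g (at r within {0..L})) = 1) \<and>
     g ` {0..L} \<subseteq> S \<and> g 0 = p \<and> g L = q \<and> intrinsic_dist S p q = ennreal L)"


section \<open>Total intrinsic curvature\<close>

definition turning_angle :: "real^3 \<Rightarrow> real^3 \<Rightarrow> real" where
  "turning_angle u w = arccos (u \<bullet> w / (norm u * norm w))"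

text \<open>A polygonal with vertices numbered 0, ..., m has the arcs P 0, ..., P (m - 1); only the m - 1
  interior vertices contribute.\<close>

definition rotation :: "nat \<Rightarrow> (nat \<Rightarrow> unit_speed_arc) \<Rightarrow> real" where
  "rotation m P = (\<Sum>i<m - 1. turning_angle (end_tangent (P i)) (start_tangent (P (Suc i))))"

definition inscribed ::
    "(real^3) set \<Rightarrow> real \<Rightarrow> real \<Rightarrow> (real \<Rightarrow> real^3) \<Rightarrow>
     nat \<Rightarrow> (nat \<Rightarrow> real) \<Rightarrow> (nat \<Rightarrow> unit_speed_arc) \<Rightarrow> bool" where
  "inscribed S a b \<gamma> m t P \<longleftrightarrow> 1 \<le> m \<and> strict_mono_on {..m} t \<and> t ` {..m} \<subseteq> {a..b} \<and>
     (\<forall>i<m. geodesic_segment S (\<gamma> (t i)) (\<gamma> (t (Suc i))) (P i))"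

definition modulus :: "(real^3) set \<Rightarrow> (real \<Rightarrow> real^3) \<Rightarrow> nat \<Rightarrow> (nat \<Rightarrow> real) \<Rightarrow> ennreal" where
  "modulus S \<gamma> m t = (MAX i\<in>{..<m}. intrinsic_diameter S (\<gamma> ` {t i..t (Suc i)}))"

text \<open>The supremum is monotone in epsilon, so the limit exists in the extended half-line. Taking
  it makes the restriction to polygonals of small modulus automatic.\<close>

definition total_curvature :: "(real^3) set \<Rightarrow> real \<Rightarrow> real \<Rightarrow> (real \<Rightarrow> real^3) \<Rightarrow> ennreal" where
  "total_curvature S a b \<gamma> = Lim (at_right (0::real)) (\<lambda>\<epsilon>.
     SUP k \<in> {rotation m P | m t P. inscribed S a b \<gamma> m t P \<and> modulus S \<gamma> m t < ennreal \<epsilon>}.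
       ennreal k)"

end

theory Submission
  imports Defs
begin

text \<open>The ruling direction d satisfies d \<bullet> n' = 0, so along the rulings the strip has the same normal n
  as along the curve, and it can be unrolled into the plane: the curve \<gamma> goes to a planar curve with
  curvature the geodesic curvature k, and the ruling d goes to the direction with the same
  coordinates in the planar frame as d has in the frame (t, u). The differentials of the two parametrizations
  differ by the linear isometry J that maps the planar frame to (t, u). Hence ratios of distances in
  space and in the plane tend to 1, lengths of paths are preserved, and the minimizing geodesics
  between close points of \<gamma> are the preimages of straight segments. The turning angles of inscribed
  polygonals are therefore those of polygonals inscribed in the planar curve. The direction
  of a short chord is, by Rolle's theorem, the tangent direction at an intermediate parameter, so the
  rotation is a sum of increments of an antiderivative of k, which converges to the integral
  of its absolute value.\<close>

section \<open>Path length and intrinsic distance\<close>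

text \<open>Lengths are suprema of chord sums and the competitors for the intrinsic distance are
  arbitrary continuous paths. The comparison with the plane therefore cannot integrate a speed; it
  needs estimates of increments, uniform over all pairs of nearby points. The ruling direction is
  built from a derivative of the normal about which nothing beyond existence is derived. Its
  regularity is read off from the C^1 parametrization of the strip, which gives one derivative of d,
  so the comparison rests on mean value estimates along the curve. An arc leaves no room beyond its
  end rulings: the planar chord between two points of the curve must be shown to stay between the
  rulings through them. Transversality of the rulings, which is the immersion condition on the
  curve, gives this by an intermediate value argument. A closed curve is treated on a longer
  parameter interval in which the junction is an interior point. The junction is also the reason why
  a small modulus has to be converted into a small parameter mesh through whole arcs: the two end
  points of a long arc may coincide.\<close>

lemma dist_le_path_length:
  assumes "0 \<le> x" "x \<le> y" "y \<le> 1"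
  shows "ennreal (dist (g x) (g y)) \<le> path_length g"
proof -
  have "(\<Sum>i<length [x,y] - 1. ennreal (dist (g ([x,y] ! i)) (g ([x,y] ! Suc i)))) \<le> path_length g"
    unfolding path_length_def by (rule SUP_upper) (use assms in auto)
  then show ?thesis by simp
qed

lemma path_length_le_lipschitz:
  fixes g :: "real \<Rightarrow> 'a::metric_space"
  assumes "\<And>x y. \<lbrakk>0 \<le> x; x \<le> y; y \<le> 1\<rbrakk> \<Longrightarrow> dist (g x) (g y) \<le> C * (y - x)" and "0 \<le> C"
  shows "path_length g \<le> ennreal C"
  unfolding path_length_def
proof (rule SUP_least)
  fix ts :: "real list" assume "ts \<in> {ts. sorted ts \<and> set ts \<subseteq> {0..1}}"
  then have ts: "sorted ts" "set ts \<subseteq> {0..1}" by auto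
  define n where "n = length ts - 1"
  have b: "ts ! i \<in> {0..1}" if "i \<le> n" "ts \<noteq> []" for i
  proof -
    have "i < length ts" using that by (cases ts) (auto simp: n_def)
    then show ?thesis using ts(2) nth_mem by blast
  qed
  show "(\<Sum>i<length ts - 1. ennreal (dist (g (ts ! i)) (g (ts ! Suc i)))) \<le> ennreal C"
  proof (cases "ts = []")
    case False
    have "(\<Sum>i<n. dist (g (ts ! i)) (g (ts ! Suc i))) \<le> (\<Sum>i<n. C * (ts ! Suc i - ts ! i))"
    proof (rule sum_mono)
      fix i assume "i \<in> {..<n}"
      then have i: "i \<le> n" "Suc i \<le> n" by auto
      have "ts ! i \<le> ts ! Suc i"
        using ts(1) i by (auto simp: n_def intro!: sorted_nth_mono)
      then show "dist (g (ts ! i)) (g (ts ! Suc i)) \<le> C * (ts ! Suc i - ts ! i)"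
        using b[OF i(1) False] b[OF i(2) False] by (intro assms(1)) auto
    qed
    also have "\<dots> = C * (ts ! n - ts ! 0)"
      by (simp add: sum_distrib_left[symmetric] sum_lessThan_telescope)
    also have "\<dots> \<le> C * 1"
      using b[of n] b[of 0] False assms(2) by (intro mult_left_mono) auto
    finally show ?thesis unfolding n_def[symmetric] by (simp add: sum_ennreal ennreal_leI)
  qed simp
qed

text \<open>A subdivision whose consecutive points are closer than \<rho> costs only the factor
  \<open>1 + \<epsilon>\<close>, and \<epsilon> is arbitrary. With the unrolling as \<Phi>, planar
  distances bound the lengths of paths in the strip from below.\<close>

lemma path_length_ge_local:
  fixes g :: "real \<Rightarrow> 'a::metric_space" and \<Phi> :: "'a \<Rightarrow> 'b::metric_space"
  assumes g: "path g" "path_image g \<subseteq> S"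
    and \<Phi>: "\<And>\<epsilon>. \<epsilon> > 0 \<Longrightarrow> \<exists>\<rho>>0. \<forall>p\<in>S. \<forall>q\<in>S. dist p q < \<rho> \<longrightarrow> dist (\<Phi> p) (\<Phi> q) \<le> (1 + \<epsilon>) * dist p q"
  shows "ennreal (dist (\<Phi> (pathstart g)) (\<Phi> (pathfinish g))) \<le> path_length g"
proof -
  have key: "ennreal (dist (\<Phi> (g 0)) (\<Phi> (g 1))) \<le> ennreal (1 + \<epsilon>) * path_length g" if "\<epsilon> > 0" for \<epsilon>
  proof -
    obtain \<rho> where \<rho>: "\<rho> > 0" "\<And>p q. \<lbrakk>p\<in>S; q\<in>S; dist p q < \<rho>\<rbrakk> \<Longrightarrow> dist (\<Phi> p) (\<Phi> q) \<le> (1 + \<epsilon>) * dist p q"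
      using \<Phi>[OF \<open>\<epsilon> > 0\<close>] by blast
    have "uniformly_continuous_on {0..1} g"
      using g(1) by (simp add: path_def compact_uniformly_continuous)
    then obtain d where d: "d > 0" "\<And>x y. \<lbrakk>x\<in>{0..1}; y\<in>{0..1}; dist x y < d\<rbrakk> \<Longrightarrow> dist (g x) (g y) < \<rho>"
      unfolding uniformly_continuous_on_def using \<rho>(1) by (metis dist_commute)
    obtain n where n: "n > 0" "1 / real n < d"
      by (metis d(1) inverse_eq_divide real_arch_inverse zero_less_iff_neq_zero)
    define ts where "ts = map (\<lambda>i. real i / real n) [0..<Suc n]"
    have tsi: "ts ! i = real i / real n" if "i \<le> n" for i
      unfolding ts_def using that by (simp del: upt_Suc add: nth_append)
    have gS: "g (real i / real n) \<in> S" if "i \<le> n" for i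
      using g(2) that n(1) by (auto simp: path_image_def)
    have tri: "dist (\<Phi> (g 0)) (\<Phi> (g (real k / real n)))
        \<le> (\<Sum>i<k. dist (\<Phi> (g (real i / real n))) (\<Phi> (g (real (Suc i) / real n))))" for k
    proof (induction k)
      case (Suc k)
      then show ?case
        using dist_triangle[of "\<Phi> (g 0)" "\<Phi> (g (real (Suc k) / real n))" "\<Phi> (g (real k / real n))"]
        by (simp del: of_nat_Suc)
    qed simp
    have "dist (\<Phi> (g 0)) (\<Phi> (g 1)) \<le> (\<Sum>i<n. dist (\<Phi> (g (real i / real n))) (\<Phi> (g (real (Suc i) / real n))))"
      using tri[of n] n(1) by simp
    also have "\<dots> \<le> (\<Sum>i<n. (1 + \<epsilon>) * dist (g (real i / real n)) (g (real (Suc i) / real n)))"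
    proof (rule sum_mono)
      fix i assume "i \<in> {..<n}"
      then have i: "i < n" by simp
      have "dist (real i / real n) (real (Suc i) / real n) = 1 / real n"
        using n(1) by (simp add: dist_real_def field_simps)
      moreover have "real i / real n \<in> {0..1}" "real (Suc i) / real n \<in> {0..1}"
        using i n(1) by auto
      ultimately have "dist (g (real i / real n)) (g (real (Suc i) / real n)) < \<rho>"
        using d(2) n(2) by presburger
      then show "dist (\<Phi> (g (real i / real n))) (\<Phi> (g (real (Suc i) / real n))) \<le> (1 + \<epsilon>) * dist (g (real i / real n)) (g (real (Suc i) / real n))"
        using \<rho>(2) gS[of i] gS[of "Suc i"] i by auto
    qed
    finally have le: "dist (\<Phi> (g 0)) (\<Phi> (g 1)) \<le> (1 + \<epsilon>) * (\<Sum>i<n. dist (g (real i / real n)) (g (real (Suc i) / real n)))"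
      by (simp add: sum_distrib_left)
    have "ennreal (\<Sum>i<n. dist (g (real i / real n)) (g (real (Suc i) / real n)))
        = (\<Sum>i<length ts - 1. ennreal (dist (g (ts ! i)) (g (ts ! Suc i))))"
    proof -
      have "length ts - 1 = n" by (simp add: ts_def)
      then show ?thesis by (simp add: tsi sum_ennreal Suc_leI del: of_nat_Suc)
    qed
    also have "\<dots> \<le> path_length g"
      unfolding path_length_def
    proof (rule SUP_upper, safe)
      show "sorted ts"
        unfolding ts_def by (auto simp: sorted_iff_nth_mono n(1) divide_right_mono simp del: upt_Suc)
      show "x \<in> {0..1}" if "x \<in> set ts" for x
        using that n(1) by (auto simp: ts_def)
    qed
    finally have s: "ennreal (\<Sum>i<n. dist (g (real i / real n)) (g (real (Suc i) / real n))) \<le> path_length g" .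
    have "ennreal (dist (\<Phi> (g 0)) (\<Phi> (g 1))) \<le> ennreal (1 + \<epsilon>) * ennreal (\<Sum>i<n. dist (g (real i / real n)) (g (real (Suc i) / real n)))"
      using le \<open>\<epsilon> > 0\<close>
      by (subst ennreal_mult'[symmetric]) (auto intro: ennreal_leI sum_nonneg simp del: ennreal_plus)
    also have "\<dots> \<le> ennreal (1 + \<epsilon>) * path_length g"
      using s by (rule mult_left_mono) simp
    finally show ?thesis .
  qed
  show ?thesis
  proof (cases "path_length g")
    case (real r)
    have "dist (\<Phi> (g 0)) (\<Phi> (g 1)) \<le> r"
    proof (rule field_le_epsilon)
      fix e :: real assume "e > 0"
      \<comment> \<open>The summand 1 guards against a path of length 0.\<close>
      define \<epsilon> where "\<epsilon> = e / (r + 1)"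
      have "\<epsilon> > 0" using \<open>e > 0\<close> real by (simp add: \<epsilon>_def)
      have "ennreal (dist (\<Phi> (g 0)) (\<Phi> (g 1))) \<le> ennreal ((1 + \<epsilon>) * r)"
        using key[OF \<open>\<epsilon> > 0\<close>] real \<open>\<epsilon> > 0\<close> by (simp add: ennreal_mult)
      then have "dist (\<Phi> (g 0)) (\<Phi> (g 1)) \<le> (1 + \<epsilon>) * r"
        using real \<open>\<epsilon> > 0\<close> by (subst (asm) ennreal_le_iff) auto
      also have "\<epsilon> * r \<le> e" using \<open>e > 0\<close> real by (simp add: \<epsilon>_def field_simps)
      then have "(1 + \<epsilon>) * r \<le> r + e" by (simp add: algebra_simps)
      finally show "dist (\<Phi> (g 0)) (\<Phi> (g 1)) \<le> r + e" .
    qed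
    then show ?thesis using real by (simp add: pathstart_def pathfinish_def ennreal_leI)
  qed simp
qed

lemma dist_le_intrinsic_dist: "ennreal (dist p q) \<le> intrinsic_dist S p q"
  unfolding intrinsic_dist_def
proof (rule INF_greatest)
  fix g assume "g \<in> {g. path g \<and> path_image g \<subseteq> S \<and> pathstart g = p \<and> pathfinish g = q}"
  then show "ennreal (dist p q) \<le> path_length g"
    using dist_le_path_length[of 0 1 g] by (auto simp: pathstart_def pathfinish_def)
qed

lemma intrinsic_dist_le_lipschitz:
  fixes g :: "real \<Rightarrow> 'a::metric_space"
  assumes lip: "\<And>x y. \<lbrakk>0 \<le> x; x \<le> y; y \<le> L\<rbrakk> \<Longrightarrow> dist (g x) (g y) \<le> y - x"
    and "0 \<le> L" "g ` {0..L} \<subseteq> S" "g 0 = p" "g L = q"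
  shows "intrinsic_dist S p q \<le> ennreal L"
proof -
  define f where "f = (\<lambda>x. g (L * x))"
  have fl: "dist (f x) (f y) \<le> L * (y - x)" if "0 \<le> x" "x \<le> y" "y \<le> 1" for x y
    using lip[of "L * x" "L * y"] that assms(2)
    by (auto simp: f_def algebra_simps mult_left_mono mult_left_le)
  have "continuous_on {0..1} f"
  proof (rule lipschitz_on_continuous_on)
    show "L-lipschitz_on {0..1} f"
    proof (rule lipschitz_onI)
      fix x y :: real assume "x \<in> {0..1}" "y \<in> {0..1}"
      then show "dist (f x) (f y) \<le> L * dist x y"
        using fl[of x y] fl[of y x] by (cases "x \<le> y") (auto simp: dist_real_def dist_commute)
    qed fact
  qed
  moreover have "f ` {0..1} \<subseteq> S"
    using assms(2,3) by (auto simp: f_def image_subset_iff mult_left_le)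
  ultimately have "f \<in> {g. path g \<and> path_image g \<subseteq> S \<and> pathstart g = p \<and> pathfinish g = q}"
    using assms(4,5) by (auto simp: path_def path_image_def pathstart_def pathfinish_def f_def)
  then have "intrinsic_dist S p q \<le> path_length f"
    unfolding intrinsic_dist_def by (rule INF_lower)
  also have "\<dots> \<le> ennreal L" by (rule path_length_le_lipschitz[OF fl assms(2)])
  finally show ?thesis .
qed

text \<open>A continuous function is still the integral of a derivative that is missing at finitely
  many points. The exceptional points will be the junctions of a closed curve.\<close>

lemma norm_diff_le_finite_exceptions:
  fixes f :: "real \<Rightarrow> 'a::banach"
  assumes "finite K" "x \<le> y" "continuous_on {x..y} f"
    and der: "\<And>s. s \<in> {x<..<y} - K \<Longrightarrow> (f has_vector_derivative f' s) (at s)"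
    and bnd: "\<And>s. s \<in> {x<..<y} - K \<Longrightarrow> norm (f' s) \<le> B" and "0 \<le> B"
  shows "norm (f y - f x) \<le> B * (y - x)"
proof -
  have "(f' has_integral (f y - f x)) {x..y}"
    using assms(1,2,3) der by (intro fundamental_theorem_of_calculus_interior_strong[of K]) auto
  then have "norm (f y - f x) \<le> B * Henstock_Kurzweil_Integration.content {x..y}"
    using bnd assms(1,6)
    by (intro has_integral_bound_real[of B "K \<union> {x,y}" f']) auto
  then show ?thesis using assms(2) by simp
qed

section \<open>Chord polygonals of a planar curve\<close>

lemma mvt_within_Icc:
  fixes f :: "real \<Rightarrow> real"
  assumes "\<And>s. s \<in> {a..b} \<Longrightarrow> (f has_real_derivative f' s) (at s within {a..b})"
    and "a \<le> x" "x < y" "y \<le> b"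
  obtains z where "x < z" "z < y" "f y - f x = f' z * (y - x)"
proof -
  have "\<exists>z\<in>{x<..<y}. f y - f x = (\<lambda>h. f' z * h) (y - x)"
  proof (rule mvt_simple[OF \<open>x < y\<close>])
    fix s assume "x \<le> s" "s \<le> y"
    then show "(f has_derivative (*) (f' s)) (at s within {x..y})"
      using assms(1)[of s] assms(2-4)
      by (auto simp: has_field_derivative_def intro: has_derivative_subset)
  qed
  then show ?thesis using that by auto
qed

text \<open>Rolle's theorem yields only a tangent parallel to the chord. The bound on the
  oscillation selects the orientation and at the same time excludes a vanishing chord.\<close>

lemma chord_direction:
  fixes \<kappa> :: "real \<Rightarrow> real" and Y :: "real \<Rightarrow> complex"
  assumes Y: "\<And>s. s \<in> {a..b} \<Longrightarrow> (Y has_vector_derivative cis (\<kappa> s)) (at s within {a..b})"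
    and ab: "a \<le> x" "x < y" "y \<le> b"
    and osc: "\<And>s s'. \<lbrakk>s \<in> {x..y}; s' \<in> {x..y}\<rbrakk> \<Longrightarrow> \<bar>\<kappa> s - \<kappa> s'\<bar> < pi / 2"
  obtains \<xi> where "x < \<xi>" "\<xi> < y" "sgn (Y y - Y x) = cis (\<kappa> \<xi>)"
proof -
  define c where "c = Y y - Y x"
  have lin: "((\<lambda>s. Im (w * Y s)) has_real_derivative Im (w * cis (\<kappa> s))) (at s within {a..b})"
            "((\<lambda>s. Re (w * Y s)) has_real_derivative Re (w * cis (\<kappa> s))) (at s within {a..b})"
    if "s \<in> {a..b}" for w s
    unfolding has_real_derivative_iff_has_vector_derivative
    using bounded_linear.has_vector_derivative[OF bounded_linear_Im has_vector_derivative_mult_right[OF Y[OF that]], of w]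
      bounded_linear.has_vector_derivative[OF bounded_linear_Re has_vector_derivative_mult_right[OF Y[OF that]], of w]
    by auto
  \<comment> \<open>The component of Y orthogonal to the chord has equal values at x and y, since
    its increment is \<open>Im (cnj c * c)\<close>, which is 0.\<close>
  obtain \<xi> where \<xi>: "x < \<xi>" "\<xi> < y" "Im (cnj c * Y y) - Im (cnj c * Y x) = Im (cnj c * cis (\<kappa> \<xi>)) * (y - x)"
    using mvt_within_Icc[OF lin(1) ab] by blast
  have "Im (cnj c * Y y) - Im (cnj c * Y x) = Im (cnj c * c)"
    by (simp add: c_def algebra_simps)
  then have Im0: "Im (cnj c * cis (\<kappa> \<xi>)) = 0" using \<xi> by simp
  \<comment> \<open>Mean value theorem in the direction of the tangent at \<xi>: every tangent on
    the interval makes an acute angle with it, hence so does the chord.\<close>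
  obtain z where z: "x < z" "z < y" "Re (cis (- \<kappa> \<xi>) * Y y) - Re (cis (- \<kappa> \<xi>) * Y x) = Re (cis (- \<kappa> \<xi>) * cis (\<kappa> z)) * (y - x)"
    using mvt_within_Icc[OF lin(2) ab] by blast
  have "Re (cis (- \<kappa> \<xi>) * cis (\<kappa> z)) > 0"
  proof -
    have "\<bar>\<kappa> z - \<kappa> \<xi>\<bar> < pi / 2" using osc[of z \<xi>] z(1,2) \<xi>(1,2) by simp
    then have "cos (\<kappa> z - \<kappa> \<xi>) > 0" unfolding abs_less_iff by (intro cos_gt_zero_pi) linarith+
    then show ?thesis unfolding cis_mult by simp
  qed
  then have "Re (cis (- \<kappa> \<xi>) * Y y) - Re (cis (- \<kappa> \<xi>) * Y x) > 0"
    unfolding z(3) using ab by (intro mult_pos_pos) auto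
  then have "Re (cis (- \<kappa> \<xi>) * c) > 0"
    by (simp add: c_def algebra_simps)
  then have pos: "Re (cnj c * cis (\<kappa> \<xi>)) > 0" by (simp add: algebra_simps)
  define r where "r = Re (cnj c * cis (\<kappa> \<xi>))"
  have "cnj c * cis (\<kappa> \<xi>) = of_real r"
    using Im0 by (simp add: complex_eq_iff r_def)
  then have "cnj c * (cis (\<kappa> \<xi>) * cis (- \<kappa> \<xi>)) = of_real r * cis (- \<kappa> \<xi>)"
    by (metis mult.assoc)
  then have "cnj c = of_real r * cis (- \<kappa> \<xi>)" by (simp add: cis_mult)
  then have "c = of_real r * cis (\<kappa> \<xi>)"
    by (metis cis_cnj complex_cnj_cnj complex_cnj_complex_of_real complex_cnj_mult minus_minus)
  then have "sgn c = cis (\<kappa> \<xi>)"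
    using pos unfolding r_def[symmetric] by (simp add: sgn_mult sgn_eq norm_mult)
  then show ?thesis using that \<xi> by (simp add: c_def)
qed

lemma arccos_cis_inner:
  assumes "\<bar>x - y\<bar> \<le> pi"
  shows "arccos (cis x \<bullet> cis y) = \<bar>x - y\<bar>"
proof -
  have "cis x \<bullet> cis y = cos (x - y)"
    by (simp add: inner_complex_def cos_diff)
  then show ?thesis using arccos_cos_eq_abs[OF assms] by simp
qed

text \<open>Oscillation below \<open>pi / 2\<close> on each mesh interval serves twice. It makes
  \<open>chord_direction\<close> applicable; and as the two intermediate parameters are both
  compared with the common vertex \<open>t (Suc i)\<close>, their angles differ by less than pi,
  where \<open>arccos\<close> returns the difference without folding it.\<close>

lemma planar_turning_angles:
  fixes \<kappa> :: "real \<Rightarrow> real" and Y :: "real \<Rightarrow> complex"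
  assumes Y: "\<And>s. s \<in> {a..b} \<Longrightarrow> (Y has_vector_derivative cis (\<kappa> s)) (at s within {a..b})"
    and "continuous_on {a..b} \<kappa>"
  shows "\<exists>\<rho>>0. \<forall>m t. strict_mono_on {..m} t \<and> t ` {..m} \<subseteq> {a..b} \<and> (\<forall>i<m. t (Suc i) - t i < \<rho>) \<longrightarrow>
     (\<exists>\<xi>. (\<forall>i<m. t i < \<xi> i \<and> \<xi> i < t (Suc i)) \<and>
       (\<forall>i<m - 1. arccos (sgn (Y (t (Suc i)) - Y (t i)) \<bullet> sgn (Y (t (Suc (Suc i))) - Y (t (Suc i))))
          = \<bar>\<kappa> (\<xi> (Suc i)) - \<kappa> (\<xi> i)\<bar>))"
proof -
  have "uniformly_continuous_on {a..b} \<kappa>"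
    using assms(2) by (simp add: compact_uniformly_continuous)
  then obtain \<rho> where \<rho>: "\<rho> > 0" "\<And>x y. \<lbrakk>x\<in>{a..b}; y\<in>{a..b}; dist x y < \<rho>\<rbrakk> \<Longrightarrow> dist (\<kappa> x) (\<kappa> y) < pi / 2"
    unfolding uniformly_continuous_on_def using pi_half_gt_zero by (metis dist_commute)
  show ?thesis
  proof (intro exI[of _ \<rho>] conjI \<rho>(1) allI impI, elim conjE)
    fix m t assume t: "strict_mono_on {..m} t" "t ` {..m} \<subseteq> {a..b}" "\<forall>i<m. t (Suc i) - t i < \<rho>"
    have bd: "a \<le> t i" "t i < t (Suc i)" "t (Suc i) \<le> b" if "i < m" for i
      using t(1,2) that by (auto simp: image_subset_iff strict_mono_on_def)
    have "\<exists>x. t i < x \<and> x < t (Suc i) \<and> sgn (Y (t (Suc i)) - Y (t i)) = cis (\<kappa> x)" if "i < m" for i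
    proof (rule chord_direction[OF Y bd[OF that]])
      fix s s' assume "s \<in> {t i..t (Suc i)}" "s' \<in> {t i..t (Suc i)}"
      moreover have "t (Suc i) - t i < \<rho>" using t(3) that by simp
      ultimately show "\<bar>\<kappa> s - \<kappa> s'\<bar> < pi / 2"
        using \<rho>(2)[of s s'] bd[OF that] by (auto simp: dist_real_def)
    qed auto
    then obtain \<xi> where \<xi>: "\<And>i. i < m \<Longrightarrow> t i < \<xi> i \<and> \<xi> i < t (Suc i) \<and> sgn (Y (t (Suc i)) - Y (t i)) = cis (\<kappa> (\<xi> i))"
      by metis
    have "arccos (sgn (Y (t (Suc i)) - Y (t i)) \<bullet> sgn (Y (t (Suc (Suc i))) - Y (t (Suc i)))) = \<bar>\<kappa> (\<xi> (Suc i)) - \<kappa> (\<xi> i)\<bar>"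
      if "i < m - 1" for i
    proof -
      have i: "i < m" "Suc i < m" using that by auto
      have near: "\<bar>\<kappa> (\<xi> j) - \<kappa> (t (Suc i))\<bar> < pi / 2" if "j = i \<or> j = Suc i" for j
      proof -
        have "\<xi> j \<in> {a..b}" "t (Suc i) \<in> {a..b}" "dist (\<xi> j) (t (Suc i)) < \<rho>"
          using \<xi>[OF i(1)] \<xi>[OF i(2)] bd[OF i(1)] bd[OF i(2)] t(3)[rule_format, OF i(1)] t(3)[rule_format, OF i(2)] that
          by (auto simp: dist_real_def)
        then show ?thesis using \<rho>(2)[of "\<xi> j" "t (Suc i)"] by (simp add: dist_real_def)
      qed
      have "\<bar>\<kappa> (\<xi> i) - \<kappa> (\<xi> (Suc i))\<bar> \<le> pi" using near[of i] near[of "Suc i"] by linarith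
      then show ?thesis using \<xi>[OF i(1)] \<xi>[OF i(2)] arccos_cis_inner by (simp add: abs_minus_commute)
    qed
    then show "\<exists>\<xi>. (\<forall>i<m. t i < \<xi> i \<and> \<xi> i < t (Suc i)) \<and>
       (\<forall>i<m - 1. arccos (sgn (Y (t (Suc i)) - Y (t i)) \<bullet> sgn (Y (t (Suc (Suc i))) - Y (t (Suc i))))
          = \<bar>\<kappa> (\<xi> (Suc i)) - \<kappa> (\<xi> i)\<bar>)"
      using \<xi> by blast
  qed
qed

section \<open>Increments of an antiderivative and the integral of the absolute value\<close>

context
  fixes \<kappa> k :: "real \<Rightarrow> real" and a b :: real
  assumes \<kappa>: "\<And>s. s \<in> {a..b} \<Longrightarrow> (\<kappa> has_real_derivative k s) (at s within {a..b})"
    and k: "continuous_on {a..b} k"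
begin

definition variation_fun :: "real \<Rightarrow> real" where
  "variation_fun s = integral {a..s} (\<lambda>x. \<bar>k x\<bar>)"

lemma variation_fun_deriv:
  "s \<in> {a..b} \<Longrightarrow> (variation_fun has_real_derivative \<bar>k s\<bar>) (at s within {a..b})"
  unfolding variation_fun_def
  by (rule integral_has_real_derivative) (use k in \<open>auto intro!: continuous_intros\<close>)

lemma variation_fun_mono:
  assumes "a \<le> x" "x \<le> y" "y \<le> b"
  shows "variation_fun x \<le> variation_fun y"
proof (cases "x = y")
  case False
  then have "x < y" using assms by simp
  then obtain z where "variation_fun y - variation_fun x = \<bar>k z\<bar> * (y - x)"
    using mvt_within_Icc[OF variation_fun_deriv assms(1) _ assms(3)] by blast
  moreover have "\<bar>k z\<bar> * (y - x) \<ge> 0" using \<open>x < y\<close> by simp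
  ultimately show ?thesis by linarith
qed simp

text \<open>Both \<open>variation_fun - \<kappa>\<close> and \<open>variation_fun + \<kappa>\<close>
  are nondecreasing, with derivatives \<open>\<bar>k\<bar> - k\<close> and
  \<open>\<bar>k\<bar> + k\<close>; the sign is the factor c in the proof.\<close>

lemma abs_diff_le_variation:
  assumes "a \<le> x" "x \<le> y" "y \<le> b"
  shows "\<bar>\<kappa> y - \<kappa> x\<bar> \<le> variation_fun y - variation_fun x"
proof (cases "x = y")
  case False
  then have xy: "x < y" using assms by simp
  have "0 \<le> (variation_fun y - c * \<kappa> y) - (variation_fun x - c * \<kappa> x)" if "\<bar>c\<bar> = 1" for c
  proof -
    have "((\<lambda>s. variation_fun s - c * \<kappa> s) has_real_derivative (\<bar>k s\<bar> - c * k s)) (at s within {a..b})"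
      if "s \<in> {a..b}" for s
      using that by (auto intro!: derivative_eq_intros variation_fun_deriv \<kappa>)
    from mvt_within_Icc[OF this assms(1) xy assms(3)] obtain z where
      z: "(variation_fun y - c * \<kappa> y) - (variation_fun x - c * \<kappa> x) = (\<bar>k z\<bar> - c * k z) * (y - x)"
      by blast
    have "c * k z \<le> \<bar>k z\<bar>" using that by (metis abs_ge_self abs_mult mult_1)
    then show ?thesis unfolding z using xy by simp
  qed
  from this[of 1] this[of "-1"] show ?thesis by simp
qed simp

lemma sum_abs_diff_le_integral:
  assumes "\<And>i. i \<le> n \<Longrightarrow> \<xi> i \<in> {a..b}" "\<And>i. i < n \<Longrightarrow> \<xi> i \<le> \<xi> (Suc i)"
  shows "(\<Sum>i<n. \<bar>\<kappa> (\<xi> (Suc i)) - \<kappa> (\<xi> i)\<bar>) \<le> integral {a..b} (\<lambda>x. \<bar>k x\<bar>)"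
proof -
  have "(\<Sum>i<n. \<bar>\<kappa> (\<xi> (Suc i)) - \<kappa> (\<xi> i)\<bar>) \<le> (\<Sum>i<n. variation_fun (\<xi> (Suc i)) - variation_fun (\<xi> i))"
    using assms by (intro sum_mono abs_diff_le_variation) (auto simp: Suc_le_eq)
  also have "\<dots> = variation_fun (\<xi> n) - variation_fun (\<xi> 0)"
    by (rule sum_lessThan_telescope)
  also have "\<dots> \<le> variation_fun b - variation_fun a"
    using assms(1)[of n] assms(1)[of 0] by (intro diff_mono variation_fun_mono) auto
  also have "\<dots> = integral {a..b} (\<lambda>x. \<bar>k x\<bar>)" by (simp add: variation_fun_def)
  finally show ?thesis .
qed

text \<open>The points \<xi> will be intermediate parameters, which do not reach a and b; hence the
  conditions on the two end gaps. The error e is split into \<open>e / 2\<close> for all steps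
  together and \<open>e / 4\<close> for each gap.\<close>

lemma sum_abs_diff_ge_integral:
  assumes "a < b" "e > 0"
  shows "\<exists>\<rho>>0. \<forall>n \<xi>. (\<forall>i\<le>n. \<xi> i \<in> {a..b}) \<and> (\<forall>i<n. \<xi> i < \<xi> (Suc i) \<and> \<xi> (Suc i) - \<xi> i < \<rho>)
     \<and> \<xi> 0 - a < \<rho> \<and> b - \<xi> n < \<rho>
     \<longrightarrow> integral {a..b} (\<lambda>x. \<bar>k x\<bar>) - e \<le> (\<Sum>i<n. \<bar>\<kappa> (\<xi> (Suc i)) - \<kappa> (\<xi> i)\<bar>)"
proof -
  define e' where "e' = e / (2 * (b - a))"
  have e': "e' > 0" using assms by (simp add: e'_def)
  have "compact (k ` {a..b})" using k by (intro compact_continuous_image) auto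
  then obtain K where K: "K > 0" "\<And>s. s \<in> {a..b} \<Longrightarrow> \<bar>k s\<bar> \<le> K"
    using compact_imp_bounded[of "k ` {a..b}"] unfolding bounded_pos by auto
  have "uniformly_continuous_on {a..b} k" using k by (simp add: compact_uniformly_continuous)
  then obtain \<rho> where \<rho>: "\<rho> > 0" "\<And>x y. \<lbrakk>x\<in>{a..b}; y\<in>{a..b}; dist x y < \<rho>\<rbrakk> \<Longrightarrow> dist (k x) (k y) < e'"
    unfolding uniformly_continuous_on_def using e' by (metis dist_commute)
  \<comment> \<open>Since K bounds the absolute value of k, a gap shorter than
    \<open>e / (4 * K)\<close> carries variation at most \<open>e / 4\<close>.\<close>
  define \<rho>' where "\<rho>' = min \<rho> (e / (4 * K))"
  have \<rho>': "\<rho>' > 0" "\<rho>' \<le> \<rho>" "K * \<rho>' \<le> e / 4"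
    using \<rho>(1) assms(2) K(1) by (auto simp: \<rho>'_def min_def field_simps)
  \<comment> \<open>The two increments are values of k at different intermediate points z and w;
    uniform continuity brings these values within e' of each other.\<close>
  have step: "variation_fun y - variation_fun x - e' * (y - x) \<le> \<bar>\<kappa> y - \<kappa> x\<bar>"
    if xy: "a \<le> x" "x < y" "y \<le> b" "y - x < \<rho>'" for x y
  proof -
    obtain z where z: "x < z" "z < y" "\<kappa> y - \<kappa> x = k z * (y - x)"
      using mvt_within_Icc[OF \<kappa> xy(1-3)] by blast
    obtain w where w: "x < w" "w < y" "variation_fun y - variation_fun x = \<bar>k w\<bar> * (y - x)"
      using mvt_within_Icc[OF variation_fun_deriv xy(1-3)] by blast
    have "dist (k w) (k z) < e'"
      using xy w(1,2) z(1,2) \<rho>'(2) by (intro \<rho>(2)) (auto simp: dist_real_def)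
    then have "\<bar>k w\<bar> - e' \<le> \<bar>k z\<bar>" by (auto simp: dist_real_def)
    then have "(\<bar>k w\<bar> - e') * (y - x) \<le> \<bar>k z\<bar> * (y - x)" using xy by (intro mult_right_mono) auto
    then show ?thesis unfolding z(3) w(3) using xy by (simp add: abs_mult algebra_simps)
  qed
  have ends: "variation_fun y - variation_fun x \<le> e / 4" if "a \<le> x" "x \<le> y" "y \<le> b" "y - x < \<rho>'" for x y
  proof (cases "x = y")
    case False
    then have "x < y" using that by simp
    then obtain w where w: "x < w" "w < y" "variation_fun y - variation_fun x = \<bar>k w\<bar> * (y - x)"
      using mvt_within_Icc[OF variation_fun_deriv \<open>a \<le> x\<close> _ \<open>y \<le> b\<close>] by blast
    have "\<bar>k w\<bar> * (y - x) \<le> K * \<rho>'" using K w that by (intro mult_mono) auto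
    then show ?thesis using w(3) \<rho>'(3) by simp
  qed (use assms in simp)
  show ?thesis
  proof (intro exI[of _ \<rho>'] conjI \<rho>'(1) allI impI, elim conjE)
    fix n \<xi> assume \<xi>: "\<forall>i\<le>n. \<xi> i \<in> {a..b}" "\<forall>i<n. \<xi> i < \<xi> (Suc i) \<and> \<xi> (Suc i) - \<xi> i < \<rho>'"
      "\<xi> 0 - a < \<rho>'" "b - \<xi> n < \<rho>'"
    have "(\<Sum>i<n. (variation_fun (\<xi> (Suc i)) - variation_fun (\<xi> i)) - e' * (\<xi> (Suc i) - \<xi> i))
        \<le> (\<Sum>i<n. \<bar>\<kappa> (\<xi> (Suc i)) - \<kappa> (\<xi> i)\<bar>)"
      using \<xi>(1,2) by (intro sum_mono step) (auto simp: Suc_le_eq)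
    moreover have "(\<Sum>i<n. (variation_fun (\<xi> (Suc i)) - variation_fun (\<xi> i)) - e' * (\<xi> (Suc i) - \<xi> i))
      = (variation_fun (\<xi> n) - variation_fun (\<xi> 0)) - e' * (\<xi> n - \<xi> 0)"
      unfolding sum_subtractf[of "\<lambda>i. variation_fun (\<xi> (Suc i)) - variation_fun (\<xi> i)"] sum_distrib_left[symmetric]
      by (simp only: sum_lessThan_telescope[of "\<lambda>i. variation_fun (\<xi> i)"] sum_lessThan_telescope[of \<xi>])
    moreover have "variation_fun b - variation_fun (\<xi> n) \<le> e / 4" "variation_fun (\<xi> 0) - variation_fun a \<le> e / 4"
      using ends[of "\<xi> n" b] ends[of a "\<xi> 0"] \<xi>(3,4) \<xi>(1)[rule_format, of n] \<xi>(1)[rule_format, of 0] by auto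
    moreover have "e' * (\<xi> n - \<xi> 0) \<le> e' * (b - a)"
      using \<xi>(1)[rule_format, of n] \<xi>(1)[rule_format, of 0] e' by (intro mult_left_mono) auto
    moreover have "e' * (b - a) = e / 2"
    proof -
      have "b - a \<noteq> 0" using assms by simp
      then show ?thesis by (simp add: e'_def divide_simps)
    qed
    moreover have "integral {a..b} (\<lambda>x. \<bar>k x\<bar>) = variation_fun b - variation_fun a"
      by (simp add: variation_fun_def)
    ultimately show "integral {a..b} (\<lambda>x. \<bar>k x\<bar>) - e \<le> (\<Sum>i<n. \<bar>\<kappa> (\<xi> (Suc i)) - \<kappa> (\<xi> i)\<bar>)"
      by linarith
  qed
qed

end

section \<open>Unrolling the strip\<close>

lemma bounded_bilinear_cross3: "bounded_bilinear cross3"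
  using bilinear_cross bilinear_conv_bounded_bilinear by blast

text \<open>The remainder x is orthogonal to n, t and u. Lagrange's identity turns orthogonality to
  n and t into \<open>cross3 x u = 0\<close>, and a vector both parallel and orthogonal to a nonzero
  u vanishes.\<close>

lemma orthonormal_frame_expansion:
  fixes n t w :: "real^3"
  assumes "norm n = 1" "norm t = 1" "n \<bullet> t = 0" "w \<bullet> n = 0"
  shows "w = (w \<bullet> t) *\<^sub>R t + (w \<bullet> cross3 n t) *\<^sub>R cross3 n t"
proof -
  define u where "u = cross3 n t"
  define x where "x = w - (w \<bullet> t) *\<^sub>R t - (w \<bullet> u) *\<^sub>R u"
  have tt: "t \<bullet> t = 1" using assms by (simp add: dot_square_norm)
  have "(norm u)\<^sup>2 = 1" using assms norm_cross[of n t] by (simp add: u_def)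
  then have uu: "u \<bullet> u = 1" "u \<noteq> 0" by (auto simp: power2_norm_eq_inner)
  have tu: "t \<bullet> u = 0" "u \<bullet> t = 0" "n \<bullet> u = 0" "u \<bullet> n = 0" by (auto simp: u_def dot_cross_self)
  have "x \<bullet> t = 0" "x \<bullet> u = 0" "x \<bullet> n = 0"
    using tt uu tu assms by (auto simp: x_def inner_diff_left inner_commute[of t n])
  then have "cross3 x u = 0" unfolding u_def by (simp add: Lagrange)
  with \<open>x \<bullet> u = 0\<close> uu(2) have "x = 0" using norm_and_cross_eq_0 by blast
  then show ?thesis by (simp add: x_def u_def algebra_simps)
qed

text \<open>The exceptional set K is needed for closed curves: only one-sided derivatives of the ruling
  direction d are available at the junctions of the periodic extension.\<close>

locale unrolled_strip =
  fixes A B L :: real and \<gamma> t t2 n n1 d d1 :: "real \<Rightarrow> real^3" and K :: "real set"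
  assumes AB: "A < B"
    and \<gamma>_deriv: "\<And>s. s \<in> {A..B} \<Longrightarrow> (\<gamma> has_vector_derivative t s) (at s within {A..B})"
    and t_deriv: "\<And>s. s \<in> {A..B} \<Longrightarrow> (t has_vector_derivative t2 s) (at s within {A..B})"
    and t2_cont: "continuous_on {A..B} t2"
    and n_deriv: "\<And>s. s \<in> {A..B} \<Longrightarrow> (n has_vector_derivative n1 s) (at s within {A..B})"
    and norm_t: "\<And>s. s \<in> {A..B} \<Longrightarrow> norm (t s) = 1"
    and norm_n: "\<And>s. s \<in> {A..B} \<Longrightarrow> norm (n s) = 1"
    and n_t: "\<And>s. s \<in> {A..B} \<Longrightarrow> n s \<bullet> t s = 0"
    and norm_d: "\<And>s. s \<in> {A..B} \<Longrightarrow> norm (d s) = 1"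
    and d_n: "\<And>s. s \<in> {A..B} \<Longrightarrow> d s \<bullet> n s = 0"
    and d_n1: "\<And>s. s \<in> {A..B} \<Longrightarrow> d s \<bullet> n1 s = 0"
    and transversal: "\<And>s. s \<in> {A..B} \<Longrightarrow> d s \<bullet> cross3 (n s) (t s) \<noteq> 0"
    and d_cont: "continuous_on {A..B} d"
    and finite_K: "finite K"
    and d_deriv: "\<And>s. s \<in> {A<..<B} - K \<Longrightarrow> (d has_vector_derivative d1 s) (at s)"
    and d1_le: "\<And>s. s \<in> {A<..<B} - K \<Longrightarrow> norm (d1 s) \<le> L"
    and L0: "0 \<le> L"
begin

text \<open>Y0 and e are the unrolled curve and ruling direction, so Y is the unrolling of X.\<close>

definition u :: "real \<Rightarrow> real^3" where "u s = cross3 (n s) (t s)"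
definition kg :: "real \<Rightarrow> real" where "kg s = t2 s \<bullet> u s"
definition \<kappa> :: "real \<Rightarrow> real" where "\<kappa> s = integral {A..s} kg"
definition Y0 :: "real \<Rightarrow> complex" where "Y0 s = integral {A..s} (\<lambda>x. cis (\<kappa> x))"
definition e :: "real \<Rightarrow> complex" where "e s = Complex (d s \<bullet> t s) (d s \<bullet> u s) * cis (\<kappa> s)"
definition X :: "real \<Rightarrow> real \<Rightarrow> real^3" where "X s v = \<gamma> s + v *\<^sub>R d s"
definition Y :: "real \<Rightarrow> real \<Rightarrow> complex" where "Y s v = Y0 s + v *\<^sub>R e s"

text \<open>Multiplication by \<open>cis (- \<kappa> s)\<close> produces the coordinates in the
  moving planar frame \<open>cis (\<kappa> s)\<close>, \<open>\<i> * cis (\<kappa> s)\<close>, which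
  are then used as coordinates in the frame \<open>t s\<close>, \<open>u s\<close>.\<close>

definition J :: "real \<Rightarrow> complex \<Rightarrow> real^3" where
  "J s z = Re (z * cis (- \<kappa> s)) *\<^sub>R t s + Im (z * cis (- \<kappa> s)) *\<^sub>R u s"

lemma cont: "continuous_on {A..B} \<gamma>" "continuous_on {A..B} t" "continuous_on {A..B} n"
  using continuous_on_vector_derivative[OF \<gamma>_deriv] continuous_on_vector_derivative[OF t_deriv]
    continuous_on_vector_derivative[OF n_deriv] by auto

lemma u_cont: "continuous_on {A..B} u"
  unfolding u_def by (intro continuous_on_cross cont)

lemma kg_cont: "continuous_on {A..B} kg"
  unfolding kg_def by (intro continuous_intros t2_cont u_cont)

lemma \<kappa>_deriv: "s \<in> {A..B} \<Longrightarrow> (\<kappa> has_real_derivative kg s) (at s within {A..B})"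
  unfolding \<kappa>_def by (rule integral_has_real_derivative[OF kg_cont])

lemma \<kappa>_cont: "continuous_on {A..B} \<kappa>"
  using \<kappa>_deriv by (intro DERIV_continuous_on) auto

lemma cis_cont: "continuous_on {A..B} (\<lambda>s. cis (\<kappa> s))" "continuous_on {A..B} (\<lambda>s. cis (- \<kappa> s))"
  by (auto intro!: continuous_intros \<kappa>_cont)

lemma Y0_deriv: "s \<in> {A..B} \<Longrightarrow> (Y0 has_vector_derivative cis (\<kappa> s)) (at s within {A..B})"
  unfolding Y0_def by (rule integral_has_vector_derivative[OF cis_cont(1)])

lemma Y0_cont: "continuous_on {A..B} Y0"
  using continuous_on_vector_derivative[OF Y0_deriv] by auto

lemma e_cont: "continuous_on {A..B} e"
proof -
  have "e = (\<lambda>s. (of_real (d s \<bullet> t s) + \<i> * of_real (d s \<bullet> u s)) * cis (\<kappa> s))"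
    by (simp add: e_def Complex_eq fun_eq_iff)
  then show ?thesis by (auto intro!: continuous_intros d_cont cont u_cont cis_cont)
qed

lemma frame:
  assumes "s \<in> {A..B}"
  shows "t s \<bullet> t s = 1" "u s \<bullet> u s = 1" "t s \<bullet> u s = 0" "u s \<bullet> t s = 0" "norm (u s) = 1"
    "n s \<bullet> u s = 0" "u s \<bullet> n s = 0"
proof -
  show tt: "t s \<bullet> t s = 1" using norm_t[OF assms] by (simp add: dot_square_norm)
  have "(norm (u s))\<^sup>2 = 1" using norm_t[OF assms] norm_n[OF assms] n_t[OF assms] norm_cross[of "n s" "t s"] by (simp add: u_def)
  then show "u s \<bullet> u s = 1" "norm (u s) = 1" by (auto simp: power2_norm_eq_inner norm_eq_sqrt_inner)
  show "t s \<bullet> u s = 0" "u s \<bullet> t s = 0" "n s \<bullet> u s = 0" "u s \<bullet> n s = 0" by (auto simp: u_def dot_cross_self)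
qed

lemma expansion:
  assumes "s \<in> {A..B}" "w \<bullet> n s = 0"
  shows "w = (w \<bullet> t s) *\<^sub>R t s + (w \<bullet> u s) *\<^sub>R u s"
  unfolding u_def using assms norm_n norm_t n_t by (intro orthonormal_frame_expansion) auto

lemma J_inner:
  assumes "s \<in> {A..B}"
  shows "J s z \<bullet> J s w = z \<bullet> w"
proof -
  have "J s z \<bullet> J s w = (z * cis (- \<kappa> s)) \<bullet> (w * cis (- \<kappa> s))"
    using frame[OF assms] by (simp add: J_def inner_complex_def inner_add_left inner_add_right algebra_simps)
  also have "\<dots> = z \<bullet> w"
  proof -
    define p where "p = cos (\<kappa> s)"
    define q where "q = sin (\<kappa> s)"
    have "(z * cis (- \<kappa> s)) \<bullet> (w * cis (- \<kappa> s)) = (z \<bullet> w) * (p * p + q * q)"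
      by (simp add: inner_complex_def algebra_simps flip: p_def q_def)
    then show ?thesis by (simp add: p_def q_def)
  qed
  finally show ?thesis .
qed

lemma norm_J: "s \<in> {A..B} \<Longrightarrow> norm (J s z) = norm z"
  using J_inner[of s z z] by (simp add: norm_eq_sqrt_inner)

lemma J_linear: "linear (J s)"
  by (rule linearI) (auto simp: J_def algebra_simps scaleR_add_left)

lemmas J_add = linear_add[OF J_linear] and J_diff = linear_diff[OF J_linear]
  and J_scaleR = linear_cmul[OF J_linear]

lemma J_e: "s \<in> {A..B} \<Longrightarrow> J s (e s) = d s"
proof -
  assume s: "s \<in> {A..B}"
  have "e s * cis (- \<kappa> s) = Complex (d s \<bullet> t s) (d s \<bullet> u s)" by (simp add: e_def mult.assoc cis_mult)
  then show ?thesis using expansion[OF s d_n[OF s]] by (simp add: J_def)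
qed

lemma J_cis: "J s (cis (\<kappa> s)) = t s"
  by (simp add: J_def cis_mult)

lemma norm_e: "s \<in> {A..B} \<Longrightarrow> norm (e s) = 1"
  using J_e norm_J norm_d by metis

lemma J_uniform:
  assumes "\<omega> > 0"
  shows "\<exists>\<rho>>0. \<forall>s\<in>{A..B}. \<forall>s'\<in>{A..B}. \<bar>s - s'\<bar> < \<rho> \<longrightarrow> (\<forall>z. norm (J s z - J s' z) \<le> \<omega> * norm z)"
proof -
  define F where "F = (\<lambda>s. (cis (- \<kappa> s), t s, u s))"
  have "uniformly_continuous_on {A..B} F" unfolding F_def
    by (intro compact_uniformly_continuous continuous_on_Pair cis_cont cont u_cont) auto
  \<comment> \<open>The difference below has four summands, each to be bounded by
    \<open>\<omega> / 4 * norm z\<close>.\<close>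
  moreover have "\<omega> / 4 > 0" using assms by simp
  ultimately obtain \<rho> where \<rho>: "\<rho> > 0" "\<And>x y. \<lbrakk>x\<in>{A..B}; y\<in>{A..B}; dist x y < \<rho>\<rbrakk> \<Longrightarrow> dist (F x) (F y) < \<omega> / 4"
    unfolding uniformly_continuous_on_def by (metis dist_commute)
  show ?thesis
  proof (intro exI[of _ \<rho>] conjI \<rho>(1) ballI impI allI)
    fix s s' z assume s: "s \<in> {A..B}" "s' \<in> {A..B}" "\<bar>s - s'\<bar> < \<rho>"
    define c where "c = cis (- \<kappa> s)"
    define c' where "c' = cis (- \<kappa> s')"
    have F: "dist (F s) (F s') < \<omega> / 4" using \<rho>(2) s by (simp add: dist_real_def)
    have D: "norm (c - c') \<le> \<omega> / 4" "norm (t s - t s') \<le> \<omega> / 4" "norm (u s - u s') \<le> \<omega> / 4"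
      using F dist_fst_le[of "F s" "F s'"] dist_snd_le[of "F s" "F s'"]
        dist_fst_le[of "snd (F s)" "snd (F s')"] dist_snd_le[of "snd (F s)" "snd (F s')"]
      by (auto simp: F_def c_def c'_def dist_norm)
    have "J s z - J s' z = Re (z * (c - c')) *\<^sub>R t s + Re (z * c') *\<^sub>R (t s - t s')
        + (Im (z * (c - c')) *\<^sub>R u s + Im (z * c') *\<^sub>R (u s - u s'))"
      unfolding J_def c_def[symmetric] c'_def[symmetric] by (simp add: algebra_simps)
    also have "norm \<dots> \<le> norm (z * (c - c')) * 1 + norm (z * c') * (\<omega> / 4)
        + (norm (z * (c - c')) * 1 + norm (z * c') * (\<omega> / 4))"
      using D norm_t[OF s(1)] frame(5)[OF s(1)]
      by (intro order.trans[OF norm_triangle_ineq] add_mono; unfold norm_scaleR;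
          intro mult_mono abs_Re_le_cmod abs_Im_le_cmod) auto
    also have "\<dots> \<le> norm z * (\<omega> / 4) + norm z * (\<omega> / 4) + (norm z * (\<omega> / 4) + norm z * (\<omega> / 4))"
    proof -
      have "norm c' = 1" by (simp add: c'_def)
      moreover have "norm z * norm (c - c') \<le> \<omega> * norm z / 4"
        using mult_left_mono[OF D(1), of "norm z"] by (simp add: mult.commute)
      ultimately show ?thesis by (simp add: norm_mult)
    qed
    also have "\<dots> = \<omega> * norm z" by simp
    finally show "norm (J s z - J s' z) \<le> \<omega> * norm z" .
  qed
qed

lemma at_interior:
  assumes "s \<in> {A<..<B}" "(f has_vector_derivative f') (at s within {A..B})"
  shows "(f has_vector_derivative f') (at s)"
  using assms at_within_Icc_at[of A s B] by simp

lemma inner_deriv_eq: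
  assumes s: "s \<in> {A<..<B}"
    and f: "(f has_vector_derivative f') (at s)" and g: "(g has_vector_derivative g') (at s)"
    and c: "\<And>x. x \<in> {A<..<B} \<Longrightarrow> (f x :: real^3) \<bullet> g x = c"
  shows "f s \<bullet> g' + f' \<bullet> g s = 0"
proof -
  have "((\<lambda>x. f x \<bullet> g x) has_vector_derivative (f s \<bullet> g' + f' \<bullet> g s)) (at s)"
    by (rule bounded_bilinear.has_vector_derivative[OF bounded_bilinear_inner f g])
  then have "((\<lambda>x. c) has_vector_derivative (f s \<bullet> g' + f' \<bullet> g s)) (at s)"
    by (rule has_vector_derivative_transform_within_open[of _ _ _ "{A<..<B}"]) (use s c in auto)
  then show ?thesis using vector_derivative_unique_at has_vector_derivative_const by blast
qed

definition e1 :: "real \<Rightarrow> complex" where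
  "e1 s = Complex (d1 s \<bullet> t s) (d1 s \<bullet> u s) * cis (\<kappa> s)"

text \<open>All of these are differentiated orthogonality relations. The hypothesis
  \<open>d s \<bullet> n1 s = 0\<close> makes \<open>d1 s\<close> tangential, which is the constancy
  of the normal along the ruling. The other relations are the tangential part of the Darboux
  equations: inside the tangent plane the frame (t, u) turns at the rate kg.\<close>

lemma interior_facts:
  assumes s: "s \<in> {A<..<B} - K"
  shows "d1 s \<bullet> n s = 0" "d s \<bullet> t2 s = kg s * (d s \<bullet> u s)"
    "d s \<bullet> (cross3 (n s) (t2 s) + cross3 (n1 s) (t s)) = - kg s * (d s \<bullet> t s)"
    "(u has_vector_derivative cross3 (n s) (t2 s) + cross3 (n1 s) (t s)) (at s)"
proof -
  have sI: "s \<in> {A<..<B}" "s \<in> {A..B}" using s by auto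
  note nd = at_interior[OF sI(1) n_deriv[OF sI(2)]]
  note td = at_interior[OF sI(1) t_deriv[OF sI(2)]]
  show ud: "(u has_vector_derivative cross3 (n s) (t2 s) + cross3 (n1 s) (t s)) (at s)"
    unfolding u_def by (rule bounded_bilinear.has_vector_derivative[OF bounded_bilinear_cross3 nd td])
  define u1 where "u1 = cross3 (n s) (t2 s) + cross3 (n1 s) (t s)"
  have "d s \<bullet> n1 s + d1 s \<bullet> n s = 0"
    by (rule inner_deriv_eq[OF sI(1) d_deriv[OF s] nd]) (use d_n in auto)
  then show "d1 s \<bullet> n s = 0" using d_n1 sI by simp
  have "t s \<bullet> t2 s + t2 s \<bullet> t s = 0"
    by (rule inner_deriv_eq[OF sI(1) td td]) (use frame in auto)
  then have t2t: "t s \<bullet> t2 s = 0" by (simp add: inner_commute)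
  have "t s \<bullet> u1 + t2 s \<bullet> u s = 0"
    by (rule inner_deriv_eq[OF sI(1) td ud[folded u1_def]]) (use frame in auto)
  then have tu1: "t s \<bullet> u1 = - kg s" by (simp add: kg_def)
  have "u s \<bullet> u1 + u1 \<bullet> u s = 0"
    by (rule inner_deriv_eq[OF sI(1) ud[folded u1_def] ud[folded u1_def]]) (use frame in auto)
  then have uu1: "u s \<bullet> u1 = 0" by (simp add: inner_commute)
  note ex = expansion[OF sI(2) d_n[OF sI(2)]]
  have "d s \<bullet> w = (d s \<bullet> t s) * (t s \<bullet> w) + (d s \<bullet> u s) * (u s \<bullet> w)" for w
    by (subst ex) (simp add: inner_add_left)
  from this[of "t2 s"] this[of u1] show "d s \<bullet> t2 s = kg s * (d s \<bullet> u s)"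
    "d s \<bullet> (cross3 (n s) (t2 s) + cross3 (n1 s) (t s)) = - kg s * (d s \<bullet> t s)"
    using t2t tu1 uu1 unfolding u1_def[symmetric] by (auto simp: kg_def inner_commute)
qed

lemma J_e1: "s \<in> {A<..<B} - K \<Longrightarrow> J s (e1 s) = d1 s"
proof -
  assume s: "s \<in> {A<..<B} - K"
  have "e1 s * cis (- \<kappa> s) = Complex (d1 s \<bullet> t s) (d1 s \<bullet> u s)" by (simp add: e1_def mult.assoc cis_mult)
  then show ?thesis using expansion[OF _ interior_facts(1)[OF s]] s by (simp add: J_def)
qed

lemma norm_e1: "s \<in> {A<..<B} - K \<Longrightarrow> norm (e1 s) \<le> L"
  using J_e1[of s] norm_J[of s "e1 s"] d1_le[of s] by auto

text \<open>The turning of the frame (t, u) enters through the coordinates of d, that of the planar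
  frame through \<open>cis (\<kappa> s)\<close>. Both have rate kg and cancel, so only
  \<open>d1 s\<close>, read in the planar frame, remains.\<close>

lemma e_deriv:
  assumes s: "s \<in> {A<..<B} - K"
  shows "(e has_vector_derivative e1 s) (at s)"
proof -
  have sI: "s \<in> {A<..<B}" "s \<in> {A..B}" using s by auto
  note td = at_interior[OF sI(1) t_deriv[OF sI(2)]]
  note f = interior_facts[OF s]
  have \<alpha>: "((\<lambda>s. d s \<bullet> t s) has_vector_derivative (d s \<bullet> t2 s + d1 s \<bullet> t s)) (at s)"
    by (rule bounded_bilinear.has_vector_derivative[OF bounded_bilinear_inner d_deriv[OF s] td])
  have \<beta>: "((\<lambda>s. d s \<bullet> u s) has_vector_derivative (- kg s * (d s \<bullet> t s) + d1 s \<bullet> u s)) (at s)"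
    using bounded_bilinear.has_vector_derivative[OF bounded_bilinear_inner d_deriv[OF s] f(4)] f(3) by simp
  have \<kappa>d: "(\<kappa> has_real_derivative kg s) (at s)"
    using at_interior[OF sI(1)] \<kappa>_deriv[OF sI(2)] unfolding has_real_derivative_iff_has_vector_derivative by blast
  have c: "((\<lambda>s. cis (\<kappa> s)) has_vector_derivative (kg s *\<^sub>R (\<i> * cis (\<kappa> s)))) (at s)"
    using \<kappa>d unfolding has_vector_derivative_def has_field_derivative_def
    by (auto intro!: derivative_eq_intros simp: fun_eq_iff algebra_simps scaleR_conv_of_real)
  have AB: "((\<lambda>s. of_real (d s \<bullet> t s) + \<i> * of_real (d s \<bullet> u s) :: complex) has_vector_derivative
       of_real (d s \<bullet> t2 s + d1 s \<bullet> t s) + \<i> * of_real (- kg s * (d s \<bullet> t s) + d1 s \<bullet> u s)) (at s)"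
    by (intro has_vector_derivative_add has_vector_derivative_mult_right has_vector_derivative_of_real)
      (use \<alpha> \<beta> in \<open>auto simp: has_real_derivative_iff_has_vector_derivative\<close>)
  have "(e has_vector_derivative
     (of_real (d s \<bullet> t s) + \<i> * of_real (d s \<bullet> u s)) * (kg s *\<^sub>R (\<i> * cis (\<kappa> s)))
     + (of_real (d s \<bullet> t2 s + d1 s \<bullet> t s) + \<i> * of_real (- kg s * (d s \<bullet> t s) + d1 s \<bullet> u s)) * cis (\<kappa> s)) (at s)"
    using bounded_bilinear.has_vector_derivative[OF bounded_bilinear_mult AB c]
    unfolding e_def Complex_eq by simp
  moreover have "(of_real (d s \<bullet> t s) + \<i> * of_real (d s \<bullet> u s)) * (kg s *\<^sub>R (\<i> * cis (\<kappa> s)))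
     + (of_real (d s \<bullet> t2 s + d1 s \<bullet> t s) + \<i> * of_real (- kg s * (d s \<bullet> t s) + d1 s \<bullet> u s)) * cis (\<kappa> s)
     = e1 s"
    unfolding f(2) by (simp add: e1_def complex_eq_iff algebra_simps)
  ultimately show ?thesis by simp
qed

lemma derivs_at:
  assumes "s \<in> {A<..<B}"
  shows "(\<gamma> has_vector_derivative t s) (at s)" "(Y0 has_vector_derivative cis (\<kappa> s)) (at s)"
  using assms by (auto intro!: at_interior[OF assms] \<gamma>_deriv Y0_deriv)

section \<open>Quantitative comparison of the strip with its unrolling\<close>

lemma e_lipschitz:
  assumes "s \<in> {A..B}" "s' \<in> {A..B}"
  shows "norm (e s - e s') \<le> L * \<bar>s - s'\<bar>"
proof -
  have *: "norm (e y - e x) \<le> L * (y - x)" if "A \<le> x" "x \<le> y" "y \<le> B" for x y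
    using that finite_K e_deriv norm_e1 L0
    by (intro norm_diff_le_finite_exceptions[of K x y e e1 L] continuous_on_subset[OF e_cont]) auto
  show ?thesis using *[of s s'] *[of s' s] assms by (cases "s \<le> s'") (auto simp: norm_minus_commute)
qed

lemma Y0_linear_approx:
  assumes "\<omega> > 0"
  shows "\<exists>\<rho>>0. \<forall>s\<in>{A..B}. \<forall>s'\<in>{A..B}. \<forall>r\<in>{A..B}. \<bar>s - r\<bar> < \<rho> \<and> \<bar>s' - r\<bar> < \<rho> \<longrightarrow>
    norm (Y0 s - Y0 s' - (s - s') *\<^sub>R cis (\<kappa> r)) \<le> \<omega> * \<bar>s - s'\<bar>"
proof -
  have "uniformly_continuous_on {A..B} (\<lambda>s. cis (\<kappa> s))"
    by (intro compact_uniformly_continuous cis_cont) auto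
  then obtain \<rho> where \<rho>: "\<rho> > 0" "\<And>x y. \<lbrakk>x\<in>{A..B}; y\<in>{A..B}; dist x y < \<rho>\<rbrakk> \<Longrightarrow> dist (cis (\<kappa> x)) (cis (\<kappa> y)) < \<omega>"
    unfolding uniformly_continuous_on_def using assms by (metis dist_commute)
  have *: "norm (Y0 y - Y0 x - (y - x) *\<^sub>R cis (\<kappa> r)) \<le> \<omega> * (y - x)"
    if "x \<in> {A..B}" "y \<in> {A..B}" "r \<in> {A..B}" "x \<le> y" "\<bar>x - r\<bar> < \<rho>" "\<bar>y - r\<bar> < \<rho>" for x y r
  proof -
    have "norm ((Y0 y - y *\<^sub>R cis (\<kappa> r)) - (Y0 x - x *\<^sub>R cis (\<kappa> r))) \<le> \<omega> * (y - x)"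
    proof (rule norm_diff_le_finite_exceptions[of "{}" _ _ _ "\<lambda>\<sigma>. cis (\<kappa> \<sigma>) - cis (\<kappa> r)"])
      show "continuous_on {x..y} (\<lambda>\<sigma>. Y0 \<sigma> - \<sigma> *\<^sub>R cis (\<kappa> r))"
        using that by (intro continuous_intros continuous_on_subset[OF Y0_cont]) auto
      fix \<sigma> assume "\<sigma> \<in> {x<..<y} - {}"
      then have \<sigma>: "\<sigma> \<in> {A<..<B}" "\<bar>\<sigma> - r\<bar> < \<rho>" using that by auto
      have "((\<lambda>\<sigma>. \<sigma> *\<^sub>R cis (\<kappa> r)) has_vector_derivative 1 *\<^sub>R cis (\<kappa> r)) (at \<sigma>)"
        by (rule bounded_linear.has_vector_derivative[OF bounded_linear_scaleR_left has_vector_derivative_id])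
      then show "((\<lambda>\<sigma>. Y0 \<sigma> - \<sigma> *\<^sub>R cis (\<kappa> r)) has_vector_derivative cis (\<kappa> \<sigma>) - cis (\<kappa> r)) (at \<sigma>)"
        using derivs_at(2)[OF \<sigma>(1)] by (auto intro!: has_vector_derivative_diff)
      show "norm (cis (\<kappa> \<sigma>) - cis (\<kappa> r)) \<le> \<omega>"
        using \<rho>(2)[of \<sigma> r] \<sigma> that(3) by (simp add: dist_norm)
    qed (use assms that in auto)
    then show ?thesis by (simp add: algebra_simps)
  qed
  show ?thesis
  proof (intro exI[of _ \<rho>] conjI \<rho>(1) ballI impI, elim conjE)
    fix s s' r assume h: "s \<in> {A..B}" "s' \<in> {A..B}" "r \<in> {A..B}" "\<bar>s - r\<bar> < \<rho>" "\<bar>s' - r\<bar> < \<rho>"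
    show "norm (Y0 s - Y0 s' - (s - s') *\<^sub>R cis (\<kappa> r)) \<le> \<omega> * \<bar>s - s'\<bar>"
    proof (cases "s' \<le> s")
      case True then show ?thesis using *[of s' s r] h by auto
    next
      case False
      moreover have "norm (Y0 s - Y0 s' - (s - s') *\<^sub>R cis (\<kappa> r)) = norm (Y0 s' - Y0 s - (s' - s) *\<^sub>R cis (\<kappa> r))"
        by (subst norm_minus_cancel[symmetric]) (simp add: algebra_simps)
      ultimately show ?thesis using *[of s s' r] h by auto
    qed
  qed
qed

text \<open>For fixed s, the partial derivatives of X - J s Y at a point with first coordinate s'
  are the images of those of Y under J s' - J s, hence small.\<close>

lemma X_Y_approx:
  assumes "\<epsilon> > 0"
  shows "\<exists>\<rho>>0. \<forall>s\<in>{A..B}. \<forall>s'\<in>{A..B}. \<bar>s - s'\<bar> < \<rho> \<longrightarrow> (\<forall>v v'. \<bar>v'\<bar> \<le> 1 \<longrightarrow>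
     norm (X s v - X s' v' - J s (Y s v - Y s' v')) \<le> \<epsilon> * \<bar>s - s'\<bar>)"
proof -
  \<comment> \<open>For \<open>\<bar>v'\<bar> \<le> 1\<close> the derivative of Y in the direction
    of the curve has norm at most \<open>1 + L\<close>.\<close>
  define \<omega> where "\<omega> = \<epsilon> / (1 + L)"
  have "\<omega> > 0" using assms L0 by (simp add: \<omega>_def)
  then obtain \<rho> where \<rho>: "\<rho> > 0" "\<And>s s' z. \<lbrakk>s\<in>{A..B}; s'\<in>{A..B}; \<bar>s - s'\<bar> < \<rho>\<rbrakk> \<Longrightarrow> norm (J s z - J s' z) \<le> \<omega> * norm z"
    using J_uniform[OF \<open>\<omega> > 0\<close>] by metis
  have *: "norm ((X y v' - J r (Y y v')) - (X x v' - J r (Y x v'))) \<le> \<epsilon> * (y - x)"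
    if "x \<in> {A..B}" "y \<in> {A..B}" "r \<in> {A..B}" "x \<le> y" "\<bar>x - r\<bar> < \<rho>" "\<bar>y - r\<bar> < \<rho>" "\<bar>v'\<bar> \<le> 1" for x y r v'
  proof (rule norm_diff_le_finite_exceptions[OF finite_K, of _ _ _ "\<lambda>\<sigma>. (t \<sigma> + v' *\<^sub>R d1 \<sigma>) - J r (cis (\<kappa> \<sigma>) + v' *\<^sub>R e1 \<sigma>)"])
    have bl: "bounded_linear (J r)" using J_linear linear_conv_bounded_linear by blast
    have "continuous_on {A..B} (\<lambda>\<sigma>. X \<sigma> v' - J r (Y \<sigma> v'))"
      unfolding X_def Y_def
      by (intro continuous_intros cont d_cont bounded_linear.continuous_on[OF bl] Y0_cont e_cont)
    then show "continuous_on {x..y} (\<lambda>\<sigma>. X \<sigma> v' - J r (Y \<sigma> v'))"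
      by (rule continuous_on_subset) (use that in auto)
    fix \<sigma> assume "\<sigma> \<in> {x<..<y} - K"
    then have \<sigma>: "\<sigma> \<in> {A<..<B} - K" "\<sigma> \<in> {A..B}" "\<bar>r - \<sigma>\<bar> < \<rho>" using that by auto
    show "((\<lambda>\<sigma>. X \<sigma> v' - J r (Y \<sigma> v')) has_vector_derivative (t \<sigma> + v' *\<^sub>R d1 \<sigma>) - J r (cis (\<kappa> \<sigma>) + v' *\<^sub>R e1 \<sigma>)) (at \<sigma>)"
      unfolding X_def Y_def using \<sigma>
      by (intro has_vector_derivative_diff has_vector_derivative_add derivs_at
          bounded_linear.has_vector_derivative[OF bl]
          bounded_linear.has_vector_derivative[OF bounded_linear_scaleR_right] d_deriv e_deriv) auto
    have "(t \<sigma> + v' *\<^sub>R d1 \<sigma>) = J \<sigma> (cis (\<kappa> \<sigma>) + v' *\<^sub>R e1 \<sigma>)"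
      using J_e1[OF \<sigma>(1)] by (simp add: J_add J_scaleR J_cis)
    then have bd: "norm ((t \<sigma> + v' *\<^sub>R d1 \<sigma>) - J r (cis (\<kappa> \<sigma>) + v' *\<^sub>R e1 \<sigma>)) \<le> \<omega> * norm (cis (\<kappa> \<sigma>) + v' *\<^sub>R e1 \<sigma>)"
      using \<rho>(2)[of \<sigma> r] \<sigma> that(3) by (simp add: abs_minus_commute)
    have "norm (cis (\<kappa> \<sigma>) + v' *\<^sub>R e1 \<sigma>) \<le> 1 + \<bar>v'\<bar> * norm (e1 \<sigma>)"
      using norm_triangle_ineq[of "cis (\<kappa> \<sigma>)" "v' *\<^sub>R e1 \<sigma>"] by simp
    also have "\<bar>v'\<bar> * norm (e1 \<sigma>) \<le> 1 * L" using norm_e1[OF \<sigma>(1)] that by (intro mult_mono) auto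
    finally have "norm (cis (\<kappa> \<sigma>) + v' *\<^sub>R e1 \<sigma>) \<le> 1 + L" by simp
    then have "\<omega> * norm (cis (\<kappa> \<sigma>) + v' *\<^sub>R e1 \<sigma>) \<le> \<omega> * (1 + L)"
      using \<open>\<omega> > 0\<close> by (intro mult_left_mono) auto
    also have "\<dots> = \<epsilon>" using L0 by (simp add: \<omega>_def)
    finally show "norm ((t \<sigma> + v' *\<^sub>R d1 \<sigma>) - J r (cis (\<kappa> \<sigma>) + v' *\<^sub>R e1 \<sigma>)) \<le> \<epsilon>"
      using bd by simp
  qed (use assms that in auto)
  show ?thesis
  proof (intro exI[of _ \<rho>] conjI \<rho>(1) ballI impI allI)
    fix s s' v v' assume h: "s \<in> {A..B}" "s' \<in> {A..B}" "\<bar>s - s'\<bar> < \<rho>" "\<bar>v'\<bar> \<le> (1::real)"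
    \<comment> \<open>Since \<open>J s (e s) = d s\<close>, the difference is constant along the
      ruling of s. Thus v can be traded for v', and only a displacement along the curve
      remains.\<close>
    have "X s v - J s (Y s v) = X s v' - J s (Y s v')"
      using J_e[OF h(1)] by (simp add: X_def Y_def J_add J_scaleR)
    then have eq: "X s v - X s' v' - J s (Y s v - Y s' v') = (X s v' - J s (Y s v')) - (X s' v' - J s (Y s' v'))"
      by (simp add: J_diff algebra_simps)
    show "norm (X s v - X s' v' - J s (Y s v - Y s' v')) \<le> \<epsilon> * \<bar>s - s'\<bar>"
    proof (cases "s' \<le> s")
      case True then show ?thesis unfolding eq using *[of s' s s v'] h \<rho>(1) by (simp add: abs_minus_commute)
    next
      case False then show ?thesis unfolding eq using *[of s s' s v'] h \<rho>(1)
        by (simp add: norm_minus_commute abs_minus_commute)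
    qed
  qed
qed

text \<open>The component of d across the curve is continuous without zeros, so it keeps its sign,
  and compactness bounds it away from 0.\<close>

lemma transversality_sign:
  obtains sg \<beta>0 where "\<bar>sg\<bar> = 1" "\<beta>0 > 0" "\<And>s. s \<in> {A..B} \<Longrightarrow> sg * (d s \<bullet> u s) \<ge> \<beta>0"
proof -
  define \<beta> where "\<beta> = (\<lambda>s. d s \<bullet> u s)"
  have \<beta>c: "continuous_on {A..B} \<beta>" unfolding \<beta>_def by (intro continuous_intros d_cont u_cont)
  have nz: "\<beta> s \<noteq> 0" if "s \<in> {A..B}" for s using transversal[OF that] by (simp add: \<beta>_def u_def)
  define sg where "sg = sgn (\<beta> A)"
  have sg: "\<bar>sg\<bar> = 1" using nz[of A] AB by (simp add: sg_def abs_sgn_eq)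
  have pos: "sg * \<beta> s > 0" if "s \<in> {A..B}" for s
  proof (rule ccontr)
    assume "\<not> sg * \<beta> s > 0"
    then have "sg * \<beta> s \<le> 0" by simp
    moreover have "0 \<le> sg * \<beta> A" by (simp add: sg_def sgn_mult_self_eq flip: abs_sgn mult.commute)
    moreover have "continuous_on {A..s} (\<lambda>s. sg * \<beta> s)"
      using that by (intro continuous_intros continuous_on_subset[OF \<beta>c]) auto
    ultimately have "\<exists>x\<ge>A. x \<le> s \<and> sg * \<beta> x = 0"
      using that by (intro IVT2') auto
    then obtain x where "A \<le> x" "x \<le> s" "sg * \<beta> x = 0" by blast
    then show False using nz[of x] sg that by auto
  qed
  have "continuous_on {A..B} (\<lambda>s. sg * \<beta> s)" by (intro continuous_intros \<beta>c)
  then obtain x where x: "x \<in> {A..B}" "\<And>s. s \<in> {A..B} \<Longrightarrow> sg * \<beta> x \<le> sg * \<beta> s"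
    using continuous_attains_inf[of "{A..B}" "\<lambda>s. sg * \<beta> s"] AB by auto
  show ?thesis using that[OF sg pos[OF x(1)]] x(2) by (simp add: \<beta>_def)
qed

lemma e_cis: "cnj (e s) * cis (\<kappa> s) = Complex (d s \<bullet> t s) (- (d s \<bullet> u s))"
proof -
  have "cnj (cis (\<kappa> s)) * cis (\<kappa> s) = 1" by (simp add: cis_cnj cis_mult)
  then show ?thesis by (simp add: e_def mult.assoc complex_cnj)
qed

text \<open>The linear part \<open>x *\<^sub>R cis (\<kappa> s) + y *\<^sub>R e s\<close> has
  determinant \<open>d s \<bullet> u s\<close>, so its norm dominates both coordinates with constant
  \<open>\<beta>0 / 2\<close>. The bending of the curve and the turning of the ruling each use up
  \<open>\<beta>0 / 8\<close> of this, which leaves \<open>\<beta>0 / 4\<close>.\<close>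

lemma Y_lower:
  "\<exists>c>0. \<exists>\<eta>>0. \<exists>\<rho>>0. \<eta> \<le> 1 \<and> (\<forall>s\<in>{A..B}. \<forall>s'\<in>{A..B}. \<bar>s - s'\<bar> < \<rho> \<longrightarrow> (\<forall>v v'. \<bar>v'\<bar> \<le> \<eta> \<longrightarrow>
     c * (\<bar>s - s'\<bar> + \<bar>v - v'\<bar>) \<le> norm (Y s v - Y s' v')))"
proof -
  obtain sg \<beta>0 where sg: "\<bar>sg\<bar> = 1" "\<beta>0 > 0" "\<And>s. s \<in> {A..B} \<Longrightarrow> sg * (d s \<bullet> u s) \<ge> \<beta>0"
    using transversality_sign by blast
  have lin: "\<beta>0 / 2 * (\<bar>x\<bar> + \<bar>y\<bar>) \<le> norm (x *\<^sub>R cis (\<kappa> s) + y *\<^sub>R e s)" if s: "s \<in> {A..B}" for x y s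
  proof -
    define \<alpha> where "\<alpha> = d s \<bullet> t s"
    define \<beta> where "\<beta> = d s \<bullet> u s"
    have \<beta>: "\<beta>0 \<le> \<bar>\<beta>\<bar>" using sg(1) sg(3)[OF s] abs_mult[of sg \<beta>] by (auto simp: \<beta>_def)
    have "x *\<^sub>R cis (\<kappa> s) + y *\<^sub>R e s = Complex (x + y * \<alpha>) (y * \<beta>) * cis (\<kappa> s)"
      by (simp add: e_def \<alpha>_def \<beta>_def complex_eq_iff algebra_simps)
    then have n1: "norm (x *\<^sub>R cis (\<kappa> s) + y *\<^sub>R e s) \<ge> \<bar>y\<bar> * \<bar>\<beta>\<bar>"
      using abs_Im_le_cmod[of "Complex (x + y * \<alpha>) (y * \<beta>)"] by (simp add: norm_mult abs_mult)
    \<comment> \<open>Multiplication by \<open>cnj (e s)\<close> rotates the ruling onto the real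
      axis, so that the imaginary part isolates x.\<close>
    have "cnj (e s) * e s = 1" using norm_e[OF s] by (simp add: complex_norm_square[symmetric] mult.commute)
    then have "cnj (e s) * (x *\<^sub>R cis (\<kappa> s) + y *\<^sub>R e s) = x *\<^sub>R (cnj (e s) * cis (\<kappa> s)) + of_real y"
      by (simp add: algebra_simps scaleR_conv_of_real)
    then have "Im (cnj (e s) * (x *\<^sub>R cis (\<kappa> s) + y *\<^sub>R e s)) = - x * \<beta>"
      unfolding e_cis by (simp add: \<beta>_def)
    then have n2: "norm (x *\<^sub>R cis (\<kappa> s) + y *\<^sub>R e s) \<ge> \<bar>x\<bar> * \<bar>\<beta>\<bar>"
      using abs_Im_le_cmod[of "cnj (e s) * (x *\<^sub>R cis (\<kappa> s) + y *\<^sub>R e s)"] norm_e[OF s]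
      by (simp add: norm_mult abs_mult)
    have "\<beta>0 * \<bar>x\<bar> \<le> \<bar>\<beta>\<bar> * \<bar>x\<bar>" "\<beta>0 * \<bar>y\<bar> \<le> \<bar>\<beta>\<bar> * \<bar>y\<bar>" using \<beta> by (auto intro: mult_right_mono)
    then show ?thesis using n1 n2 by (simp add: algebra_simps)
  qed
  obtain \<rho> where \<rho>: "\<rho> > 0" "\<And>s s' r. \<lbrakk>s\<in>{A..B}; s'\<in>{A..B}; r\<in>{A..B}; \<bar>s - r\<bar> < \<rho>; \<bar>s' - r\<bar> < \<rho>\<rbrakk> \<Longrightarrow>
      norm (Y0 s - Y0 s' - (s - s') *\<^sub>R cis (\<kappa> r)) \<le> (\<beta>0 / 8) * \<bar>s - s'\<bar>"
    using Y0_linear_approx[of "\<beta>0 / 8"] sg(2) by (metis divide_pos_pos zero_less_numeral)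
  \<comment> \<open>At height v' the turning of the ruling moves a point by at most
    \<open>\<bar>v'\<bar> * L * \<bar>s - s'\<bar>\<close>; this is what forces the strip to be
    narrow. The bound 1 keeps \<open>X_Y_approx\<close> applicable.\<close>
  define \<eta> where "\<eta> = min 1 (\<beta>0 / (8 * (1 + L)))"
  have \<eta>: "\<eta> > 0" "\<eta> \<le> 1" "\<eta> * L \<le> \<beta>0 / 8"
  proof -
    show "\<eta> > 0" "\<eta> \<le> 1" using sg(2) L0 by (auto simp: \<eta>_def)
    have "\<eta> * L \<le> \<beta>0 / (8 * (1 + L)) * L" using L0 by (intro mult_right_mono) (auto simp: \<eta>_def)
    also have "\<dots> \<le> \<beta>0 / 8" using L0 sg(2) by (simp add: field_simps)
    finally show "\<eta> * L \<le> \<beta>0 / 8" .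
  qed
  show ?thesis
  proof (rule exI[of _ "\<beta>0 / 4"], intro conjI, use sg in simp, rule exI[of _ \<eta>], intro conjI, fact \<eta>,
      rule exI[of _ \<rho>], intro conjI \<eta> \<rho>(1) ballI impI allI)
    fix s s' v v' assume h: "s \<in> {A..B}" "s' \<in> {A..B}" "\<bar>s - s'\<bar> < \<rho>" "\<bar>v'\<bar> \<le> \<eta>"
    define R1 where "R1 = Y0 s - Y0 s' - (s - s') *\<^sub>R cis (\<kappa> s)"
    define R2 where "R2 = v' *\<^sub>R (e s - e s')"
    have R1: "norm R1 \<le> \<beta>0 / 8 * \<bar>s - s'\<bar>" unfolding R1_def using h \<rho>(1) by (intro \<rho>(2)) (auto simp: abs_minus_commute)
    have "norm R2 \<le> \<eta> * (L * \<bar>s - s'\<bar>)"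
      unfolding R2_def norm_scaleR using h e_lipschitz[OF h(1,2)] \<eta> by (intro mult_mono) auto
    also have "\<dots> \<le> \<beta>0 / 8 * \<bar>s - s'\<bar>"
      using mult_right_mono[OF \<eta>(3), of "\<bar>s - s'\<bar>"] by (simp add: mult.assoc)
    finally have R2: "norm R2 \<le> \<beta>0 / 8 * \<bar>s - s'\<bar>" .
    have "(s - s') *\<^sub>R cis (\<kappa> s) + (v - v') *\<^sub>R e s = (Y s v - Y s' v') - R1 - R2"
      by (simp add: R1_def R2_def Y_def algebra_simps)
    then have "\<beta>0 / 2 * (\<bar>s - s'\<bar> + \<bar>v - v'\<bar>) \<le> norm (Y s v - Y s' v' - R1 - R2)"
      using lin[OF h(1), of "s - s'" "v - v'"] by simp
    also have "\<dots> \<le> norm (Y s v - Y s' v') + norm R1 + norm R2"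
      by (metis (no_types, lifting) add.commute add_mono_thms_linordered_semiring(3) norm_triangle_ineq4 order.trans add_left_mono)
    finally have "\<beta>0 / 2 * (\<bar>s - s'\<bar> + \<bar>v - v'\<bar>) \<le> norm (Y s v - Y s' v') + \<beta>0 / 8 * \<bar>s - s'\<bar> + \<beta>0 / 8 * \<bar>s - s'\<bar>"
      using R1 R2 by linarith
    moreover have "0 \<le> \<beta>0 * \<bar>v - v'\<bar>" using sg(2) by simp
    ultimately show "\<beta>0 / 4 * (\<bar>s - s'\<bar> + \<bar>v - v'\<bar>) \<le> norm (Y s v - Y s' v')"
      by (simp add: algebra_simps)
  qed
qed

text \<open>Dividing the error of \<open>X_Y_approx\<close>, which is absolute, by the lower bound
  of \<open>Y_lower\<close> gives a relative error. It will be used once with 1/2, to identify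
  parameters, and then with arbitrarily small \<epsilon>, for lengths and derivatives.\<close>

lemma near_isometry:
  obtains c \<eta> \<rho>0 where "c > 0" "\<eta> > 0" "\<rho>0 > 0" "\<eta> \<le> 1"
    "\<And>s s' v v'. \<lbrakk>s\<in>{A..B}; s'\<in>{A..B}; \<bar>s - s'\<bar> < \<rho>0; \<bar>v'\<bar> \<le> \<eta>\<rbrakk> \<Longrightarrow>
       c * (\<bar>s - s'\<bar> + \<bar>v - v'\<bar>) \<le> norm (Y s v - Y s' v')"
    "\<And>\<epsilon>. \<epsilon> > 0 \<Longrightarrow> \<exists>\<rho>>0. \<forall>s\<in>{A..B}. \<forall>s'\<in>{A..B}. \<bar>s - s'\<bar> < \<rho> \<longrightarrow> (\<forall>v v'. \<bar>v'\<bar> \<le> \<eta> \<longrightarrow>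
       norm (X s v - X s' v' - J s (Y s v - Y s' v')) \<le> \<epsilon> * norm (Y s v - Y s' v'))"
proof -
  obtain c \<eta> \<rho>0 where c: "c > 0" "\<eta> > 0" "\<rho>0 > 0" "\<eta> \<le> 1" and
    low0: "\<forall>s\<in>{A..B}. \<forall>s'\<in>{A..B}. \<bar>s - s'\<bar> < \<rho>0 \<longrightarrow> (\<forall>v v'. \<bar>v'\<bar> \<le> \<eta> \<longrightarrow>
       c * (\<bar>s - s'\<bar> + \<bar>v - v'\<bar>) \<le> norm (Y s v - Y s' v'))"
    using Y_lower by (elim exE conjE)
  note low = low0[rule_format]
  have near: "\<exists>\<rho>>0. \<forall>s\<in>{A..B}. \<forall>s'\<in>{A..B}. \<bar>s - s'\<bar> < \<rho> \<longrightarrow> (\<forall>v v'. \<bar>v'\<bar> \<le> \<eta> \<longrightarrow>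
       norm (X s v - X s' v' - J s (Y s v - Y s' v')) \<le> \<epsilon> * norm (Y s v - Y s' v'))" if "\<epsilon> > 0" for \<epsilon>
  proof -
    obtain \<rho> where \<rho>: "\<rho> > 0" "\<And>s s' v v'. \<lbrakk>s\<in>{A..B}; s'\<in>{A..B}; \<bar>s - s'\<bar> < \<rho>; \<bar>v'\<bar> \<le> 1\<rbrakk> \<Longrightarrow>
       norm (X s v - X s' v' - J s (Y s v - Y s' v')) \<le> (\<epsilon> * c) * \<bar>s - s'\<bar>"
      using X_Y_approx[of "\<epsilon> * c"] mult_pos_pos[OF \<open>\<epsilon> > 0\<close> c(1)] by metis
    show ?thesis
    proof (intro exI[of _ "min \<rho> \<rho>0"] conjI ballI impI allI)
      show "min \<rho> \<rho>0 > 0" using \<rho> c by simp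
      fix s s' v v' assume h: "s \<in> {A..B}" "s' \<in> {A..B}" "\<bar>s - s'\<bar> < min \<rho> \<rho>0" "\<bar>v'\<bar> \<le> \<eta>"
      have "norm (X s v - X s' v' - J s (Y s v - Y s' v')) \<le> (\<epsilon> * c) * \<bar>s - s'\<bar>"
        using h c by (intro \<rho>(2)) auto
      also have "\<dots> \<le> \<epsilon> * (c * (\<bar>s - s'\<bar> + \<bar>v - v'\<bar>))" using c \<open>\<epsilon> > 0\<close> by (simp add: mult_left_mono)
      also have "\<dots> \<le> \<epsilon> * norm (Y s v - Y s' v')"
        using low[OF h(1,2), of v' v] h \<open>\<epsilon> > 0\<close> by (intro mult_left_mono) auto
      finally show "norm (X s v - X s' v' - J s (Y s v - Y s' v')) \<le> \<epsilon> * norm (Y s v - Y s' v')" .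
    qed
  qed
  show ?thesis by (rule that[OF c], rule low, assumption+, rule near)
qed

end

section \<open>Short geodesics of the strip\<close>

lemma has_vector_derivative_frechet:
  assumes "f differentiable (at x within S)"
  shows "(f has_vector_derivative frechet_derivative f (at x within S) 1) (at x within S)"
proof -
  let ?f' = "frechet_derivative f (at x within S)"
  have d: "(f has_derivative ?f') (at x within S)" using assms frechet_derivative_works by blast
  then have "linear ?f'" using has_derivative_linear by blast
  then have "?f' = (\<lambda>h. h *\<^sub>R ?f' 1)"
    by (metis linear_cmul real_scaleR_def mult.right_neutral)
  then show ?thesis using d unfolding has_vector_derivative_def by simp
qed

lemma C_k_on_1_IccI:
  fixes g :: "real \<Rightarrow> 'a::real_normed_vector"
  assumes "a < b" "\<And>r. r \<in> {a..b} \<Longrightarrow> (g has_vector_derivative g' r) (at r within {a..b})"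
    and "continuous_on {a..b} g'"
  shows "C_k_on 1 g {a..b}"
proof -
  have diff: "g differentiable (at r within {a..b})" if "r \<in> {a..b}" for r
    using assms(2)[OF that] differentiableI_vector by blast
  have "frechet_derivative g (at r within {a..b}) 1 = g' r" if "r \<in> {a..b}" for r
    using vector_derivative_unique_within_closed_interval[of a b r g]
      has_vector_derivative_frechet[OF diff[OF that]] assms(1) assms(2)[OF that] that by simp
  then have "continuous_on {a..b} (\<lambda>r. frechet_derivative g (at r within {a..b}) 1)"
    by (intro continuous_on_eq[OF assms(3)]) auto
  then show ?thesis using diff by simp
qed

lemma unit_speed_lipschitz:
  fixes g :: "real \<Rightarrow> 'a::banach"
  assumes "\<And>r. r \<in> {a..b} \<Longrightarrow> (g has_vector_derivative g' r) (at r within {a..b})"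
    and "\<And>r. r \<in> {a..b} \<Longrightarrow> norm (g' r) = 1"
    and "a \<le> x" "x \<le> y" "y \<le> b"
  shows "dist (g x) (g y) \<le> y - x"
proof -
  have "norm (g y - g x) \<le> 1 * (y - x)"
  proof (rule norm_diff_le_finite_exceptions[of "{}" _ _ _ g'])
    show "continuous_on {x..y} g"
      by (rule continuous_on_subset[OF continuous_on_vector_derivative[OF assms(1)]]) (use assms in auto)
    fix s assume "s \<in> {x<..<y} - {}"
    then have "a < s" "s < b" using assms by auto
    then show "(g has_vector_derivative g' s) (at s)" "norm (g' s) \<le> 1"
      using assms(1,2)[of s] at_within_Icc_at[of a s b] by auto
  qed (use assms in auto)
  then show ?thesis by (simp add: dist_norm norm_minus_commute)
qed

text \<open>Equality case of the triangle inequality: the second bound forces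
  \<open>w \<bullet> e \<ge> x\<close>, the first gives \<open>norm w \<le> x\<close>, and together
  they annihilate the square of the norm of \<open>w - x *\<^sub>R e\<close>.\<close>

lemma straight_line_rigidity:
  fixes f :: "real \<Rightarrow> 'a::real_inner"
  assumes "dist (f 0) (f x) \<le> x" "dist (f x) (f L) \<le> L - x" "dist (f 0) (f L) = L" "0 < L"
  shows "f x = f 0 + x *\<^sub>R sgn (f L - f 0)"
proof -
  define e where "e = sgn (f L - f 0)"
  define w where "w = f x - f 0"
  have n: "norm (f L - f 0) = L" using assms(3) by (simp add: dist_norm norm_minus_commute)
  have ne: "norm e = 1" using n assms(4) by (auto simp: e_def norm_sgn)
  have "(f L - f 0) \<bullet> e = L"
    using n assms(4) by (simp add: e_def sgn_div_norm dot_square_norm power2_eq_square)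
  moreover have "(f L - f x) \<bullet> e \<le> L - x"
    using norm_cauchy_schwarz[of "f L - f x" e] ne assms(2) by (simp add: dist_norm norm_minus_commute)
  ultimately have we: "w \<bullet> e \<ge> x" by (simp add: w_def inner_diff_left)
  have nw: "norm w \<le> x" using assms(1) by (simp add: w_def dist_norm norm_minus_commute)
  have "0 \<le> x" using nw norm_ge_zero order.trans by blast
  have "(norm (w - x *\<^sub>R e))\<^sup>2 = (norm w)\<^sup>2 - 2 * x * (w \<bullet> e) + x\<^sup>2"
  proof -
    have "e \<bullet> e = 1" using ne by (simp add: dot_square_norm)
    then show ?thesis unfolding power2_norm_eq_inner
      by (simp add: inner_diff_left inner_diff_right inner_commute power2_eq_square algebra_simps)
  qed
  also have "\<dots> \<le> x\<^sup>2 - 2 * x * x + x\<^sup>2"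
    using we nw \<open>0 \<le> x\<close> by (intro add_mono diff_mono power_mono mult_left_mono) auto
  finally have "(norm (w - x *\<^sub>R e))\<^sup>2 \<le> 0" by (simp add: power2_eq_square)
  then have "w = x *\<^sub>R e" by simp
  then show ?thesis by (simp add: w_def e_def algebra_simps)
qed

text \<open>What the comparison of lengths has to know about the surface S. Conversely to
  \<open>X_in_S\<close>, \<open>lift\<close> describes every point of S near the curve, over the
  larger interval \<open>{A..B}\<close>, so that near the junction of a closed curve both sides are
  seen by one parameter interval. \<open>no_return\<close> is the quantitative form of simplicity of
  the curve.\<close>

locale unrolled_strip_surface = unrolled_strip +
  fixes a b \<delta> :: real and S :: "(real^3) set"
  assumes ab: "A \<le> a" "a < b" "b \<le> B" and \<delta>: "0 < \<delta>"
    and X_in_S: "\<And>s v. \<lbrakk>s \<in> {a..b}; \<bar>v\<bar> < \<delta>\<rbrakk> \<Longrightarrow> X s v \<in> S"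
    and lift: "\<And>\<rho> \<eta>. \<lbrakk>\<rho> > 0; \<eta> > 0\<rbrakk> \<Longrightarrow> \<exists>r>0. \<forall>s0\<in>{a..b}. \<forall>p\<in>S. dist p (\<gamma> s0) < r \<longrightarrow>
      (\<exists>s\<in>{A..B}. \<exists>v. \<bar>s - s0\<bar> < \<rho> \<and> \<bar>v\<bar> < \<eta> \<and> p = X s v)"
    and no_return: "\<And>\<rho>. \<rho> > 0 \<Longrightarrow> \<exists>w>0. \<forall>x\<in>{a..b}. \<forall>y\<in>{a..b}.
      x \<le> y \<and> (\<forall>z\<in>{x..y}. dist (\<gamma> x) (\<gamma> z) < w) \<longrightarrow> y - x < \<rho>"
begin

section \<open>Local unrolling charts along the curve\<close>

lemma \<gamma>_lipschitz:
  assumes "s \<in> {A..B}" "s' \<in> {A..B}"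
  shows "dist (\<gamma> s) (\<gamma> s') \<le> \<bar>s - s'\<bar>"
  using unit_speed_lipschitz[OF \<gamma>_deriv norm_t, of s s'] unit_speed_lipschitz[OF \<gamma>_deriv norm_t, of s' s] assms
  by (cases "s \<le> s'") (auto simp: dist_commute)

text \<open>The function \<Phi> unrolls a neighbourhood of a point of the curve, and \<sigma> gives the ruling through
  a point; J (\<sigma> p) is the differential at p of the inverse of \<Phi>.\<close>

definition chart :: "real \<Rightarrow> real \<Rightarrow> real \<Rightarrow> real \<Rightarrow> (real^3 \<Rightarrow> complex) \<Rightarrow> (real^3 \<Rightarrow> real) \<Rightarrow> bool" where
  "chart r \<rho> \<eta> s0 \<Phi> \<sigma> \<longleftrightarrow>
    (\<forall>p \<in> S \<inter> ball (\<gamma> s0) r. \<sigma> p \<in> {A..B}) \<and>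
    continuous_on (S \<inter> ball (\<gamma> s0) r) \<sigma> \<and>
    (\<forall>p \<in> S \<inter> ball (\<gamma> s0) r. \<forall>q \<in> S \<inter> ball (\<gamma> s0) r. dist p q \<le> 2 * dist (\<Phi> p) (\<Phi> q)) \<and>
    (\<forall>\<epsilon>>0. \<exists>\<rho>>0. \<forall>p \<in> S \<inter> ball (\<gamma> s0) r. \<forall>q \<in> S \<inter> ball (\<gamma> s0) r. dist p q < \<rho> \<longrightarrow>
       norm (p - q - J (\<sigma> p) (\<Phi> p - \<Phi> q)) \<le> \<epsilon> * dist p q) \<and>
    (\<forall>s \<in> {A..B}. \<forall>v. \<bar>s - s0\<bar> < \<rho> \<and> \<bar>v\<bar> < \<eta> \<and> X s v \<in> S \<inter> ball (\<gamma> s0) r \<longrightarrow>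
       \<Phi> (X s v) = Y s v \<and> \<sigma> (X s v) = s)"

text \<open>\<Phi> is Y at chosen parameters of the point with first coordinate near s0. The
  estimate with relative error 1/2 shows that the point determines these parameters, so the choice
  is forced. The sizes r, \<rho> and \<eta> do not depend on s0, which makes everything later
  uniform along the curve.\<close>

lemma chart_exists:
  obtains r \<rho> \<eta> where "r > 0" "\<rho> > 0" "\<eta> > 0" "\<And>s0. s0 \<in> {a..b} \<Longrightarrow> \<exists>\<Phi> \<sigma>. chart r \<rho> \<eta> s0 \<Phi> \<sigma>"
proof -
  obtain c \<eta> \<rho>0 where c: "c > 0" "\<eta> > 0" "\<rho>0 > 0" "\<eta> \<le> 1" and
    low: "\<And>s s' v v'. \<lbrakk>s\<in>{A..B}; s'\<in>{A..B}; \<bar>s - s'\<bar> < \<rho>0; \<bar>v'\<bar> \<le> \<eta>\<rbrakk> \<Longrightarrow>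
       c * (\<bar>s - s'\<bar> + \<bar>v - v'\<bar>) \<le> norm (Y s v - Y s' v')" and
    near: "\<And>\<epsilon>. \<epsilon> > 0 \<Longrightarrow> \<exists>\<rho>>0. \<forall>s\<in>{A..B}. \<forall>s'\<in>{A..B}. \<bar>s - s'\<bar> < \<rho> \<longrightarrow> (\<forall>v v'. \<bar>v'\<bar> \<le> \<eta> \<longrightarrow>
       norm (X s v - X s' v' - J s (Y s v - Y s' v')) \<le> \<epsilon> * norm (Y s v - Y s' v'))"
    by (rule near_isometry, rule that, assumption, assumption, assumption, assumption, assumption, assumption)
  have "(1/2::real) > 0" by simp
  from near[OF this] obtain \<rho>h where "\<rho>h > 0" and
    half0: "\<forall>s\<in>{A..B}. \<forall>s'\<in>{A..B}. \<bar>s - s'\<bar> < \<rho>h \<longrightarrow> (\<forall>v v'. \<bar>v'\<bar> \<le> \<eta> \<longrightarrow>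
       norm (X s v - X s' v' - J s (Y s v - Y s' v')) \<le> 1/2 * norm (Y s v - Y s' v'))"
    by (elim exE conjE)
  note half = half0[rule_format]
  \<comment> \<open>Halved because two parameters are compared that are each within \<rho>1 of
    s0.\<close>
  define \<rho>1 where "\<rho>1 = min \<rho>0 \<rho>h / 2"
  have \<rho>1: "\<rho>1 > 0" "2 * \<rho>1 \<le> \<rho>0" "2 * \<rho>1 \<le> \<rho>h" using c \<open>\<rho>h > 0\<close> by (auto simp: \<rho>1_def)
  obtain r where "r > 0" and
    r0: "\<forall>s0\<in>{a..b}. \<forall>p\<in>S. dist p (\<gamma> s0) < r \<longrightarrow> (\<exists>s\<in>{A..B}. \<exists>v. \<bar>s - s0\<bar> < \<rho>1 \<and> \<bar>v\<bar> < \<eta> \<and> p = X s v)"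
    using lift[OF \<rho>1(1) c(2)] by (elim exE conjE)
  have "\<exists>\<Phi> \<sigma>. chart r \<rho>1 \<eta> s0 \<Phi> \<sigma>" if s0: "s0 \<in> {a..b}" for s0
  proof -
    let ?U = "S \<inter> ball (\<gamma> s0) r"
    have "\<forall>p\<in>?U. \<exists>sv. fst sv \<in> {A..B} \<and> \<bar>fst sv - s0\<bar> < \<rho>1 \<and> \<bar>snd sv\<bar> < \<eta> \<and> p = X (fst sv) (snd sv)"
      using r0[rule_format, OF s0] by (fastforce simp: dist_commute)
    then obtain F where F: "\<And>p. p \<in> ?U \<Longrightarrow> fst (F p) \<in> {A..B} \<and> \<bar>fst (F p) - s0\<bar> < \<rho>1 \<and> \<bar>snd (F p)\<bar> < \<eta> \<and> p = X (fst (F p)) (snd (F p))"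
      by metis
    define \<sigma> where "\<sigma> = (\<lambda>p. fst (F p))"
    define \<nu> where "\<nu> = (\<lambda>p. snd (F p))"
    define \<Phi> where "\<Phi> = (\<lambda>p. Y (\<sigma> p) (\<nu> p))"
    have \<sigma>: "\<sigma> p \<in> {A..B}" "\<bar>\<sigma> p - s0\<bar> < \<rho>1" "\<bar>\<nu> p\<bar> \<le> \<eta>" "X (\<sigma> p) (\<nu> p) = p" if "p \<in> ?U" for p
      using F[OF that] by (auto simp: \<sigma>_def \<nu>_def)
    have close: "\<bar>\<sigma> p - \<sigma> q\<bar> < \<rho>0" "\<bar>\<sigma> p - \<sigma> q\<bar> < \<rho>h" if "p \<in> ?U" "q \<in> ?U" for p q
      using \<sigma>(2)[OF that(1)] \<sigma>(2)[OF that(2)] \<rho>1 by linarith+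
    have h: "norm (p - q - J (\<sigma> p) (\<Phi> p - \<Phi> q)) \<le> 1/2 * dist (\<Phi> p) (\<Phi> q)" if "p \<in> ?U" "q \<in> ?U" for p q
      using half[OF \<sigma>(1)[OF that(1)] \<sigma>(1)[OF that(2)] close(2)[OF that] \<sigma>(3)[OF that(2)], of "\<nu> p"]
        \<sigma>(4)[OF that(1)] \<sigma>(4)[OF that(2)] by (simp add: \<Phi>_def dist_norm)
    have up: "dist p q \<le> 2 * dist (\<Phi> p) (\<Phi> q)" and dn: "dist (\<Phi> p) (\<Phi> q) \<le> 2 * dist p q" if "p \<in> ?U" "q \<in> ?U" for p q
    proof -
      have "norm (J (\<sigma> p) (\<Phi> p - \<Phi> q)) = dist (\<Phi> p) (\<Phi> q)" using norm_J[OF \<sigma>(1)[OF that(1)]] by (simp add: dist_norm)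
      then have "\<bar>dist p q - dist (\<Phi> p) (\<Phi> q)\<bar> \<le> 1/2 * dist (\<Phi> p) (\<Phi> q)"
        using h[OF that] norm_triangle_ineq3[of "p - q" "J (\<sigma> p) (\<Phi> p - \<Phi> q)"] by (simp add: dist_norm)
      then show "dist p q \<le> 2 * dist (\<Phi> p) (\<Phi> q)" "dist (\<Phi> p) (\<Phi> q) \<le> 2 * dist p q"
        using zero_le_dist[of "\<Phi> p" "\<Phi> q"] by linarith+
    qed
    \<comment> \<open>Closeness in space has to imply closeness of the parameters before
      \<open>near\<close> can be applied with a smaller \<epsilon>.\<close>
    have \<sigma>l: "c * \<bar>\<sigma> p - \<sigma> q\<bar> \<le> 2 * dist p q" if "p \<in> ?U" "q \<in> ?U" for p q
    proof -
      have "c * \<bar>\<sigma> p - \<sigma> q\<bar> \<le> c * (\<bar>\<sigma> p - \<sigma> q\<bar> + \<bar>\<nu> p - \<nu> q\<bar>)" using c by simp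
      also have "\<dots> \<le> dist (\<Phi> p) (\<Phi> q)"
        using low[OF \<sigma>(1)[OF that(1)] \<sigma>(1)[OF that(2)] close(1)[OF that] \<sigma>(3)[OF that(2)], of "\<nu> p"]
        by (simp add: \<Phi>_def dist_norm)
      also note dn[OF that]
      finally show ?thesis .
    qed
    have \<sigma>c: "continuous_on ?U \<sigma>"
    proof (rule lipschitz_on_continuous_on[OF lipschitz_onI])
      fix p q assume "p \<in> ?U" "q \<in> ?U"
      then show "dist (\<sigma> p) (\<sigma> q) \<le> (2 / c) * dist p q"
        using \<sigma>l[of p q] c(1) by (simp add: dist_real_def field_simps)
    qed (use c in simp)
    have loc: "\<exists>\<rho>>0. \<forall>p\<in>?U. \<forall>q\<in>?U. dist p q < \<rho> \<longrightarrow> norm (p - q - J (\<sigma> p) (\<Phi> p - \<Phi> q)) \<le> \<epsilon> * dist p q"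
      if "\<epsilon> > 0" for \<epsilon>
    proof -
      from \<open>\<epsilon> > 0\<close> have "\<epsilon> / 2 > 0" by simp
      from near[OF this] obtain \<rho> where "\<rho> > 0" and
        n0: "\<forall>s\<in>{A..B}. \<forall>s'\<in>{A..B}. \<bar>s - s'\<bar> < \<rho> \<longrightarrow> (\<forall>v v'. \<bar>v'\<bar> \<le> \<eta> \<longrightarrow>
           norm (X s v - X s' v' - J s (Y s v - Y s' v')) \<le> \<epsilon>/2 * norm (Y s v - Y s' v'))"
        by (elim exE conjE)
      show ?thesis
      proof (intro exI[of _ "\<rho> * c / 2"] conjI ballI impI)
        show "\<rho> * c / 2 > 0" using \<open>\<rho> > 0\<close> c by simp
        fix p q assume pq: "p \<in> ?U" "q \<in> ?U" "dist p q < \<rho> * c / 2"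
        have "c * \<bar>\<sigma> p - \<sigma> q\<bar> < c * \<rho>" using \<sigma>l[OF pq(1,2)] pq(3) by (simp add: mult.commute)
        then have "\<bar>\<sigma> p - \<sigma> q\<bar> < \<rho>" using c by simp
        then have "norm (p - q - J (\<sigma> p) (\<Phi> p - \<Phi> q)) \<le> \<epsilon>/2 * dist (\<Phi> p) (\<Phi> q)"
          using n0[rule_format, OF \<sigma>(1)[OF pq(1)] \<sigma>(1)[OF pq(2)] _ \<sigma>(3)[OF pq(2)], of "\<nu> p"]
            \<sigma>(4)[OF pq(1)] \<sigma>(4)[OF pq(2)] by (simp add: \<Phi>_def dist_norm)
        also have "\<dots> \<le> \<epsilon>/2 * (2 * dist p q)" using dn[OF pq(1,2)] that by (intro mult_left_mono) auto
        finally show "norm (p - q - J (\<sigma> p) (\<Phi> p - \<Phi> q)) \<le> \<epsilon> * dist p q" by simp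
      qed
    qed
    have eq: "\<Phi> (X s v) = Y s v \<and> \<sigma> (X s v) = s"
      if s: "s \<in> {A..B}" "\<bar>s - s0\<bar> < \<rho>1" "\<bar>v\<bar> < \<eta>" and U: "X s v \<in> ?U" for s v
    proof -
      define p where "p = X s v"
      have p: "p \<in> ?U" using U by (simp add: p_def)
      note \<sigma>p = \<sigma>[OF p]
      have "\<bar>s - \<sigma> p\<bar> < \<rho>0" "\<bar>s - \<sigma> p\<bar> < \<rho>h" using s(2) \<sigma>p(2) \<rho>1 by linarith+
      note cl = this
      \<comment> \<open>Both parameter pairs give the same point of space, so the estimate bounds an
        isometric image of a planar vector by half the norm of that vector.\<close>
      have "norm (J s (Y s v - \<Phi> p)) \<le> 1/2 * norm (Y s v - \<Phi> p)"
        using half[OF s(1) \<sigma>p(1) cl(2) \<sigma>p(3), of v] \<sigma>p(4) by (simp add: \<Phi>_def p_def[symmetric])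
      then have Y: "Y s v = \<Phi> p" using norm_J[OF s(1)] by simp
      then have "c * (\<bar>s - \<sigma> p\<bar> + \<bar>v - \<nu> p\<bar>) \<le> 0"
        using low[OF s(1) \<sigma>p(1) cl(1) \<sigma>p(3), of v] by (simp add: \<Phi>_def)
      then have "\<bar>s - \<sigma> p\<bar> + \<bar>v - \<nu> p\<bar> \<le> 0" using c(1) by (simp add: mult_le_0_iff)
      then show ?thesis using Y by (simp add: p_def)
    qed
    have "chart r \<rho>1 \<eta> s0 \<Phi> \<sigma>"
      unfolding chart_def using \<sigma>(1) \<sigma>c up loc eq by blast
    then show ?thesis by blast
  qed
  then show ?thesis using that \<open>r > 0\<close> \<rho>1(1) c(2) by blast
qed

text \<open>The sign of \<phi> tells on which side of the ruling line through \<open>Y0 s\<close>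
  the point z lies. It changes between s0 and s1, so some ruling in between passes through z.
  Keeping the parameter in \<open>{s0..s1}\<close> keeps the chord over the strip even if s0 or s1
  is an end of an arc.\<close>

lemma chord_in_strip:
  "\<exists>\<rho>>0. \<forall>s0\<in>{A..B}. \<forall>s1\<in>{A..B}. s0 < s1 \<and> s1 - s0 < \<rho> \<longrightarrow>
     Y0 s1 \<noteq> Y0 s0 \<and> norm (Y0 s1 - Y0 s0) \<le> s1 - s0 \<and>
     (\<forall>\<tau>\<in>{0..1}. \<exists>s\<in>{s0..s1}. \<exists>v. \<bar>v\<bar> \<le> 2 * (s1 - s0) \<and> Y s v = Y0 s0 + \<tau> *\<^sub>R (Y0 s1 - Y0 s0))"
proof -
  obtain sg \<beta>0 where sg: "\<bar>sg\<bar> = 1" "\<beta>0 > 0" "\<And>s. s \<in> {A..B} \<Longrightarrow> sg * (d s \<bullet> u s) \<ge> \<beta>0"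
    using transversality_sign by blast
  \<comment> \<open>The bound 1/2 makes the chord nonzero; the bound \<beta>0 lets its component
    across the rulings keep the sign that the tangent has.\<close>
  define \<omega> where "\<omega> = min (1/2) \<beta>0"
  have \<omega>: "\<omega> > 0" "\<omega> \<le> \<beta>0" "\<omega> \<le> 1/2" using sg by (auto simp: \<omega>_def)
  from Y0_linear_approx[OF \<omega>(1)] obtain \<rho> where "\<rho> > 0" and
    ap: "\<forall>s\<in>{A..B}. \<forall>s'\<in>{A..B}. \<forall>r\<in>{A..B}. \<bar>s - r\<bar> < \<rho> \<and> \<bar>s' - r\<bar> < \<rho> \<longrightarrow>
    norm (Y0 s - Y0 s' - (s - s') *\<^sub>R cis (\<kappa> r)) \<le> \<omega> * \<bar>s - s'\<bar>"
    by (elim exE conjE)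
  have lip: "norm (Y0 y - Y0 x) \<le> y - x" if "x \<in> {A..B}" "y \<in> {A..B}" "x \<le> y" for x y
    using unit_speed_lipschitz[OF Y0_deriv, of x y] that by (auto simp: dist_norm norm_minus_commute)
  show ?thesis
  proof (intro exI[of _ \<rho>] conjI \<open>\<rho> > 0\<close> ballI impI; elim conjE)
    fix s0 s1 assume s: "s0 \<in> {A..B}" "s1 \<in> {A..B}" "s0 < s1" "s1 - s0 < \<rho>"
    define c where "c = Y0 s1 - Y0 s0"
    have sgn0: "sg * Im (cnj (e r) * c) \<le> 0" if "r = s0 \<or> r = s1" for r
    proof -
      have r: "r \<in> {A..B}" using that s by auto
      have "norm (c - (s1 - s0) *\<^sub>R cis (\<kappa> r)) \<le> \<omega> * (s1 - s0)"
        using ap[rule_format, OF s(2,1) r] that s by (auto simp: c_def)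
      then have "norm (cnj (e r) * (c - (s1 - s0) *\<^sub>R cis (\<kappa> r))) \<le> \<omega> * (s1 - s0)"
        using norm_e[OF r] by (simp add: norm_mult)
      moreover have "cnj (e r) * (c - (s1 - s0) *\<^sub>R cis (\<kappa> r)) = cnj (e r) * c - (s1 - s0) *\<^sub>R (cnj (e r) * cis (\<kappa> r))"
        by (simp add: algebra_simps)
      moreover have "Im (cnj (e r) * c - (s1 - s0) *\<^sub>R (cnj (e r) * cis (\<kappa> r))) = Im (cnj (e r) * c) + (s1 - s0) * (d r \<bullet> u r)"
        unfolding e_cis by simp
      ultimately have "\<bar>Im (cnj (e r) * c) + (s1 - s0) * (d r \<bullet> u r)\<bar> \<le> \<omega> * (s1 - s0)"
        using abs_Im_le_cmod order.trans by metis
      then have "\<bar>sg * (Im (cnj (e r) * c) + (s1 - s0) * (d r \<bullet> u r))\<bar> \<le> \<omega> * (s1 - s0)"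
        using sg(1) by (simp add: abs_mult)
      then have "sg * Im (cnj (e r) * c) + (s1 - s0) * (sg * (d r \<bullet> u r)) \<le> \<omega> * (s1 - s0)"
        by (simp add: algebra_simps)
      moreover have "(s1 - s0) * \<beta>0 \<le> (s1 - s0) * (sg * (d r \<bullet> u r))"
        using sg(3)[OF r] s by (intro mult_left_mono) auto
      moreover have "\<omega> * (s1 - s0) \<le> \<beta>0 * (s1 - s0)" using \<omega>(2) s by (intro mult_right_mono) auto
      ultimately show ?thesis by (simp add: mult.commute)
    qed
    have "norm (c - (s1 - s0) *\<^sub>R cis (\<kappa> s0)) \<le> \<omega> * (s1 - s0)"
      using ap[rule_format, OF s(2,1) s(1)] s by (auto simp: c_def)
    also have "\<dots> \<le> 1/2 * (s1 - s0)" using \<omega>(3) s by (intro mult_right_mono) auto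
    also have "\<dots> < norm ((s1 - s0) *\<^sub>R cis (\<kappa> s0))" using s by simp
    finally have "c \<noteq> 0" by auto
    then show "Y0 s1 \<noteq> Y0 s0" by (simp add: c_def)
    show cl: "norm (Y0 s1 - Y0 s0) \<le> s1 - s0" using lip s by simp
    fix \<tau> :: real assume \<tau>: "\<tau> \<in> {0..1}"
    define z where "z = Y0 s0 + \<tau> *\<^sub>R c"
    have z1: "z = Y0 s1 - (1 - \<tau>) *\<^sub>R c" by (simp add: z_def c_def algebra_simps)
    define \<phi> where "\<phi> = (\<lambda>s. sg * Im (cnj (e s) * (z - Y0 s)))"
    have "\<phi> s0 = \<tau> * (sg * Im (cnj (e s0) * c))" by (simp add: \<phi>_def z_def algebra_simps)
    then have p0: "\<phi> s0 \<le> 0" using sgn0[of s0] \<tau> by (simp add: mult_nonneg_nonpos)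
    have "\<phi> s1 = - ((1 - \<tau>) * (sg * Im (cnj (e s1) * c)))" by (simp add: \<phi>_def z1 algebra_simps)
    moreover have "(1 - \<tau>) * (sg * Im (cnj (e s1) * c)) \<le> 0"
      using mult_nonneg_nonpos[OF _ sgn0[OF disjI2[OF refl]], of "1 - \<tau>"] \<tau> by simp
    ultimately have p1: "\<phi> s1 \<ge> 0" by simp
    have "continuous_on {A..B} \<phi>" unfolding \<phi>_def
      by (intro continuous_intros e_cont Y0_cont)
    then have "continuous_on {s0..s1} \<phi>" by (rule continuous_on_subset) (use s in auto)
    then obtain x where x: "s0 \<le> x" "x \<le> s1" "\<phi> x = 0" using IVT'[of \<phi> s0 0 s1, OF p0 p1] s by auto
    have xI: "x \<in> {A..B}" using x s by auto
    define v where "v = Re (cnj (e x) * (z - Y0 x))"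
    have "Im (cnj (e x) * (z - Y0 x)) = 0" using x(3) sg(1) by (auto simp: \<phi>_def)
    then have "cnj (e x) * (z - Y0 x) = of_real v" by (simp add: complex_eq_iff v_def)
    moreover have "e x * cnj (e x) = 1" using norm_e[OF xI] by (simp add: complex_norm_square[symmetric])
    ultimately have "z - Y0 x = of_real v * e x" by (metis mult.assoc mult.commute mult.left_neutral)
    then have Yz: "Y x v = z" by (simp add: Y_def scaleR_conv_of_real algebra_simps)
    \<comment> \<open>Both z and \<open>Y0 x\<close> are within \<open>s1 - s0\<close> of
      \<open>Y0 s0\<close>, whence the factor 2.\<close>
    have "\<bar>v\<bar> \<le> norm (z - Y0 x)"
      using abs_Re_le_cmod[of "cnj (e x) * (z - Y0 x)"] norm_e[OF xI] by (simp add: v_def norm_mult)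
    also have "\<dots> \<le> norm (\<tau> *\<^sub>R c) + norm (Y0 x - Y0 s0)"
      using norm_triangle_ineq4[of "\<tau> *\<^sub>R c" "Y0 x - Y0 s0"] by (simp add: z_def algebra_simps)
    also have "norm (\<tau> *\<^sub>R c) \<le> 1 * (s1 - s0)"
      unfolding norm_scaleR using \<tau> cl by (intro mult_mono) (auto simp: c_def)
    also have "norm (Y0 x - Y0 s0) \<le> s1 - s0" using lip[OF s(1) xI x(1)] x by linarith
    finally have "\<bar>v\<bar> \<le> 2 * (s1 - s0)" by simp
    then show "\<exists>s\<in>{s0..s1}. \<exists>v. \<bar>v\<bar> \<le> 2 * (s1 - s0) \<and> Y s v = Y0 s0 + \<tau> *\<^sub>R (Y0 s1 - Y0 s0)"
      using Yz x by (auto simp: z_def c_def)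
  qed
qed

lemma chartD:
  assumes "chart r \<rho> \<eta> s0 \<Phi> \<sigma>"
  shows "\<And>p. p \<in> S \<inter> ball (\<gamma> s0) r \<Longrightarrow> \<sigma> p \<in> {A..B}"
    "continuous_on (S \<inter> ball (\<gamma> s0) r) \<sigma>"
    "\<And>p q. \<lbrakk>p \<in> S \<inter> ball (\<gamma> s0) r; q \<in> S \<inter> ball (\<gamma> s0) r\<rbrakk> \<Longrightarrow> dist p q \<le> 2 * dist (\<Phi> p) (\<Phi> q)"
    "\<And>\<epsilon>. \<epsilon> > 0 \<Longrightarrow> \<exists>\<rho>>0. \<forall>p \<in> S \<inter> ball (\<gamma> s0) r. \<forall>q \<in> S \<inter> ball (\<gamma> s0) r. dist p q < \<rho> \<longrightarrow>
       norm (p - q - J (\<sigma> p) (\<Phi> p - \<Phi> q)) \<le> \<epsilon> * dist p q"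
    "\<And>s v. \<lbrakk>s \<in> {A..B}; \<bar>s - s0\<bar> < \<rho>; \<bar>v\<bar> < \<eta>; X s v \<in> S \<inter> ball (\<gamma> s0) r\<rbrakk> \<Longrightarrow> \<Phi> (X s v) = Y s v"
    "\<And>s v. \<lbrakk>s \<in> {A..B}; \<bar>s - s0\<bar> < \<rho>; \<bar>v\<bar> < \<eta>; X s v \<in> S \<inter> ball (\<gamma> s0) r\<rbrakk> \<Longrightarrow> \<sigma> (X s v) = s"
  using assms unfolding chart_def by blast+

lemma chart_locally_lipschitz:
  assumes ch: "chart r \<rho> \<eta> s0 \<Phi> \<sigma>" and "\<epsilon> > 0"
  shows "\<exists>\<rho>>0. \<forall>p \<in> S \<inter> ball (\<gamma> s0) r. \<forall>q \<in> S \<inter> ball (\<gamma> s0) r. dist p q < \<rho> \<longrightarrow>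
    dist (\<Phi> p) (\<Phi> q) \<le> (1 + \<epsilon>) * dist p q"
proof -
  obtain \<rho>' where "\<rho>' > 0" and l: "\<forall>p \<in> S \<inter> ball (\<gamma> s0) r. \<forall>q \<in> S \<inter> ball (\<gamma> s0) r. dist p q < \<rho>' \<longrightarrow>
       norm (p - q - J (\<sigma> p) (\<Phi> p - \<Phi> q)) \<le> \<epsilon> * dist p q"
    using chartD(4)[OF assms] by (elim exE conjE)
  show ?thesis
  proof (intro exI[of _ \<rho>'] conjI \<open>\<rho>' > 0\<close> ballI impI)
    fix p q assume pq: "p \<in> S \<inter> ball (\<gamma> s0) r" "q \<in> S \<inter> ball (\<gamma> s0) r" "dist p q < \<rho>'"
    have "norm (J (\<sigma> p) (\<Phi> p - \<Phi> q)) = dist (\<Phi> p) (\<Phi> q)"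
      using norm_J[OF chartD(1)[OF ch pq(1)]] by (simp add: dist_norm)
    then show "dist (\<Phi> p) (\<Phi> q) \<le> (1 + \<epsilon>) * dist p q"
      using l[rule_format, OF pq] norm_triangle_ineq2[of "J (\<sigma> p) (\<Phi> p - \<Phi> q)" "p - q"]
      by (simp add: dist_norm norm_minus_commute algebra_simps)
  qed
qed

text \<open>A competing path may leave the ball in which \<Phi> is controlled, but then its length
  is at least r, which suffices.\<close>

lemma chart_intrinsic_dist_ge:
  assumes ch: "chart r \<rho> \<eta> s0 \<Phi> \<sigma>" and "\<gamma> s0 \<in> S" "0 < r"
    and small: "dist (\<Phi> (\<gamma> s0)) (\<Phi> q) \<le> r"
  shows "ennreal (dist (\<Phi> (\<gamma> s0)) (\<Phi> q)) \<le> intrinsic_dist S (\<gamma> s0) q"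
  unfolding intrinsic_dist_def
proof (rule INF_greatest)
  fix g assume "g \<in> {g. path g \<and> path_image g \<subseteq> S \<and> pathstart g = \<gamma> s0 \<and> pathfinish g = q}"
  then have g: "path g" "path_image g \<subseteq> S" "pathstart g = \<gamma> s0" "pathfinish g = q" by auto
  show "ennreal (dist (\<Phi> (\<gamma> s0)) (\<Phi> q)) \<le> path_length g"
  proof (cases "path_image g \<subseteq> ball (\<gamma> s0) r")
    case True
    then have "path_image g \<subseteq> S \<inter> ball (\<gamma> s0) r" using g by auto
    from path_length_ge_local[OF g(1) this chart_locally_lipschitz[OF ch]] show ?thesis
      using g by simp
  next
    case False
    then obtain \<tau> where "\<tau> \<in> {0..1}" "g \<tau> \<notin> ball (\<gamma> s0) r" unfolding path_image_def by blast
    then have \<tau>: "\<tau> \<in> {0..1}" "dist (\<gamma> s0) (g \<tau>) \<ge> r" by auto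
    have "ennreal (dist (\<Phi> (\<gamma> s0)) (\<Phi> q)) \<le> ennreal (dist (g 0) (g \<tau>))"
      using small \<tau> g(3) by (intro ennreal_leI) (simp add: pathstart_def)
    also have "\<dots> \<le> path_length g" using \<tau> by (intro dist_le_path_length) auto
    finally show ?thesis .
  qed
qed

text \<open>The chart expands \<open>p - q\<close> in terms of \<open>\<Phi> p - \<Phi> q\<close>
  with relative error tending to 0. On the preimage of a line the latter is linear in the parameter,
  so the expansion is already a derivative.\<close>

lemma chart_straight_line_deriv:
  assumes ch: "chart r \<rho> \<eta> s0 \<Phi> \<sigma>" and "0 < l" "norm w = 1"
    and g: "g ` {0..l} \<subseteq> S \<inter> ball (\<gamma> s0) r"
    and line: "\<forall>x\<in>{0..l}. \<Phi> (g x) = z + x *\<^sub>R w"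
  shows "\<And>x. x \<in> {0..l} \<Longrightarrow> (g has_vector_derivative J (\<sigma> (g x)) w) (at x within {0..l})"
    and "continuous_on {0..l} (\<lambda>x. J (\<sigma> (g x)) w)"
    and "\<And>x. x \<in> {0..l} \<Longrightarrow> norm (J (\<sigma> (g x)) w) = 1"
proof -
  have U: "g x \<in> S \<inter> ball (\<gamma> s0) r" if "x \<in> {0..l}" for x using g that by blast
  have lip: "dist (g x) (g y) \<le> 2 * \<bar>x - y\<bar>" if "x \<in> {0..l}" "y \<in> {0..l}" for x y
  proof -
    have "\<Phi> (g x) - \<Phi> (g y) = (x - y) *\<^sub>R w" using line that by (simp add: algebra_simps)
    then have "dist (\<Phi> (g x)) (\<Phi> (g y)) = \<bar>x - y\<bar>" using assms(3) by (simp add: dist_norm)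
    then show ?thesis using chartD(3)[OF ch U[OF that(1)] U[OF that(2)]] by simp
  qed
  show nJ: "norm (J (\<sigma> (g x)) w) = 1" if "x \<in> {0..l}" for x
    using norm_J[OF chartD(1)[OF ch U[OF that]]] assms(3) by simp
  have "continuous_on {0..l} g"
    by (rule lipschitz_on_continuous_on[OF lipschitz_onI[of _ _ 2]]) (use lip in \<open>auto simp: dist_real_def\<close>)
  then have \<sigma>g: "continuous_on {0..l} (\<lambda>x. \<sigma> (g x))"
    using continuous_on_compose2[OF chartD(2)[OF ch]] g by blast
  have Jc: "continuous_on {A..B} (\<lambda>s. J s w)"
    unfolding J_def by (intro continuous_intros cis_cont cont u_cont)
  show "continuous_on {0..l} (\<lambda>x. J (\<sigma> (g x)) w)"
    by (rule continuous_on_compose2[OF Jc \<sigma>g]) (use chartD(1)[OF ch U] in blast)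
  show "(g has_vector_derivative J (\<sigma> (g x)) w) (at x within {0..l})" if x: "x \<in> {0..l}" for x
    unfolding has_vector_derivative_def has_derivative_within_alt
  proof (intro conjI allI impI)
    show "bounded_linear (\<lambda>h. h *\<^sub>R J (\<sigma> (g x)) w)" by (rule bounded_linear_scaleR_left)
    fix \<epsilon> :: real assume "\<epsilon> > 0"
    then have "\<epsilon> / 2 > 0" by simp
    from chartD(4)[OF ch this] obtain \<rho>' where "\<rho>' > 0" and
      l: "\<forall>p \<in> S \<inter> ball (\<gamma> s0) r. \<forall>q \<in> S \<inter> ball (\<gamma> s0) r. dist p q < \<rho>' \<longrightarrow>
       norm (p - q - J (\<sigma> p) (\<Phi> p - \<Phi> q)) \<le> \<epsilon> / 2 * dist p q"
      by (elim exE conjE)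
    show "\<exists>d>0. \<forall>y\<in>{0..l}. norm (y - x) < d \<longrightarrow> norm (g y - g x - (y - x) *\<^sub>R J (\<sigma> (g x)) w) \<le> \<epsilon> * norm (y - x)"
    proof (intro exI[of _ "\<rho>' / 2"] conjI ballI impI)
      show "\<rho>' / 2 > 0" using \<open>\<rho>' > 0\<close> by simp
      fix y assume y: "y \<in> {0..l}" "norm (y - x) < \<rho>' / 2"
      then have "dist (g x) (g y) < \<rho>'" using lip[OF x y(1)] by (simp add: abs_minus_commute)
      then have "norm (g x - g y - J (\<sigma> (g x)) (\<Phi> (g x) - \<Phi> (g y))) \<le> \<epsilon> / 2 * dist (g x) (g y)"
        using l U[OF x] U[OF y(1)] by blast
      also have "\<dots> \<le> \<epsilon> / 2 * (2 * \<bar>x - y\<bar>)" using lip[OF x y(1)] \<open>\<epsilon> > 0\<close> by (intro mult_left_mono) auto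
      also have "\<Phi> (g x) - \<Phi> (g y) = (x - y) *\<^sub>R w" using line x y by (simp add: algebra_simps)
      finally have *: "norm (g x - g y - (x - y) *\<^sub>R J (\<sigma> (g x)) w) \<le> \<epsilon> * \<bar>x - y\<bar>" by (simp add: J_scaleR)
      have "g y - g x - (y - x) *\<^sub>R J (\<sigma> (g x)) w = - (g x - g y - (x - y) *\<^sub>R J (\<sigma> (g x)) w)"
        by (simp add: algebra_simps)
      then show "norm (g y - g x - (y - x) *\<^sub>R J (\<sigma> (g x)) w) \<le> \<epsilon> * norm (y - x)"
        using * by (metis norm_minus_cancel abs_minus_commute real_norm_def)
    qed
  qed
qed

text \<open>Existence: the planar chord lifts to a curve in S whose length equals the planar
  distance, and no path in S is shorter. Tangents: under \<Phi> any minimizing segment becomes a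
  curve without expansion that joins two points at distance equal to its length, so by rigidity it
  is the chord.\<close>

lemma short_geodesics:
  "\<exists>\<rho>>0. \<forall>s0\<in>{a..b}. \<forall>s1\<in>{a..b}. s0 < s1 \<and> s1 - s0 < \<rho> \<longrightarrow>
    Y0 s1 \<noteq> Y0 s0 \<and> (\<exists>P. geodesic_segment S (\<gamma> s0) (\<gamma> s1) P) \<and>
    (\<forall>P. geodesic_segment S (\<gamma> s0) (\<gamma> s1) P \<longrightarrow>
      start_tangent P = J s0 (sgn (Y0 s1 - Y0 s0)) \<and> end_tangent P = J s1 (sgn (Y0 s1 - Y0 s0)))"
proof -
  obtain r \<rho>1 \<eta> where r: "r > 0" "\<rho>1 > 0" "\<eta> > 0" and ch: "\<And>s0. s0 \<in> {a..b} \<Longrightarrow> \<exists>\<Phi> \<sigma>. chart r \<rho>1 \<eta> s0 \<Phi> \<sigma>"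
    using chart_exists by metis
  obtain \<rho>2 where "\<rho>2 > 0" and seg: "\<forall>s0\<in>{A..B}. \<forall>s1\<in>{A..B}. s0 < s1 \<and> s1 - s0 < \<rho>2 \<longrightarrow>
     Y0 s1 \<noteq> Y0 s0 \<and> norm (Y0 s1 - Y0 s0) \<le> s1 - s0 \<and>
     (\<forall>\<tau>\<in>{0..1}. \<exists>s\<in>{s0..s1}. \<exists>v. \<bar>v\<bar> \<le> 2 * (s1 - s0) \<and> Y s v = Y0 s0 + \<tau> *\<^sub>R (Y0 s1 - Y0 s0))"
    using chord_in_strip by (elim exE conjE)
  \<comment> \<open>Points over the chord have \<open>\<bar>v\<bar> \<le> 2 * (s1 - s0)\<close> and
    lie within \<open>3 * (s1 - s0)\<close> of \<open>\<gamma> s0\<close>; hence the divisors 2 and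
    3.\<close>
  define \<rho> where "\<rho> = min (min (r / 3) \<rho>1) (min (min (\<eta> / 2) (\<delta> / 2)) \<rho>2)"
  have \<rho>: "\<rho> > 0" "3 * \<rho> \<le> r" "\<rho> \<le> \<rho>1" "2 * \<rho> \<le> \<eta>" "2 * \<rho> \<le> \<delta>" "\<rho> \<le> \<rho>2"
    using r \<delta> \<open>\<rho>2 > 0\<close> by (auto simp: \<rho>_def)
  show ?thesis
  proof (intro exI[of _ \<rho>] conjI \<rho>(1) ballI allI impI; elim conjE)
    fix s0 s1 assume s: "s0 \<in> {a..b}" "s1 \<in> {a..b}" "s0 < s1" "s1 - s0 < \<rho>"
    have sI: "s0 \<in> {A..B}" "s1 \<in> {A..B}" using s ab by auto
    define l where "l = norm (Y0 s1 - Y0 s0)"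
    define w where "w = sgn (Y0 s1 - Y0 s0)"
    have sg: "Y0 s1 \<noteq> Y0 s0" "l \<le> s1 - s0"
      "\<And>\<tau>. \<tau> \<in> {0..1} \<Longrightarrow> \<exists>s\<in>{s0..s1}. \<exists>v. \<bar>v\<bar> \<le> 2 * (s1 - s0) \<and> Y s v = Y0 s0 + \<tau> *\<^sub>R (Y0 s1 - Y0 s0)"
      using seg[rule_format, OF sI] s \<rho> by (auto simp: l_def)
    show "Y0 s1 \<noteq> Y0 s0" by (fact sg)
    have l: "0 < l" "l < r" using sg(1,2) s(4) \<rho> by (auto simp: l_def)
    have nw: "norm w = 1" using sg(1) by (simp add: w_def norm_sgn)
    have lw: "Y0 s1 = Y0 s0 + l *\<^sub>R w" using sg(1) by (simp add: l_def w_def sgn_div_norm)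
    obtain \<Phi> \<sigma> where C: "chart r \<rho>1 \<eta> s0 \<Phi> \<sigma>" using ch[OF s(1)] by blast
    let ?U = "S \<inter> ball (\<gamma> s0) r"
    have XU: "X x v \<in> ?U" "\<Phi> (X x v) = Y x v" "\<sigma> (X x v) = x" if "x \<in> {s0..s1}" "\<bar>v\<bar> \<le> 2 * (s1 - s0)" for x v
    proof -
      have x: "x \<in> {a..b}" "x \<in> {A..B}" "\<bar>x - s0\<bar> < \<rho>1" "\<bar>v\<bar> < \<eta>" using that s \<rho> ab by auto
      have v\<delta>: "\<bar>v\<bar> < \<delta>" using that s \<rho> by auto
      have "dist (\<gamma> s0) (X x v) \<le> dist (\<gamma> s0) (\<gamma> x) + norm (v *\<^sub>R d x)"
        using dist_triangle[of "\<gamma> s0" "X x v" "\<gamma> x"] by (simp add: X_def dist_norm)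
      also have "\<dots> \<le> (x - s0) + \<bar>v\<bar>" using \<gamma>_lipschitz[OF sI(1) x(2)] that norm_d[OF x(2)] by simp
      also have "\<dots> < r" using that s \<rho> by auto
      finally show XU: "X x v \<in> ?U" using X_in_S[OF x(1) v\<delta>] by simp
      show "\<Phi> (X x v) = Y x v" "\<sigma> (X x v) = x" using chartD(5,6)[OF C x(2-4) XU] by auto
    qed
    have e0: "\<gamma> s0 \<in> ?U" "\<Phi> (\<gamma> s0) = Y0 s0" "\<sigma> (\<gamma> s0) = s0" using XU[of s0 0] s by (auto simp: X_def Y_def)
    have e1: "\<gamma> s1 \<in> ?U" "\<Phi> (\<gamma> s1) = Y0 s1" "\<sigma> (\<gamma> s1) = s1" using XU[of s1 0] s by (auto simp: X_def Y_def)
    have d01: "dist (Y0 s0) (Y0 s1) = l" by (simp add: l_def dist_norm norm_minus_commute)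
    have lower: "ennreal l \<le> intrinsic_dist S (\<gamma> s0) (\<gamma> s1)"
      using chart_intrinsic_dist_ge[OF C _ r(1), of "\<gamma> s1"] e0 e1 l d01 by simp
    have "\<exists>p. p \<in> ?U \<and> \<Phi> p = Y0 s0 + x *\<^sub>R w" if "x \<in> {0..l}" for x
    proof -
      have "x / l \<in> {0..1}" using that l by simp
      from sg(3)[OF this] obtain y v where yv: "y \<in> {s0..s1}" "\<bar>v\<bar> \<le> 2 * (s1 - s0)"
        "Y y v = Y0 s0 + (x / l) *\<^sub>R (Y0 s1 - Y0 s0)" by blast
      have "(x / l) *\<^sub>R (Y0 s1 - Y0 s0) = x *\<^sub>R w" using l by (simp add: lw)
      then show ?thesis using XU[OF yv(1,2)] yv(3) by auto
    qed
    then obtain g where g: "\<And>x. x \<in> {0..l} \<Longrightarrow> g x \<in> ?U" "\<And>x. x \<in> {0..l} \<Longrightarrow> \<Phi> (g x) = Y0 s0 + x *\<^sub>R w"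
      by metis
    have gU: "g ` {0..l} \<subseteq> ?U" using g(1) by auto
    have gl: "\<forall>x\<in>{0..l}. \<Phi> (g x) = Y0 s0 + x *\<^sub>R w" using g(2) by blast
    note D = chart_straight_line_deriv[OF C l(1) nw gU gl]
    have gends: "g 0 = \<gamma> s0" "g l = \<gamma> s1"
      using chartD(3)[OF C g(1) e0(1), of 0] chartD(3)[OF C g(1) e1(1), of l] g(2)[of 0] g(2)[of l] l e0 e1 lw by auto
    have "intrinsic_dist S (\<gamma> s0) (\<gamma> s1) \<le> ennreal l"
      using unit_speed_lipschitz[OF D(1) D(3)] gU gends l by (intro intrinsic_dist_le_lipschitz[of l g]) auto
    then have id: "intrinsic_dist S (\<gamma> s0) (\<gamma> s1) = ennreal l" using lower by (rule antisym)
    have vd: "vector_derivative g (at x within {0..l}) = J (\<sigma> (g x)) w" if "x \<in> {0..l}" for x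
      by (rule vector_derivative_within_closed_interval[OF l(1) that D(1)[OF that]])
    have "geodesic_segment S (\<gamma> s0) (\<gamma> s1) (l, g)"
      unfolding geodesic_segment_def
      using l C_k_on_1_IccI[OF l(1) D(1,2)] vd D(3) gU gends id by auto
    then show "\<exists>P. geodesic_segment S (\<gamma> s0) (\<gamma> s1) P" by blast
    fix P assume P: "geodesic_segment S (\<gamma> s0) (\<gamma> s1) P"
    obtain L' h where Ph: "P = (L', h)" by (cases P)
    from P[unfolded Ph geodesic_segment_def] have h: "0 < L'" "C_k_on 1 h {0..L'}"
      "\<And>x. x \<in> {0..L'} \<Longrightarrow> norm (vector_derivative h (at x within {0..L'})) = 1"
      "h ` {0..L'} \<subseteq> S" "h 0 = \<gamma> s0" "h L' = \<gamma> s1" "ennreal l = ennreal L'" by (auto simp: id)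
    have Ll: "L' = l" using h(1,7) l by simp
    have hd: "(h has_vector_derivative vector_derivative h (at x within {0..l})) (at x within {0..l})"
      if "x \<in> {0..l}" for x
      using h(2) that unfolding Ll by (simp add: vector_derivative_works)
    have hl: "dist (h x) (h y) \<le> y - x" if "0 \<le> x" "x \<le> y" "y \<le> l" for x y
      using unit_speed_lipschitz[OF hd h(3)[unfolded Ll]] that by blast
    \<comment> \<open>A unit speed curve of length \<open>l < r\<close> starting at the centre
      cannot leave the ball, so the chart covers the whole competitor.\<close>
    have hU: "h x \<in> ?U" if "x \<in> {0..l}" for x
      using hl[of 0 x] that l h(4,5) Ll by auto
    \<comment> \<open>\<Phi> is free of expansion only in the limit of small distances. The bound
      between distant points goes through the length of the arc of h between them.\<close>
    have \<Phi>h: "dist (\<Phi> (h x)) (\<Phi> (h y)) \<le> y - x" if xy: "0 \<le> x" "x \<le> y" "y \<le> l" for x y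
    proof -
      define f where "f = (\<lambda>\<tau>. h (x + \<tau> * (y - x)))"
      have in_l: "x + \<tau> * (y - x) \<in> {0..l}" if "\<tau> \<in> {0..1}" for \<tau>
        using that xy mult_left_le_one_le[of "y - x" \<tau>] by auto
      have fl: "dist (f \<tau>) (f \<tau>') \<le> (y - x) * (\<tau>' - \<tau>)" if "0 \<le> \<tau>" "\<tau> \<le> \<tau>'" "\<tau>' \<le> 1" for \<tau> \<tau>'
      proof -
        have "\<tau> * (y - x) \<le> \<tau>' * (y - x)" using that xy by (intro mult_right_mono) auto
        then have "dist (f \<tau>) (f \<tau>') \<le> (x + \<tau>' * (y - x)) - (x + \<tau> * (y - x))"
          unfolding f_def using in_l[of \<tau>] in_l[of \<tau>'] that by (intro hl) auto
        then show ?thesis by (simp add: algebra_simps)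
      qed
      have "continuous_on {0..l} h" using continuous_on_vector_derivative[OF hd] by blast
      then have "path f" unfolding path_def f_def
        by (rule continuous_on_compose2) (use in_l in \<open>auto intro!: continuous_intros\<close>)
      moreover have "path_image f \<subseteq> ?U" using hU in_l by (force simp: path_image_def f_def)
      ultimately have "ennreal (dist (\<Phi> (pathstart f)) (\<Phi> (pathfinish f))) \<le> path_length f"
        by (rule path_length_ge_local[OF _ _ chart_locally_lipschitz[OF C]])
      also have "\<dots> \<le> ennreal (y - x)" by (rule path_length_le_lipschitz[OF fl]) (use xy in auto)
      finally show ?thesis using xy by (simp add: pathstart_def pathfinish_def f_def)
    qed
    have line: "\<forall>x\<in>{0..l}. \<Phi> (h x) = Y0 s0 + x *\<^sub>R w"
      using straight_line_rigidity[of "\<lambda>x. \<Phi> (h x)" _ l] \<Phi>h[of 0] \<Phi>h[of _ l] l h(5,6) Ll e0 e1 d01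
      by (auto simp: w_def)
    have hUs: "h ` {0..l} \<subseteq> ?U" using hU by auto
    note D' = chart_straight_line_deriv(1)[OF C l(1) nw hUs line]
    have "vector_derivative h (at x within {0..l}) = J (\<sigma> (h x)) w" if "x \<in> {0..l}" for x
      by (rule vector_derivative_within_closed_interval[OF l(1) that D'[OF that]])
    from this[of 0] this[of l] show "start_tangent P = J s0 (sgn (Y0 s1 - Y0 s0))" "end_tangent P = J s1 (sgn (Y0 s1 - Y0 s0))"
      using l h(5,6) e0 e1 by (auto simp: Ph start_tangent_def end_tangent_def Ll w_def)
  qed
qed

section \<open>Total curvature of the unrolled strip\<close>

lemma intrinsic_dist_along_curve:
  assumes "s \<in> {a..b}" "s' \<in> {a..b}"
  shows "intrinsic_dist S (\<gamma> s) (\<gamma> s') \<le> ennreal \<bar>s - s'\<bar>"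
proof -
  have \<gamma>S: "\<gamma> x \<in> S" if "x \<in> {a..b}" for x using X_in_S[OF that, of 0] \<delta> by (simp add: X_def)
  \<comment> \<open>The direction in which the curve is followed from s to s'.\<close>
  define c :: real where "c = (if s \<le> s' then 1 else -1)"
  have c: "c * \<bar>s - s'\<bar> = s' - s" "\<bar>c\<bar> = 1" by (auto simp: c_def)
  have in_ab: "s + c * x \<in> {a..b}" if "0 \<le> x" "x \<le> \<bar>s - s'\<bar>" for x
    using that assms by (auto simp: c_def split: if_splits)
  show ?thesis
  proof (rule intrinsic_dist_le_lipschitz)
    fix x y :: real assume xy: "0 \<le> x" "x \<le> y" "y \<le> \<bar>s - s'\<bar>"
    have "dist (\<gamma> (s + c * x)) (\<gamma> (s + c * y)) \<le> \<bar>(s + c * x) - (s + c * y)\<bar>"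
      using in_ab[of x] in_ab[of y] xy ab by (intro \<gamma>_lipschitz) auto
    also have "\<dots> = \<bar>c * (x - y)\<bar>" by (simp add: algebra_simps)
    also have "\<dots> = y - x" using xy c(2) by (simp add: abs_mult)
    finally show "dist (\<gamma> (s + c * x)) (\<gamma> (s + c * y)) \<le> y - x" .
  next
    show "(\<lambda>x. \<gamma> (s + c * x)) ` {0..\<bar>s - s'\<bar>} \<subseteq> S" using in_ab \<gamma>S by auto
  qed (use c in auto)
qed

text \<open>The modulus measures sets in space, not parameters. Because it bounds the diameter of
  the whole arc and not only the distance of its end points, \<open>no_return\<close>
  applies.\<close>

lemma mesh_small:
  assumes "\<rho> > 0"
  shows "\<exists>w>0. \<forall>m t P. inscribed S a b \<gamma> m t P \<and> modulus S \<gamma> m t < ennreal w \<longrightarrow> (\<forall>i<m. t (Suc i) - t i < \<rho>)"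
proof -
  obtain w where "w > 0" and w: "\<forall>x\<in>{a..b}. \<forall>y\<in>{a..b}. x \<le> y \<and> (\<forall>z\<in>{x..y}. dist (\<gamma> x) (\<gamma> z) < w) \<longrightarrow> y - x < \<rho>"
    using no_return[OF assms] by (elim exE conjE)
  show ?thesis
  proof (intro exI[of _ w] conjI \<open>w > 0\<close> allI impI; elim conjE)
    fix m t P i assume h: "inscribed S a b \<gamma> m t P" "modulus S \<gamma> m t < ennreal w" "i < m"
    have ti: "t i \<in> {a..b}" "t (Suc i) \<in> {a..b}" "t i < t (Suc i)"
      using h(1,3) by (auto simp: inscribed_def image_subset_iff strict_mono_on_def)
    have "dist (\<gamma> (t i)) (\<gamma> z) < w" if "z \<in> {t i..t (Suc i)}" for z
    proof -
      have "ennreal (dist (\<gamma> (t i)) (\<gamma> z)) \<le> intrinsic_dist S (\<gamma> (t i)) (\<gamma> z)" by (rule dist_le_intrinsic_dist)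
      also have "\<dots> \<le> intrinsic_diameter S (\<gamma> ` {t i..t (Suc i)})"
        unfolding intrinsic_diameter_def using that ti
        by (intro SUP_upper2[of "\<gamma> (t i)"] SUP_upper2[of "\<gamma> z"]) auto
      also have "\<dots> \<le> modulus S \<gamma> m t" unfolding modulus_def using h(3) by (intro Max_ge) auto
      also have "\<dots> < ennreal w" by (fact h(2))
      finally show ?thesis by (simp add: ennreal_less_iff)
    qed
    then show "t (Suc i) - t i < \<rho>" using w ti by force
  qed
qed

lemma modulus_less:
  fixes ts :: "nat \<Rightarrow> real"
  assumes "1 \<le> m" "ts ` {..m} \<subseteq> {a..b}" "\<And>i. i < m \<Longrightarrow> ts (Suc i) - ts i < \<epsilon>" "\<And>i. i < m \<Longrightarrow> ts i < ts (Suc i)"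
  shows "modulus S \<gamma> m ts < ennreal \<epsilon>"
  unfolding modulus_def
proof (subst Max_less_iff)
  show "(\<lambda>i. intrinsic_diameter S (\<gamma> ` {ts i..ts (Suc i)})) ` {..<m} \<noteq> {}" using assms(1) by (auto simp: lessThan_empty_iff)
  show "\<forall>x\<in>(\<lambda>i. intrinsic_diameter S (\<gamma> ` {ts i..ts (Suc i)})) ` {..<m}. x < ennreal \<epsilon>"
  proof (clarsimp)
    fix i assume i: "i < m"
    have ti: "ts i \<in> {a..b}" "ts (Suc i) \<in> {a..b}" using i assms(2) by (auto simp: image_subset_iff)
    have "intrinsic_diameter S (\<gamma> ` {ts i..ts (Suc i)}) \<le> ennreal (ts (Suc i) - ts i)"
      unfolding intrinsic_diameter_def
    proof (intro SUP_least; clarsimp)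
      fix x y assume xy: "ts i \<le> x" "x \<le> ts (Suc i)" "ts i \<le> y" "y \<le> ts (Suc i)"
      have "intrinsic_dist S (\<gamma> x) (\<gamma> y) \<le> ennreal \<bar>x - y\<bar>"
        using xy ti by (intro intrinsic_dist_along_curve) auto
      also have "\<dots> \<le> ennreal (ts (Suc i) - ts i)" using xy by (intro ennreal_leI) auto
      finally show "intrinsic_dist S (\<gamma> x) (\<gamma> y) \<le> ennreal (ts (Suc i) - ts i)" .
    qed
    also have "\<dots> < ennreal \<epsilon>" using assms(3,4)[OF i] by (simp add: ennreal_less_iff)
    finally show "intrinsic_diameter S (\<gamma> ` {ts i..ts (Suc i)}) < ennreal \<epsilon>" .
  qed
qed auto

lemma deriv_ab:
  assumes "s \<in> {a..b}"
  shows "(Y0 has_vector_derivative cis (\<kappa> s)) (at s within {a..b})"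
    "(\<kappa> has_real_derivative kg s) (at s within {a..b})"
  using has_vector_derivative_within_subset[OF Y0_deriv, of s "{a..b}"]
    DERIV_subset[OF \<kappa>_deriv, of s "{a..b}"] assms ab by auto

text \<open>At the vertex with parameter \<open>t (Suc i)\<close> both tangents are images of the
  directions of planar chords under the same isometry \<open>J (t (Suc i))\<close>, so the turning
  angle is the planar one. The second half supplies the polygonals for the lower bound.\<close>

lemma rotation_eq:
  "\<exists>\<rho>>0. (\<forall>m t P. inscribed S a b \<gamma> m t P \<and> (\<forall>i<m. t (Suc i) - t i < \<rho>) \<longrightarrow>
     (\<exists>\<xi>. (\<forall>i<m. t i < \<xi> i \<and> \<xi> i < t (Suc i)) \<and> rotation m P = (\<Sum>i<m - 1. \<bar>\<kappa> (\<xi> (Suc i)) - \<kappa> (\<xi> i)\<bar>))) \<and>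
   (\<forall>m t. 1 \<le> m \<and> strict_mono_on {..m} t \<and> t ` {..m} \<subseteq> {a..b} \<and> (\<forall>i<m. t (Suc i) - t i < \<rho>) \<longrightarrow>
     (\<exists>P. inscribed S a b \<gamma> m t P))"
proof -
  obtain \<rho>g where "\<rho>g > 0" and g: "\<forall>s0\<in>{a..b}. \<forall>s1\<in>{a..b}. s0 < s1 \<and> s1 - s0 < \<rho>g \<longrightarrow>
    Y0 s1 \<noteq> Y0 s0 \<and> (\<exists>P. geodesic_segment S (\<gamma> s0) (\<gamma> s1) P) \<and>
    (\<forall>P. geodesic_segment S (\<gamma> s0) (\<gamma> s1) P \<longrightarrow>
      start_tangent P = J s0 (sgn (Y0 s1 - Y0 s0)) \<and> end_tangent P = J s1 (sgn (Y0 s1 - Y0 s0)))"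
    using short_geodesics by (elim exE conjE)
  have "continuous_on {a..b} \<kappa>" by (rule continuous_on_subset[OF \<kappa>_cont]) (use ab in auto)
  then obtain \<rho>p where "\<rho>p > 0" and p: "\<forall>m t. strict_mono_on {..m} t \<and> t ` {..m} \<subseteq> {a..b} \<and> (\<forall>i<m. t (Suc i) - t i < \<rho>p) \<longrightarrow>
     (\<exists>\<xi>. (\<forall>i<m. t i < \<xi> i \<and> \<xi> i < t (Suc i)) \<and>
       (\<forall>i<m - 1. arccos (sgn (Y0 (t (Suc i)) - Y0 (t i)) \<bullet> sgn (Y0 (t (Suc (Suc i))) - Y0 (t (Suc i))))
          = \<bar>\<kappa> (\<xi> (Suc i)) - \<kappa> (\<xi> i)\<bar>))"
    using planar_turning_angles[OF deriv_ab(1)] by blast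
  define \<rho> where "\<rho> = min \<rho>g \<rho>p"
  show ?thesis
  proof (intro exI[of _ \<rho>] conjI allI impI; (elim conjE)?)
    show "\<rho> > 0" using \<open>\<rho>g > 0\<close> \<open>\<rho>p > 0\<close> by (simp add: \<rho>_def)
  next
    fix m t P assume ins: "inscribed S a b \<gamma> m t P" and mesh: "\<forall>i<m. t (Suc i) - t i < \<rho>"
    from ins have t: "strict_mono_on {..m} t" "t ` {..m} \<subseteq> {a..b}"
      "\<And>i. i < m \<Longrightarrow> geodesic_segment S (\<gamma> (t i)) (\<gamma> (t (Suc i))) (P i)" by (auto simp: inscribed_def)
    have ti: "t i \<in> {a..b}" "t (Suc i) \<in> {a..b}" "t i < t (Suc i)" "t (Suc i) - t i < \<rho>g" if "i < m" for i
      using t(1,2) that mesh by (auto simp: image_subset_iff strict_mono_on_def \<rho>_def)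
    have tang: "start_tangent (P i) = J (t i) (sgn (Y0 (t (Suc i)) - Y0 (t i)))"
      "end_tangent (P i) = J (t (Suc i)) (sgn (Y0 (t (Suc i)) - Y0 (t i)))"
      "norm (sgn (Y0 (t (Suc i)) - Y0 (t i))) = 1" if "i < m" for i
    proof -
      have *: "Y0 (t (Suc i)) \<noteq> Y0 (t i) \<and> (\<forall>P. geodesic_segment S (\<gamma> (t i)) (\<gamma> (t (Suc i))) P \<longrightarrow>
        start_tangent P = J (t i) (sgn (Y0 (t (Suc i)) - Y0 (t i))) \<and>
        end_tangent P = J (t (Suc i)) (sgn (Y0 (t (Suc i)) - Y0 (t i))))"
        using g ti[OF that] by blast
      then show "start_tangent (P i) = J (t i) (sgn (Y0 (t (Suc i)) - Y0 (t i)))"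
        "end_tangent (P i) = J (t (Suc i)) (sgn (Y0 (t (Suc i)) - Y0 (t i)))"
        using t(3)[OF that] by blast+
      show "norm (sgn (Y0 (t (Suc i)) - Y0 (t i))) = 1" using * by (simp add: norm_sgn)
    qed
    have "\<exists>\<xi>. (\<forall>i<m. t i < \<xi> i \<and> \<xi> i < t (Suc i)) \<and>
       (\<forall>i<m - 1. arccos (sgn (Y0 (t (Suc i)) - Y0 (t i)) \<bullet> sgn (Y0 (t (Suc (Suc i))) - Y0 (t (Suc i))))
          = \<bar>\<kappa> (\<xi> (Suc i)) - \<kappa> (\<xi> i)\<bar>)"
      by (rule p[rule_format]) (use t(1,2) mesh in \<open>auto simp: \<rho>_def\<close>)
    then obtain \<xi> where \<xi>: "\<forall>i<m. t i < \<xi> i \<and> \<xi> i < t (Suc i)"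
       "\<And>i. i < m - 1 \<Longrightarrow> arccos (sgn (Y0 (t (Suc i)) - Y0 (t i)) \<bullet> sgn (Y0 (t (Suc (Suc i))) - Y0 (t (Suc i))))
          = \<bar>\<kappa> (\<xi> (Suc i)) - \<kappa> (\<xi> i)\<bar>" by blast
    have "rotation m P = (\<Sum>i<m - 1. \<bar>\<kappa> (\<xi> (Suc i)) - \<kappa> (\<xi> i)\<bar>)"
      unfolding rotation_def
    proof (rule sum.cong[OF refl])
      fix i assume "i \<in> {..<m - 1}"
      then have i: "i < m" "Suc i < m" "i < m - 1" by auto
      have I: "t (Suc i) \<in> {A..B}" using ti[OF i(1)] ab by auto
      show "turning_angle (end_tangent (P i)) (start_tangent (P (Suc i))) = \<bar>\<kappa> (\<xi> (Suc i)) - \<kappa> (\<xi> i)\<bar>"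
        unfolding turning_angle_def tang(2)[OF i(1)] tang(1)[OF i(2)] J_inner[OF I] norm_J[OF I]
          tang(3)[OF i(1)] tang(3)[OF i(2)] using \<xi>(2)[OF i(3)] by simp
    qed
    with \<xi>(1) show "\<exists>\<xi>. (\<forall>i<m. t i < \<xi> i \<and> \<xi> i < t (Suc i)) \<and> rotation m P = (\<Sum>i<m - 1. \<bar>\<kappa> (\<xi> (Suc i)) - \<kappa> (\<xi> i)\<bar>)"
      by blast
  next
    fix m :: nat and t assume t: "1 \<le> m" "strict_mono_on {..m} t" "t ` {..m} \<subseteq> {a..b}" and mesh: "\<forall>i<m. t (Suc i) - t i < \<rho>"
    have "\<exists>P. geodesic_segment S (\<gamma> (t i)) (\<gamma> (t (Suc i))) P" if "i < m" for i
    proof -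
      have "t i \<in> {a..b}" "t (Suc i) \<in> {a..b}" "t i < t (Suc i)" "t (Suc i) - t i < \<rho>g"
        using t(2,3) that mesh by (auto simp: image_subset_iff strict_mono_on_def \<rho>_def)
      then show ?thesis using g by blast
    qed
    then obtain P where "\<And>i. i < m \<Longrightarrow> geodesic_segment S (\<gamma> (t i)) (\<gamma> (t (Suc i))) (P i)" by metis
    then show "\<exists>P. inscribed S a b \<gamma> m t P" using t unfolding inscribed_def by blast
  qed
qed

theorem total_curvature_eq:
  "total_curvature S a b \<gamma> = ennreal (integral {a..b} (\<lambda>s. \<bar>kg s\<bar>))"
proof -
  define I where "I = integral {a..b} (\<lambda>s. \<bar>kg s\<bar>)"
  define F where "F = (\<lambda>\<epsilon>. SUP k \<in> {rotation m P | m t P. inscribed S a b \<gamma> m t P \<and> modulus S \<gamma> m t < ennreal \<epsilon>}. ennreal k)"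
  have kc: "continuous_on {a..b} kg" by (rule continuous_on_subset[OF kg_cont]) (use ab in auto)
  obtain \<rho> where "\<rho> > 0" and
    rot: "\<forall>m t P. inscribed S a b \<gamma> m t P \<and> (\<forall>i<m. t (Suc i) - t i < \<rho>) \<longrightarrow>
     (\<exists>\<xi>. (\<forall>i<m. t i < \<xi> i \<and> \<xi> i < t (Suc i)) \<and> rotation m P = (\<Sum>i<m - 1. \<bar>\<kappa> (\<xi> (Suc i)) - \<kappa> (\<xi> i)\<bar>))" and
    ex: "\<forall>m t. 1 \<le> m \<and> strict_mono_on {..m} t \<and> t ` {..m} \<subseteq> {a..b} \<and> (\<forall>i<m. t (Suc i) - t i < \<rho>) \<longrightarrow>
     (\<exists>P. inscribed S a b \<gamma> m t P)"
    using rotation_eq by (elim exE conjE)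
  obtain w where "w > 0" and w: "\<forall>m t P. inscribed S a b \<gamma> m t P \<and> modulus S \<gamma> m t < ennreal w \<longrightarrow> (\<forall>i<m. t (Suc i) - t i < \<rho>)"
    using mesh_small[OF \<open>\<rho> > 0\<close>] by (elim exE conjE)
  have upper: "F \<epsilon> \<le> ennreal I" if "\<epsilon> \<le> w" for \<epsilon>
    unfolding F_def
  proof (rule SUP_least, clarify)
    fix m t P assume h: "inscribed S a b \<gamma> m t P" "modulus S \<gamma> m t < ennreal \<epsilon>"
    have "modulus S \<gamma> m t < ennreal w" using h(2) ennreal_leI[OF that] by (rule order.strict_trans2)
    then have "\<forall>i<m. t (Suc i) - t i < \<rho>"
      using w[THEN spec[of _ m], THEN spec[of _ t], THEN spec[of _ P], THEN mp] h(1) by blast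
    then obtain \<xi> where \<xi>: "\<forall>i<m. t i < \<xi> i \<and> \<xi> i < t (Suc i)" "rotation m P = (\<Sum>i<m - 1. \<bar>\<kappa> (\<xi> (Suc i)) - \<kappa> (\<xi> i)\<bar>)"
      using rot[THEN spec[of _ m], THEN spec[of _ t], THEN spec[of _ P], THEN mp] h(1) by blast
    have m: "1 \<le> m" and tab: "\<And>i. i \<le> m \<Longrightarrow> t i \<in> {a..b}" using h(1) by (auto simp: inscribed_def)
    have x1: "\<xi> i \<in> {a..b}" if "i \<le> m - 1" for i
    proof -
      have "i < m" using that m by simp
      then show ?thesis using \<xi>(1)[rule_format, of i] tab[of i] tab[of "Suc i"] by force
    qed
    have x2: "\<xi> i \<le> \<xi> (Suc i)" if "i < m - 1" for i
    proof -
      have "i < m" "Suc i < m" using that by auto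
      then show ?thesis using \<xi>(1)[rule_format, of i] \<xi>(1)[rule_format, of "Suc i"] by linarith
    qed
    have "rotation m P \<le> I" unfolding \<xi>(2) I_def
      by (rule sum_abs_diff_le_integral[OF deriv_ab(2) kc]) (use x1 x2 in auto)
    then show "ennreal (rotation m P) \<le> ennreal I" by (rule ennreal_leI)
  qed
  have lower: "ennreal I \<le> F \<epsilon>" if "\<epsilon> > 0" for \<epsilon>
  proof -
    \<comment> \<open>For fixed \<epsilon>, polygonals of arbitrarily fine mesh stay admissible, so
      the supremum reaches the integral up to any e.\<close>
    have step: "ennreal (I - e) \<le> F \<epsilon>" if "e > 0" for e
    proof -
      have "\<exists>\<rho>>0. \<forall>n \<xi>. (\<forall>i\<le>n. \<xi> i \<in> {a..b}) \<and> (\<forall>i<n. \<xi> i < \<xi> (Suc i) \<and> \<xi> (Suc i) - \<xi> i < \<rho>)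
          \<and> \<xi> 0 - a < \<rho> \<and> b - \<xi> n < \<rho>
          \<longrightarrow> integral {a..b} (\<lambda>x. \<bar>kg x\<bar>) - e \<le> (\<Sum>i<n. \<bar>\<kappa> (\<xi> (Suc i)) - \<kappa> (\<xi> i)\<bar>)"
        by (rule sum_abs_diff_ge_integral[OF deriv_ab(2) kc ab(2) \<open>e > 0\<close>])
      then obtain \<rho>' where "\<rho>' > 0 \<and> (\<forall>n \<xi>. (\<forall>i\<le>n. \<xi> i \<in> {a..b}) \<and>
          (\<forall>i<n. \<xi> i < \<xi> (Suc i) \<and> \<xi> (Suc i) - \<xi> i < \<rho>') \<and> \<xi> 0 - a < \<rho>' \<and> b - \<xi> n < \<rho>'
          \<longrightarrow> integral {a..b} (\<lambda>x. \<bar>kg x\<bar>) - e \<le> (\<Sum>i<n. \<bar>\<kappa> (\<xi> (Suc i)) - \<kappa> (\<xi> i)\<bar>))" ..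
      then have "\<rho>' > 0" and
        low: "\<forall>n \<xi>. (\<forall>i\<le>n. \<xi> i \<in> {a..b}) \<and> (\<forall>i<n. \<xi> i < \<xi> (Suc i) \<and> \<xi> (Suc i) - \<xi> i < \<rho>')
          \<and> \<xi> 0 - a < \<rho>' \<and> b - \<xi> n < \<rho>'
          \<longrightarrow> integral {a..b} (\<lambda>x. \<bar>kg x\<bar>) - e \<le> (\<Sum>i<n. \<bar>\<kappa> (\<xi> (Suc i)) - \<kappa> (\<xi> i)\<bar>)"
        by (rule conjunct1, rule conjunct2)
      \<comment> \<open>\<open>\<xi> i\<close> and \<open>\<xi> (Suc i)\<close> lie in adjacent mesh
        intervals and can be almost two mesh widths apart; hence \<open>\<rho>' / 2\<close>.\<close>
      define \<mu> where "\<mu> = min \<epsilon> (min \<rho> (\<rho>' / 2))"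
      have \<mu>: "\<mu> > 0" "\<mu> \<le> \<epsilon>" "\<mu> \<le> \<rho>" "2 * \<mu> \<le> \<rho>'" using \<open>\<epsilon> > 0\<close> \<open>\<rho> > 0\<close> \<open>\<rho>' > 0\<close> by (auto simp: \<mu>_def)
      obtain m :: nat where m: "(b - a) / \<mu> < real m" using reals_Archimedean2 by blast
      have m0: "m > 0" using m ab(2) \<mu>(1) by (metis divide_pos_pos diff_gt_0_iff_gt gr0I less_trans of_nat_0 order.asym)
      define h where "h = (b - a) / real m"
      have h: "h > 0" "h < \<mu>" using m m0 ab(2) \<mu>(1) by (auto simp: h_def field_simps)
      define t where "t = (\<lambda>i::nat. a + real i * h)"
      have tm: "t m = b" "t 0 = a" using m0 by (auto simp: t_def h_def)
      have tS: "t (Suc i) = t i + h" for i by (simp add: t_def algebra_simps)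
      have sm: "strict_mono_on {..m} t" by (auto simp: strict_mono_on_def t_def h(1))
      have tab: "t ` {..m} \<subseteq> {a..b}"
      proof (rule image_subsetI)
        fix i assume "i \<in> {..m}"
        then have "real i * h \<le> real m * h" using h(1) by (intro mult_right_mono) auto
        then show "t i \<in> {a..b}" using h(1) tm(1) by (auto simp: t_def)
      qed
      obtain P where P: "inscribed S a b \<gamma> m t P"
        using ex[rule_format, of m t] m0 sm tab tS h(2) \<mu>(3) by auto
      have mod: "modulus S \<gamma> m t < ennreal \<epsilon>"
        using m0 tab tS h \<mu> by (intro modulus_less) auto
      obtain \<xi> where \<xi>: "\<forall>i<m. t i < \<xi> i \<and> \<xi> i < t (Suc i)" "rotation m P = (\<Sum>i<m - 1. \<bar>\<kappa> (\<xi> (Suc i)) - \<kappa> (\<xi> i)\<bar>)"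
        using rot[rule_format, of m t P] P tS h(2) \<mu>(3) by auto
      \<comment> \<open>The m arcs have intermediate parameters numbered 0 to \<open>m - 1\<close>,
        hence \<open>m - 1\<close> increments, one for each interior vertex.\<close>
      have "integral {a..b} (\<lambda>x. \<bar>kg x\<bar>) - e \<le> (\<Sum>i<m - 1. \<bar>\<kappa> (\<xi> (Suc i)) - \<kappa> (\<xi> i)\<bar>)"
      proof (rule low[rule_format], intro conjI allI impI)
        fix i assume "i \<le> m - 1"
        then have i: "i < m" using m0 by simp
        have "t i \<in> {a..b}" "t (Suc i) \<in> {a..b}" using tab i by (auto simp: image_subset_iff)
        then show "\<xi> i \<in> {a..b}" using \<xi>(1)[rule_format, OF i] by auto
      next
        fix i assume "i < m - 1"
        then have i: "i < m" "Suc i < m" by auto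
        show "\<xi> i < \<xi> (Suc i)" "\<xi> (Suc i) - \<xi> i < \<rho>'"
          using \<xi>(1)[rule_format, OF i(1)] \<xi>(1)[rule_format, OF i(2)] tS[of i] tS[of "Suc i"] h \<mu>(4) by auto
      next
        show "\<xi> 0 - a < \<rho>'" using \<xi>(1)[rule_format, OF m0] tm tS[of 0] h \<mu> by auto
        show "b - \<xi> (m - 1) < \<rho>'" using \<xi>(1)[rule_format, of "m - 1"] m0 tm(1) tS[of "m - 1"] h \<mu> by auto
      qed
      then have "ennreal (I - e) \<le> ennreal (rotation m P)" unfolding I_def \<xi>(2) by (rule ennreal_leI)
      also have "\<dots> \<le> F \<epsilon>" unfolding F_def using P mod by (intro SUP_upper) blast
      finally show ?thesis .
    qed
    show ?thesis
    proof (cases "F \<epsilon>")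
      case (real x)
      have "I \<le> x"
      proof (rule field_le_epsilon)
        fix e :: real assume "e > 0"
        then have "ennreal (I - e) \<le> ennreal x" using step real by simp
        then show "I \<le> x + e" using real by (simp add: ennreal_le_iff)
      qed
      then show ?thesis using real by (simp add: ennreal_leI)
    qed simp
  qed
  \<comment> \<open>For \<open>0 < \<epsilon> < w\<close> both bounds hold: the supremum does not
    merely tend to the integral but is equal to it.\<close>
  have "eventually (\<lambda>\<epsilon>. F \<epsilon> = ennreal I) (at_right 0)"
    unfolding eventually_at_right_field using \<open>w > 0\<close> upper lower by (intro exI[of _ w]) (auto intro: antisym)
  then have "(F \<longlongrightarrow> ennreal I) (at_right 0)" by (rule tendsto_eventually)
  then have "Lim (at_right 0) F = ennreal I" by (intro tendsto_Lim) auto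
  then show ?thesis by (simp add: total_curvature_def F_def I_def)
qed

end

section \<open>The normal of the surface along a curve\<close>

text \<open>Only convergence of h at s is given. As the injective A is bounded below, the expansion
  of x at \<open>h s\<close> first makes h Lipschitz at s; a left inverse B of A then turns the
  expansion of c into one of h, with derivative \<open>B c'\<close>.\<close>

lemma lift_through_immersion:
  fixes x :: "'a::euclidean_space \<Rightarrow> 'b::euclidean_space" and h :: "real \<Rightarrow> 'a"
  assumes x: "(x has_derivative A) (at (h s))" and "inj A"
    and h: "(h \<longlongrightarrow> h s) (at s within S)"
    and c: "(c has_vector_derivative c') (at s within S)"
    and "s \<in> S" "0 < r" and xh: "\<And>s'. \<lbrakk>s' \<in> S; dist s' s < r\<rbrakk> \<Longrightarrow> x (h s') = c s'"
    and nontriv: "at s within S \<noteq> bot"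
  obtains w where "(h has_vector_derivative w) (at s within S)" "A w = c'"
proof -
  have linA: "linear A" using x has_derivative_linear by blast
  obtain m where m: "m > 0" "\<And>w. m * norm w \<le> norm (A w)"
    using linear_inj_bounded_below_pos[OF linA \<open>inj A\<close>] by blast
  obtain B where B: "linear B" "B \<circ> A = id" using linear_injective_left_inverse[OF linA \<open>inj A\<close>] by blast
  have BA: "B (A w) = w" for w using B(2) by (metis comp_apply id_apply)
  obtain K where K: "K > 0" "\<And>z. norm (B z) \<le> K * norm z"
    using linear_bounded_pos[OF B(1)] by blast
  have xa: "\<exists>d>0. \<forall>y. norm (y - h s) < d \<longrightarrow> norm (x y - x (h s) - A (y - h s)) \<le> e * norm (y - h s)" if "e > 0" for e
    using x that unfolding has_derivative_at_alt by blast
  have xev: "\<forall>\<^sub>F s' in at s within S. norm (x (h s') - x (h s) - A (h s' - h s)) \<le> e * norm (h s' - h s)" if e: "e > 0" for e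
  proof -
    obtain d where "d > 0" and d: "\<forall>y. norm (y - h s) < d \<longrightarrow> norm (x y - x (h s) - A (y - h s)) \<le> e * norm (y - h s)"
      using xa[OF e] by blast
    have "\<forall>\<^sub>F s' in at s within S. dist (h s') (h s) < d" using h \<open>d > 0\<close> by (rule tendstoD)
    then show ?thesis by eventually_elim (rule d[rule_format], simp add: dist_norm)
  qed
  have cev: "\<forall>\<^sub>F s' in at s within S. norm (c s' - c s - (s' - s) *\<^sub>R c') \<le> e * \<bar>s' - s\<bar>" if e: "e > 0" for e
  proof -
    obtain d where "d > 0" and d: "\<forall>y\<in>S. norm (y - s) < d \<longrightarrow> norm (c y - c s - (y - s) *\<^sub>R c') \<le> e * norm (y - s)"
      using c e unfolding has_vector_derivative_def has_derivative_within_alt by blast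
    show ?thesis unfolding eventually_at
      by (rule exI[of _ d]) (use d \<open>d > 0\<close> in \<open>simp add: dist_norm\<close>)
  qed
  have eqev: "\<forall>\<^sub>F s' in at s within S. x (h s') = c s'"
    unfolding eventually_at using xh \<open>0 < r\<close> by blast
  have eq0: "x (h s) = c s" using xh[OF \<open>s \<in> S\<close>] \<open>0 < r\<close> by simp
  define C where "C = 2 / m * (norm c' + 1)"
  have C: "C > 0" using m(1) by (simp add: C_def add_nonneg_pos)
  \<comment> \<open>A remainder of size \<open>m / 2\<close> absorbs half of the lower bound for A
    and leaves a linear bound for h.\<close>
  have "m / 2 > 0" using m by simp
  have hC: "\<forall>\<^sub>F s' in at s within S. norm (h s' - h s) \<le> C * \<bar>s' - s\<bar>"
    using xev[OF \<open>m / 2 > 0\<close>] cev[OF zero_less_one] eqev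
  proof eventually_elim
    case (elim s')
    have "m * norm (h s' - h s) \<le> norm (A (h s' - h s))" by (rule m)
    also have "\<dots> \<le> norm (c s' - c s) + m / 2 * norm (h s' - h s)"
      using elim(1) norm_triangle_ineq4[of "c s' - c s" "c s' - c s - A (h s' - h s)"]
      by (simp add: elim(3) eq0)
    also have "norm (c s' - c s) \<le> \<bar>s' - s\<bar> * norm c' + \<bar>s' - s\<bar>"
      using elim(2) norm_triangle_sub[of "c s' - c s" "(s' - s) *\<^sub>R c'"] by simp
    finally have "m * norm (h s' - h s) \<le> 2 * ((norm c' + 1) * \<bar>s' - s\<bar>)" by (simp add: algebra_simps)
    then show ?case using m(1) by (simp add: C_def field_simps)
  qed
  have hd: "(h has_vector_derivative B c') (at s within S)"
    unfolding has_vector_derivative_def has_derivative_within_alt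
  proof (intro conjI allI impI)
    show "bounded_linear (\<lambda>k. k *\<^sub>R B c')" by (rule bounded_linear_scaleR_left)
    fix e :: real assume "e > 0"
    \<comment> \<open>The remainders of c and of x each receive half of e after B has been applied;
      C converts increments of h into increments of s.\<close>
    define e1 where "e1 = e / (2 * K)"
    define e2 where "e2 = e / (2 * K * C)"
    have e12: "e1 > 0" "e2 > 0" using \<open>e > 0\<close> K(1) C by (auto simp: e1_def e2_def)
    have "\<forall>\<^sub>F s' in at s within S. norm (h s' - h s - (s' - s) *\<^sub>R B c') \<le> e * norm (s' - s)"
      using xev[OF e12(2)] cev[OF e12(1)] eqev hC
    proof eventually_elim
      case (elim s')
      define R where "R = c s' - c s - A (h s' - h s)"
      have R: "norm R \<le> e2 * (C * \<bar>s' - s\<bar>)"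
        using order.trans[OF elim(1) mult_left_mono[OF elim(4), of e2]] elim(3) e12 by (simp add: R_def eq0)
      have "h s' - h s - (s' - s) *\<^sub>R B c' = B (A (h s' - h s)) - B ((s' - s) *\<^sub>R c')"
        by (simp add: BA linear_cmul[OF B(1)])
      also have "\<dots> = B ((c s' - c s - (s' - s) *\<^sub>R c') - R)"
        unfolding linear_diff[OF B(1), symmetric] by (simp add: R_def)
      also have "norm \<dots> \<le> K * (norm (c s' - c s - (s' - s) *\<^sub>R c') + norm R)"
        using K(2)[of "(c s' - c s - (s' - s) *\<^sub>R c') - R"] norm_triangle_ineq4[of "c s' - c s - (s' - s) *\<^sub>R c'" R] K(1)
        by (meson mult_left_mono order.trans less_imp_le)
      also have "\<dots> \<le> K * (e1 * \<bar>s' - s\<bar> + e2 * (C * \<bar>s' - s\<bar>))"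
        using elim(2) R K(1) by (intro mult_left_mono add_mono) auto
      also have "\<dots> = e * \<bar>s' - s\<bar>" using K(1) C by (simp add: e1_def e2_def field_simps)
      finally show ?case by simp
    qed
    then obtain d where "d > 0" "\<forall>y\<in>S. y \<noteq> s \<and> dist y s < d \<longrightarrow> norm (h y - h s - (y - s) *\<^sub>R B c') \<le> e * norm (y - s)"
      unfolding eventually_at by blast
    then show "\<exists>d>0. \<forall>y\<in>S. norm (y - s) < d \<longrightarrow> norm (h y - h s - (y - s) *\<^sub>R B c') \<le> e * norm (y - s)"
      by (intro exI[of _ d]) (auto simp: dist_norm)
  qed
  have "(x has_derivative A) (at (h s) within h ` S)" using x has_derivative_at_withinI by blast
  from vector_derivative_diff_chain_within[OF hd this]
  have "((x \<circ> h) has_vector_derivative A (B c')) (at s within S)" .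
  then have "(c has_vector_derivative A (B c')) (at s within S)"
    by (rule has_vector_derivative_transform_within[OF _ \<open>0 < r\<close> \<open>s \<in> S\<close>]) (use xh in auto)
  then have "A (B c') = c'" using c vector_derivative_unique_within[OF nontriv] by blast
  then show ?thesis using that[OF hd] by blast
qed

text \<open>By Lagrange's identity N has vanishing cross product with \<open>cross3 x y\<close>. It
  is therefore parallel to it, and for unit vectors the factor is 1 or -1.\<close>

lemma unit_normal_eq:
  fixes N x y :: "real^3"
  assumes "norm N = 1" "N \<bullet> x = 0" "N \<bullet> y = 0" "cross3 x y \<noteq> 0"
  shows "N = (N \<bullet> sgn (cross3 x y)) *\<^sub>R sgn (cross3 x y)" "\<bar>N \<bullet> sgn (cross3 x y)\<bar> = 1"
proof -
  define n where "n = sgn (cross3 x y)"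
  have nn: "norm n = 1" using assms(4) by (simp add: n_def norm_sgn)
  have "cross3 N (cross3 x y) = 0" using assms by (simp add: Lagrange)
  then have "cross3 N n = 0" by (simp add: n_def sgn_div_norm cross_mult_right)
  then have f: "(N \<bullet> n)\<^sup>2 = 1" using norm_cross_dot[of N n] assms(1) nn by simp
  then show "\<bar>N \<bullet> sgn (cross3 x y)\<bar> = 1" by (simp add: n_def abs_square_eq_1)
  have "(norm (N - (N \<bullet> n) *\<^sub>R n))\<^sup>2 = (norm N)\<^sup>2 - (N \<bullet> n)\<^sup>2"
  proof -
    have "n \<bullet> n = 1" using nn by (simp add: dot_square_norm)
    then show ?thesis unfolding power2_norm_eq_inner
      by (simp add: inner_diff_left inner_diff_right inner_commute power2_eq_square)
  qed
  then have "N = (N \<bullet> n) *\<^sub>R n" using f assms(1) by simp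
  then show "N = (N \<bullet> sgn (cross3 x y)) *\<^sub>R sgn (cross3 x y)" by (simp add: n_def)
qed

lemma C_k_on_SucD:
  assumes "C_k_on (Suc k) f S"
  shows "x \<in> S \<Longrightarrow> f differentiable (at x within S)"
    "i \<in> Basis \<Longrightarrow> C_k_on k (\<lambda>x. frechet_derivative f (at x within S) i) S"
  using assms by auto

text \<open>The curve required by the definition is the image of a straight line in the parameter
  domain. In its radius the summand 1 covers \<open>e = 0\<close>.\<close>

lemma derivative_in_tangent_space:
  fixes x :: "'a::euclidean_space \<Rightarrow> real^3"
  assumes "open U" "u \<in> U" "x ` U \<subseteq> M" "(x has_derivative A) (at u)"
  shows "A e \<in> tangent_space M (x u)"
proof -
  obtain \<epsilon> where \<epsilon>: "\<epsilon> > 0" "ball u \<epsilon> \<subseteq> U" using assms(1,2) open_contains_ball by blast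
  define r where "r = \<epsilon> / (norm e + 1)"
  have n1: "norm e + 1 > 0" by (simp add: add_nonneg_pos)
  have r: "r > 0" using \<epsilon>(1) n1 by (simp add: r_def)
  have in_M: "x (u + t *\<^sub>R e) \<in> M" if "\<bar>t\<bar> < r" for t
  proof -
    have "\<bar>t\<bar> * norm e \<le> \<bar>t\<bar> * (norm e + 1)" by (intro mult_left_mono) auto
    also have "\<dots> < r * (norm e + 1)" using that n1 by (intro mult_strict_right_mono) auto
    also have "\<dots> = \<epsilon>" using n1 by (simp add: r_def)
    finally have "u + t *\<^sub>R e \<in> ball u \<epsilon>" by (simp add: dist_norm)
    then show ?thesis using \<epsilon>(2) assms(3) by blast
  qed
  have "((\<lambda>t. u + t *\<^sub>R e) has_vector_derivative e) (at 0)"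
    using has_vector_derivative_add[OF has_vector_derivative_const[of u]
        bounded_linear.has_vector_derivative[OF bounded_linear_scaleR_left[of e] has_vector_derivative_id], of "at 0"] by simp
  then have "((x \<circ> (\<lambda>t. u + t *\<^sub>R e)) has_vector_derivative A e) (at 0)"
    by (rule vector_derivative_diff_chain_within) (simp add: assms(4) has_derivative_at_withinI)
  then show ?thesis unfolding tangent_space_def using r in_M
    by (intro CollectI exI[of _ "x \<circ> (\<lambda>t. u + t *\<^sub>R e)"] exI[of _ r]) auto
qed

text \<open>N is given as merely continuous. In a chart it is, up to sign, the normalized cross
  product of the partial derivatives, which is differentiable. Along the curve the sign is
  continuous with values 1 and -1, so it is constant near s. Lifting the curve to the parameter
  domain allows one-sided derivatives at the ends.\<close>

lemma normal_along_curve: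
  assumes M: "regular_surface 3 M" and N: "unit_normal_field M N"
    and "s \<in> S" "c ` S \<subseteq> M" and c: "(c has_vector_derivative c') (at s within S)"
    and nontriv: "at s within S \<noteq> bot"
  shows "(N \<circ> c) differentiable (at s within S)" "N (c s) \<bullet> c' = 0"
proof -
  have "c s \<in> M" using assms by auto
  then obtain V U x y where V: "open V" "c s \<in> V" and U: "open (U :: (real \<times> real) set)" and
    ck: "C_k_on 3 x U" and hom: "homeomorphism U (V \<inter> M) x y" and
    inj: "\<And>q. q \<in> U \<Longrightarrow> inj (frechet_derivative x (at q))"
    using M unfolding regular_surface_def by metis
  define q where "q = y (c s)"
  define h where "h = (\<lambda>s'. y (c s'))"
  have q: "q \<in> U" "x q = c s" "h s = q"
    using hom V \<open>c s \<in> M\<close> by (auto simp: q_def h_def homeomorphism_def)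
  define x1 where "x1 = (\<lambda>u. frechet_derivative x (at u) (1, 0))"
  define x2 where "x2 = (\<lambda>u. frechet_derivative x (at u) (0, 1))"
  have B: "(1, 0) \<in> (Basis :: (real \<times> real) set)" "(0, 1) \<in> (Basis :: (real \<times> real) set)"
    by (auto simp: Basis_prod_def)
  have wi: "at u within U = at u" if "u \<in> U" for u using at_within_open[OF that U] .
  have ck': "C_k_on (Suc (Suc (Suc 0))) x U" using ck by (simp only: numeral_3_eq_3)
  have xd: "(x has_derivative frechet_derivative x (at u)) (at u)" if "u \<in> U" for u
    using ck' that wi[OF that] by (auto simp: frechet_derivative_works)
  have wi': "x1 differentiable (at u within U)" "x2 differentiable (at u within U)" if "u \<in> U" for u
  proof -
    show "x1 differentiable (at u within U)"
      by (rule differentiable_transform_within[OF C_k_on_SucD(1)[OF C_k_on_SucD(2)[OF ck' B(1)] that] zero_less_one that])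
        (simp add: x1_def wi)
    show "x2 differentiable (at u within U)"
      by (rule differentiable_transform_within[OF C_k_on_SucD(1)[OF C_k_on_SucD(2)[OF ck' B(2)] that] zero_less_one that])
        (simp add: x2_def wi)
  qed
  have xid: "x1 differentiable (at q)" "x2 differentiable (at q)"
    using wi'[OF q(1)] wi[OF q(1)] by auto
  define W where "W = (\<lambda>u. cross3 (x1 u) (x2 u))"
  have A: "frechet_derivative x (at u) w = fst w *\<^sub>R x1 u + snd w *\<^sub>R x2 u" if "u \<in> U" for u w
  proof -
    have l: "linear (frechet_derivative x (at u))" using xd[OF that] has_derivative_linear by blast
    have "w = fst w *\<^sub>R (1, 0) + snd w *\<^sub>R (0, 1)" by (simp add: prod_eq_iff)
    then show ?thesis using linear_add[OF l] linear_cmul[OF l] by (metis x1_def x2_def)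
  qed
  \<comment> \<open>A vanishing cross product makes the partial derivatives dependent and gives the
    injective differential a kernel vector.\<close>
  have W0: "W u \<noteq> 0" if u: "u \<in> U" for u
  proof
    assume "W u = 0"
    then consider "x1 u = 0" | "x2 u = 0" | k where "x2 u = k *\<^sub>R x1 u"
      unfolding W_def cross_eq_0 collinear_lemma by blast
    then obtain w :: "real \<times> real" where "w \<noteq> 0" "frechet_derivative x (at u) w = 0"
    proof cases
      case 1 then show ?thesis using that[of "(1, 0)"] A[OF u] by (simp add: zero_prod_def)
    next
      case 2 then show ?thesis using that[of "(0, 1)"] A[OF u] by (simp add: zero_prod_def)
    next
      case 3 then show ?thesis using that[of "(- k, 1)"] A[OF u] by (simp add: zero_prod_def)
    qed
    moreover have "frechet_derivative x (at u) 0 = 0" using A[OF u, of 0] by simp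
    ultimately show False using inj[OF u] by (metis injD)
  qed
  have xU: "x ` U = V \<inter> M" using hom by (simp add: homeomorphism_def)
  have Nx: "norm (N (x u)) = 1" "N (x u) \<bullet> x1 u = 0" "N (x u) \<bullet> x2 u = 0" if "u \<in> U" for u
  proof -
    have M: "x u \<in> M" "x ` U \<subseteq> M" using xU that by auto
    show "norm (N (x u)) = 1" "N (x u) \<bullet> x1 u = 0" "N (x u) \<bullet> x2 u = 0"
      using N M(1) derivative_in_tangent_space[OF U that M(2) xd[OF that]]
      unfolding unit_normal_field_def x1_def x2_def by blast+
  qed
  have "continuous (at s within S) c" using c by (rule has_vector_derivative_continuous)
  then have clim: "(c \<longlongrightarrow> c s) (at s within S)" by (simp add: continuous_within)
  have "\<forall>\<^sub>F s' in at s within S. c s' \<in> V" using clim V by (rule topological_tendstoD)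
  then obtain r where r: "r > 0" "\<And>s'. \<lbrakk>s' \<in> S; dist s' s < r\<rbrakk> \<Longrightarrow> c s' \<in> V"
    unfolding eventually_at using V(2) by metis
  have hU: "h s' \<in> U" "x (h s') = c s'" if "s' \<in> S" "dist s' s < r" for s'
    using hom r(2)[OF that] assms(4) that by (auto simp: h_def homeomorphism_def)
  have ev: "\<forall>\<^sub>F s' in at s within S. c s' \<in> V \<inter> M"
    unfolding eventually_at using r assms(4) by (intro exI[of _ r]) auto
  have "continuous_on (V \<inter> M) y" using hom by (simp add: homeomorphism_def)
  from continuous_on_tendsto_compose[OF this clim _ ev]
  have hlim: "(h \<longlongrightarrow> h s) (at s within S)" using V(2) \<open>c s \<in> M\<close> by (simp add: h_def)
  have qh: "q = h s" using q by simp
  obtain w where w: "(h has_vector_derivative w) (at s within S)" "frechet_derivative x (at q) w = c'"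
    by (rule lift_through_immersion[OF xd[OF q(1), unfolded qh] inj[OF q(1), unfolded qh] hlim c assms(3) r(1) hU(2) nontriv])
      (use qh in auto)
  show "N (c s) \<bullet> c' = 0"
    using Nx[OF q(1)] unfolding w(2)[symmetric] A[OF q(1)] q(2) by (simp add: inner_add_right)
  define nh where "nh = (\<lambda>u. sgn (W u))"
  define g where "g = (\<lambda>s'. N (c s') \<bullet> nh (h s'))"
  have g: "N (c s') = g s' *\<^sub>R nh (h s')" "\<bar>g s'\<bar> = 1" if "s' \<in> S" "dist s' s < r" for s'
    using unit_normal_eq[OF Nx[OF hU(1)[OF that]] W0[OF hU(1)[OF that], unfolded W_def]] hU(2)[OF that]
    by (simp_all add: g_def nh_def W_def)
  have Wd: "W differentiable (at q)"
    using xid bounded_bilinear.FDERIV[OF bounded_bilinear_cross3] unfolding W_def differentiable_def by blast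
  have "(norm \<circ> W) differentiable (at q)"
    using Wd W0[OF q(1)] by (intro differentiable_chain_at) auto
  then have "(\<lambda>u. inverse (norm (W u)) *\<^sub>R W u) differentiable (at q)"
    using Wd W0[OF q(1)] by (intro differentiable_scaleR differentiable_inverse) (auto simp: o_def)
  then have nhq: "nh differentiable (at (h s))" by (simp add: nh_def sgn_div_norm qh)
  have nhd: "(nh \<circ> h) differentiable (at s within S)"
    by (rule differentiable_chain_within[OF differentiableI_vector[OF w(1)] differentiable_at_withinI[OF nhq]])
  have "continuous_on M N" using N by (simp add: unit_normal_field_def)
  then have "((\<lambda>s'. N (c s')) \<longlongrightarrow> N (c s)) (at s within S)"
    by (rule continuous_on_tendsto_compose[OF _ clim \<open>c s \<in> M\<close>]) (use ev in \<open>auto elim: eventually_mono\<close>)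
  moreover have "((\<lambda>s'. nh (h s')) \<longlongrightarrow> nh (h s)) (at s within S)"
    using differentiable_imp_continuous_within[OF nhd] by (simp add: continuous_within o_def)
  ultimately have "(g \<longlongrightarrow> g s) (at s within S)" unfolding g_def by (rule tendsto_inner)
  then have "\<forall>\<^sub>F s' in at s within S. dist (g s') (g s) < 1" by (rule tendstoD) simp
  then obtain r2 where r2: "r2 > 0" "\<And>s'. \<lbrakk>s' \<in> S; dist s' s < r2\<rbrakk> \<Longrightarrow> dist (g s') (g s) < 1"
    unfolding eventually_at by (metis dist_self zero_less_one)
  \<comment> \<open>Two numbers of absolute value 1 at distance below 1 are equal.\<close>
  have const: "N (c s') = g s *\<^sub>R nh (h s')" if "s' \<in> S" "dist s' s < min r r2" for s'
  proof -
    have "dist (g s') (g s) < 1" "\<bar>g s'\<bar> = 1" "\<bar>g s\<bar> = 1"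
      using r2(2)[of s'] g(2)[of s'] g(2)[of s] that r(1) assms(3) by auto
    then have "g s' = g s" by (auto simp: dist_real_def abs_if split: if_splits)
    then show ?thesis using g(1)[of s'] that by simp
  qed
  have "(\<lambda>s'. g s *\<^sub>R nh (h s')) differentiable (at s within S)"
    using nhd unfolding o_def by (intro differentiable_scaleR) auto
  then show "(N \<circ> c) differentiable (at s within S)"
    by (rule differentiable_transform_within[of _ _ _ "min r r2"]) (use const r(1) r2(1) assms(3) in auto)
qed

section \<open>Arcs and closed curves\<close>

lemma C_k_on_3_real:
  fixes f :: "real \<Rightarrow> 'a::real_normed_vector"
  assumes "C_k_on 3 f S"
  obtains t t2 where "\<And>s. s \<in> S \<Longrightarrow> (f has_vector_derivative t s) (at s within S)"
    "\<And>s. s \<in> S \<Longrightarrow> (t has_vector_derivative t2 s) (at s within S)" "continuous_on S t2"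
proof -
  define t where "t = (\<lambda>s. frechet_derivative f (at s within S) 1)"
  define t2 where "t2 = (\<lambda>s. frechet_derivative t (at s within S) 1)"
  have ck: "C_k_on (Suc (Suc (Suc 0))) f S" using assms by (simp only: numeral_3_eq_3)
  have B: "(1::real) \<in> Basis" by simp
  have c: "C_k_on (Suc (Suc 0)) t S" unfolding t_def by (rule C_k_on_SucD(2)[OF ck B])
  have c2: "C_k_on (Suc 0) t2 S" unfolding t2_def by (rule C_k_on_SucD(2)[OF c B])
  note f = C_k_on_SucD(1)[OF ck] and td = C_k_on_SucD(1)[OF c]
  show ?thesis
  proof (rule that)
    show "(f has_vector_derivative t s) (at s within S)" if "s \<in> S" for s
      unfolding t_def by (rule has_vector_derivative_frechet[OF f[OF that]])
    show "(t has_vector_derivative t2 s) (at s within S)" if "s \<in> S" for s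
      unfolding t2_def by (rule has_vector_derivative_frechet[OF td[OF that]])
    show "continuous_on S t2"
      by (rule differentiable_imp_continuous_on) (simp add: differentiable_on_def C_k_on_SucD(1)[OF c2])
  qed
qed

lemma has_vector_derivative_translate:
  assumes "(f has_vector_derivative f') (at (s - k))"
  shows "((\<lambda>x. f (x - k)) has_vector_derivative f') (at (s::real))"
proof -
  have "((\<lambda>x. x - k) has_vector_derivative 1) (at s)"
    by (auto intro!: derivative_eq_intros)
  from vector_diff_chain_at[OF this assms] show ?thesis by (simp add: o_def)
qed

lemma total_curvature_cong:
  assumes "\<And>s. s \<in> {a..b} \<Longrightarrow> \<gamma> s = \<gamma>' s"
  shows "total_curvature S a b \<gamma> = total_curvature S a b \<gamma>'"
proof -
  have 1: "inscribed S a b \<gamma> m t P \<longleftrightarrow> inscribed S a b \<gamma>' m t P" for m t P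
  proof (cases "t ` {..m} \<subseteq> {a..b}")
    case True
    then have "\<gamma> (t i) = \<gamma>' (t i)" "\<gamma> (t (Suc i)) = \<gamma>' (t (Suc i))" if "i < m" for i
      using that assms[of "t i"] assms[of "t (Suc i)"] by (auto simp: image_subset_iff)
    then show ?thesis by (auto simp: inscribed_def)
  qed (simp add: inscribed_def)
  have 2: "modulus S \<gamma> m t = modulus S \<gamma>' m t" if "inscribed S a b \<gamma> m t P" for m t P
  proof -
    have "\<gamma> ` {t i..t (Suc i)} = \<gamma>' ` {t i..t (Suc i)}" if "i < m" for i
    proof (rule image_cong[OF refl])
      have "t i \<in> {a..b}" "t (Suc i) \<in> {a..b}"
        using \<open>inscribed S a b \<gamma> m t P\<close> that by (auto simp: inscribed_def image_subset_iff)
      then show "\<gamma> x = \<gamma>' x" if "x \<in> {t i..t (Suc i)}" for x using that assms[of x] by auto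
    qed
    then show ?thesis unfolding modulus_def by (intro arg_cong[where f = Max] image_cong) auto
  qed
  have "inscribed S a b \<gamma> m t P \<and> modulus S \<gamma> m t < \<epsilon> \<longleftrightarrow> inscribed S a b \<gamma>' m t P \<and> modulus S \<gamma>' m t < \<epsilon>" for m t P \<epsilon>
    using 1[of m t P] 2[of m t P] by auto
  then show ?thesis unfolding total_curvature_def by (simp only:)
qed

section \<open>Near coincidences on the curve and points of the strip close to it\<close>

lemma near_shift:
  fixes \<gamma> :: "real \<Rightarrow> 'a::metric_space"
  assumes "continuous_on {a..b} \<gamma>" "finite Sh" "\<rho> > 0"
    and ident: "\<And>s s0. \<lbrakk>s \<in> {a..b}; s0 \<in> {a..b}; \<gamma> s = \<gamma> s0\<rbrakk> \<Longrightarrow> \<exists>k\<in>Sh. s + k = s0"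
  shows "\<exists>w>0. \<forall>s\<in>{a..b}. \<forall>s0\<in>{a..b}. dist (\<gamma> s) (\<gamma> s0) < w \<longrightarrow> (\<exists>k\<in>Sh. \<bar>s + k - s0\<bar> < \<rho>)"
proof -
  \<comment> \<open>Q consists of the pairs that no translation in Sh brings within \<rho>. It is
    compact and contains no pair with equal images, so the distance of the images has a positive
    minimum on it.\<close>
  define Q where "Q = ({a..b} \<times> {a..b}) \<inter> (\<Inter>k\<in>Sh. {z. \<rho> \<le> \<bar>fst z + k - snd z\<bar>})"
  have "closed {z :: real \<times> real. \<rho> \<le> \<bar>fst z + k - snd z\<bar>}" for k
    by (intro closed_Collect_le continuous_intros)
  then have Q: "compact Q" unfolding Q_def
    by (intro compact_Int_closed compact_Times closed_INT) auto
  show ?thesis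
  proof (cases "Q = {}")
    case True
    then show ?thesis by (intro exI[of _ 1]) (fastforce simp: Q_def)
  next
    case False
    have "continuous_on Q (\<lambda>z. dist (\<gamma> (fst z)) (\<gamma> (snd z)))"
      by (intro continuous_on_dist continuous_on_compose2[OF assms(1)] continuous_intros) (auto simp: Q_def)
    from continuous_attains_inf[OF Q False this] obtain z where
      z: "z \<in> Q" "\<And>z'. z' \<in> Q \<Longrightarrow> dist (\<gamma> (fst z)) (\<gamma> (snd z)) \<le> dist (\<gamma> (fst z')) (\<gamma> (snd z'))" by blast
    have "\<gamma> (fst z) \<noteq> \<gamma> (snd z)"
      using ident[of "fst z" "snd z"] z(1) \<open>\<rho> > 0\<close> by (force simp: Q_def)
    then have pos: "dist (\<gamma> (fst z)) (\<gamma> (snd z)) > 0" by simp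
    show ?thesis
    proof (intro exI[of _ "dist (\<gamma> (fst z)) (\<gamma> (snd z))"] conjI pos ballI impI)
      fix s s0 assume h: "s \<in> {a..b}" "s0 \<in> {a..b}" "dist (\<gamma> s) (\<gamma> s0) < dist (\<gamma> (fst z)) (\<gamma> (snd z))"
      show "\<exists>k\<in>Sh. \<bar>s + k - s0\<bar> < \<rho>"
      proof (rule ccontr)
        assume "\<not> ?thesis"
        then have "(s, s0) \<in> Q" using h by (auto simp: Q_def not_less)
        then show False using z(2)[of "(s, s0)"] h(3) by simp
      qed
    qed
  qed
qed

text \<open>On a longer arc the point at \<open>x + \<rho>'\<close> would be close to
  \<open>\<gamma> x\<close>, and some k in Sh would lie within less than \<rho>' of \<rho>'. But 0
  has distance \<rho>' from it, and a full period at least \<open>b - a - \<rho>'\<close>, which is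
  no smaller because \<open>\<rho>' \<le> (b - a) / 2\<close>.\<close>

lemma no_return:
  fixes \<gamma> :: "real \<Rightarrow> 'a::metric_space"
  assumes "a < b" "continuous_on {a..b} \<gamma>" "finite Sh" "\<rho> > 0"
    and Sh: "\<And>k. k \<in> Sh \<Longrightarrow> k = 0 \<or> \<bar>k\<bar> = b - a"
    and ident: "\<And>s s0. \<lbrakk>s \<in> {a..b}; s0 \<in> {a..b}; \<gamma> s = \<gamma> s0\<rbrakk> \<Longrightarrow> \<exists>k\<in>Sh. s + k = s0"
  shows "\<exists>w>0. \<forall>x\<in>{a..b}. \<forall>y\<in>{a..b}. x \<le> y \<and> (\<forall>z\<in>{x..y}. dist (\<gamma> x) (\<gamma> z) < w) \<longrightarrow> y - x < \<rho>"
proof -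
  define \<rho>' where "\<rho>' = min \<rho> ((b - a) / 2)"
  have \<rho>': "\<rho>' > 0" "\<rho>' \<le> \<rho>" "2 * \<rho>' \<le> b - a"
    using assms(1,4) by (auto simp: \<rho>'_def min_def)
  from near_shift[OF assms(2,3) \<rho>'(1) ident] obtain w where "w > 0" and
    w: "\<forall>s\<in>{a..b}. \<forall>s0\<in>{a..b}. dist (\<gamma> s) (\<gamma> s0) < w \<longrightarrow> (\<exists>k\<in>Sh. \<bar>s + k - s0\<bar> < \<rho>')"
    by blast
  show ?thesis
  proof (intro exI[of _ w] conjI \<open>w > 0\<close> ballI impI; elim conjE)
    fix x y assume h: "x \<in> {a..b}" "y \<in> {a..b}" "x \<le> y" "\<forall>z\<in>{x..y}. dist (\<gamma> x) (\<gamma> z) < w"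
    show "y - x < \<rho>"
    proof (rule ccontr)
      assume "\<not> y - x < \<rho>"
      then have z: "x + \<rho>' \<in> {x..y}" "x + \<rho>' \<in> {a..b}" using \<rho>' h by auto
      then obtain k where "k \<in> Sh" "\<bar>x + k - (x + \<rho>')\<bar> < \<rho>'" using w h by blast
      then show False using Sh[of k] \<rho>' by (auto simp: abs_if split: if_splits)
    qed
  qed
qed

text \<open>The sets \<open>O' s1\<close> are saturated for the identifications made by X, so the
  quotient map sends them to open subsets of the strip even where end rulings are glued. A Lebesgue
  number of the resulting cover of the compact curve is the uniform r.\<close>

lemma strip_lift:
  assumes surf: "strip_is_surface N a b \<gamma> \<delta>" and "0 < \<delta>" "0 < \<eta>" "0 < w"
    and cont: "continuous_on {a..b} \<gamma>"
  shows "\<exists>r>0. \<forall>s0\<in>{a..b}. \<forall>p\<in>strip N a b \<gamma> \<delta>. dist p (\<gamma> s0) < r \<longrightarrow>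
    (\<exists>s\<in>{a..b}. \<exists>v. \<bar>v\<bar> < \<eta> \<and> p = envelope N a b \<gamma> (s, v) \<and> dist (\<gamma> s) (\<gamma> s0) < w)"
proof -
  define X where "X = envelope N a b \<gamma>"
  define D where "D = strip_domain a b \<delta>"
  have q: "quotient_map (top_of_set D) (top_of_set (X ` D)) X"
    and inj: "\<And>s v s' v'. \<lbrakk>(s, v) \<in> D; (s', v') \<in> D; X (s, v) = X (s', v')\<rbrakk> \<Longrightarrow> v = v' \<and> \<gamma> s = \<gamma> s'"
    using surf unfolding strip_is_surface_def X_def D_def Let_def by blast+
  have q': "openin (top_of_set D) {z. z \<in> D \<and> X z \<in> U} = openin (top_of_set (X ` D)) U" if "U \<subseteq> X ` D" for U
    using q that unfolding quotient_map_def by simp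
  have S: "strip N a b \<gamma> \<delta> = X ` D" by (simp add: strip_def X_def D_def)
  have D: "(s, v) \<in> D \<longleftrightarrow> s \<in> {a..b} \<and> \<bar>v\<bar> < \<delta>" for s v by (auto simp: D_def strip_domain_def)
  have X0: "X (s, 0) = \<gamma> s" for s by (simp add: X_def envelope_def Let_def)
  \<comment> \<open>Half of w, because s and s0 are both compared with s1.\<close>
  define O' where "O' = (\<lambda>s1. {z \<in> D. \<bar>snd z\<bar> < \<eta> \<and> dist (\<gamma> (fst z)) (\<gamma> s1) < w / 2})"
  have op: "\<exists>G. open G \<and> G \<inter> X ` D = X ` O' s1" for s1
  proof -
    have sat: "{z. z \<in> D \<and> X z \<in> X ` O' s1} = O' s1"
    proof (intro equalityI subsetI)
      fix z assume "z \<in> {z. z \<in> D \<and> X z \<in> X ` O' s1}"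
      then obtain z' where z: "z \<in> D" "z' \<in> O' s1" "X z = X z'" by auto
      then have "snd z = snd z' \<and> \<gamma> (fst z) = \<gamma> (fst z')"
        using inj[of "fst z" "snd z" "fst z'" "snd z'"] by (auto simp: O'_def)
      then show "z \<in> O' s1" using z by (auto simp: O'_def)
    qed (auto simp: O'_def)
    have "continuous_on D (\<lambda>z. \<gamma> (fst z))"
      by (rule continuous_on_compose2[OF cont]) (auto intro!: continuous_intros simp: D_def strip_domain_def)
    then have c: "continuous_on D (\<lambda>z. (\<bar>snd z\<bar>, dist (\<gamma> (fst z)) (\<gamma> s1)))"
      by (intro continuous_intros)
    have "openin (top_of_set D) (D \<inter> (\<lambda>z. (\<bar>snd z\<bar>, dist (\<gamma> (fst z)) (\<gamma> s1))) -` ({..<\<eta>} \<times> {..<w / 2}))"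
      by (rule continuous_openin_preimage_gen[OF c]) (intro open_Times open_lessThan)
    also have "D \<inter> (\<lambda>z. (\<bar>snd z\<bar>, dist (\<gamma> (fst z)) (\<gamma> s1))) -` ({..<\<eta>} \<times> {..<w / 2}) = O' s1"
      by (auto simp: O'_def)
    finally have "openin (top_of_set D) (O' s1)" .
    moreover have "X ` O' s1 \<subseteq> X ` D" by (auto simp: O'_def)
    ultimately have "openin (top_of_set (X ` D)) (X ` O' s1)"
      using q' [of "X ` O' s1"] unfolding sat by blast
    then show ?thesis unfolding openin_open by (metis Int_commute)
  qed
  have "compact (\<gamma> ` {a..b})" by (intro compact_continuous_image cont) auto
  moreover have "\<gamma> ` {a..b} \<subseteq> \<Union>{G. open G \<and> (\<exists>s1\<in>{a..b}. G \<inter> X ` D = X ` O' s1)}"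
  proof
    fix p assume "p \<in> \<gamma> ` {a..b}"
    then obtain s1 where s1: "s1 \<in> {a..b}" "p = \<gamma> s1" by blast
    obtain G where G: "open G" "G \<inter> X ` D = X ` O' s1" using op by blast
    have "(s1, 0) \<in> O' s1" using s1 assms(2-4) by (simp add: O'_def D)
    then have "p \<in> X ` O' s1" by (metis X0 imageI s1(2))
    then show "p \<in> \<Union>{G. open G \<and> (\<exists>s1\<in>{a..b}. G \<inter> X ` D = X ` O' s1)}" using G s1 by blast
  qed
  ultimately obtain r where "0 < r" and
    r: "\<And>p. p \<in> \<gamma> ` {a..b} \<Longrightarrow> \<exists>G\<in>{G. open G \<and> (\<exists>s1\<in>{a..b}. G \<inter> X ` D = X ` O' s1)}. ball p r \<subseteq> G"
    by (rule Heine_Borel_lemma) auto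
  show ?thesis unfolding S
  proof (intro exI[of _ r] conjI \<open>0 < r\<close> ballI impI)
    fix s0 p assume h: "s0 \<in> {a..b}" "p \<in> X ` D" "dist p (\<gamma> s0) < r"
    obtain G s1 where G: "ball (\<gamma> s0) r \<subseteq> G" "G \<inter> X ` D = X ` O' s1" using r[of "\<gamma> s0"] h(1) by blast
    have "p \<in> ball (\<gamma> s0) r" using h(3) by (simp add: dist_commute)
    then have "p \<in> X ` O' s1" using G h(2) by blast
    then obtain z where z: "z \<in> O' s1" "p = X z" by blast
    have D0: "(s0, 0) \<in> D" using h(1) assms(2) by (simp add: D)
    then have "X (s0, 0) \<in> X ` O' s1" unfolding G(2)[symmetric]
      by (intro IntI imageI) (use G(1) \<open>0 < r\<close> X0[of s0] in auto)
    then obtain z0 where z0: "z0 \<in> O' s1" "X (s0, 0) = X z0" by blast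
    have "\<gamma> s0 = \<gamma> (fst z0)" using inj[of s0 0 "fst z0" "snd z0"] D0 z0 by (auto simp: O'_def)
    then have "dist (\<gamma> s0) (\<gamma> s1) < w / 2" using z0(1) by (simp add: O'_def)
    moreover have "dist (\<gamma> (fst z)) (\<gamma> s1) < w / 2" using z(1) by (simp add: O'_def)
    ultimately have "dist (\<gamma> (fst z)) (\<gamma> s0) < w" using dist_triangle_half_l by blast
    then show "\<exists>s\<in>{a..b}. \<exists>v. \<bar>v\<bar> < \<eta> \<and> p = envelope N a b \<gamma> (s, v) \<and> dist (\<gamma> s) (\<gamma> s0) < w"
      using z D[of "fst z" "snd z"] unfolding X_def[symmetric] by (intro bexI[of _ "fst z"] exI[of _ "snd z"]) (auto simp: O'_def)
  qed
qed

text \<open>The parametrization is affine in v, so d is a difference quotient of it in v and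
  inherits one continuous derivative in s. If \<open>d s\<close> were
  \<open>c *\<^sub>R t s\<close>, the vector (c, -1) would lie in the kernel of the differential on
  the curve, contrary to the immersion property.\<close>

lemma strip_ruling_C1:
  assumes surf: "strip_is_surface N a b \<gamma> \<delta>" and "0 < \<delta>" "a < b"
    and env: "\<And>s v. s \<in> {a..b} \<Longrightarrow> envelope N a b \<gamma> (s, v) = \<gamma> s + v *\<^sub>R d s"
    and t: "\<And>s. s \<in> {a..b} \<Longrightarrow> (\<gamma> has_vector_derivative t s) (at s within {a..b})"
  obtains d1 L where "\<And>s. s \<in> {a..b} \<Longrightarrow> (d has_vector_derivative d1 s) (at s within {a..b})"
    "0 \<le> L" "\<And>s. s \<in> {a..b} \<Longrightarrow> norm (d1 s) \<le> L"
    "\<And>s c. s \<in> {a..b} \<Longrightarrow> d s \<noteq> c *\<^sub>R t s"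
proof -
  define X where "X = envelope N a b \<gamma>"
  define D where "D = strip_domain a b \<delta>"
  have ck: "C_k_on (Suc 0) X D" and inj: "\<And>p. p \<in> D \<Longrightarrow> inj (frechet_derivative X (at p within D))"
    using surf unfolding strip_is_surface_def X_def D_def Let_def One_nat_def by blast+
  have D: "(s, v) \<in> D \<longleftrightarrow> s \<in> {a..b} \<and> \<bar>v\<bar> < \<delta>" for s v by (auto simp: D_def strip_domain_def)
  have Xd: "(X has_derivative frechet_derivative X (at p within D)) (at p within D)" if "p \<in> D" for p
    using C_k_on_SucD(1)[OF ck that] by (simp add: frechet_derivative_works)
  have "(1, 0) \<in> (Basis :: (real \<times> real) set)" by (auto simp: Basis_prod_def)
  from C_k_on_SucD(2)[OF ck this] have Xc: "continuous_on D (\<lambda>p. frechet_derivative X (at p within D) (1, 0))" by simp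
  define X1 where "X1 = (\<lambda>s v. frechet_derivative X (at (s, v) within D) (1, 0))"
  have X1d: "((\<lambda>\<sigma>. X (\<sigma>, v)) has_vector_derivative X1 s v) (at s within {a..b})" if "s \<in> {a..b}" "\<bar>v\<bar> < \<delta>" for s v
  proof -
    have "((\<lambda>\<sigma>. (\<sigma>, v)) has_vector_derivative (1, 0)) (at s within {a..b})"
      unfolding has_vector_derivative_def
      by (auto intro!: derivative_eq_intros simp: zero_prod_def)
    moreover have "(X has_derivative frechet_derivative X (at (s, v) within D)) (at (s, v) within (\<lambda>\<sigma>. (\<sigma>, v)) ` {a..b})"
      by (rule has_derivative_subset[OF Xd]) (use that D in auto)
    ultimately show ?thesis using vector_derivative_diff_chain_within[of "\<lambda>\<sigma>. (\<sigma>, v)" "(1, 0)" s "{a..b}" X]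
      by (simp add: X1_def o_def)
  qed
  define v0 where "v0 = \<delta> / 2"
  have v0: "v0 \<noteq> 0" "\<bar>v0\<bar> < \<delta>" using assms(2) by (auto simp: v0_def)
  define d1 where "d1 = (\<lambda>s. (1 / v0) *\<^sub>R (X1 s v0 - X1 s 0))"
  have d: "(d has_vector_derivative d1 s) (at s within {a..b})" if s: "s \<in> {a..b}" for s
  proof (rule has_vector_derivative_transform[OF s])
    show "((\<lambda>\<sigma>. (1 / v0) *\<^sub>R (X (\<sigma>, v0) - X (\<sigma>, 0))) has_vector_derivative d1 s) (at s within {a..b})"
      unfolding d1_def using X1d[OF s] v0 assms(2)
      by (intro bounded_linear.has_vector_derivative[OF bounded_linear_scaleR_right] has_vector_derivative_diff) auto
    show "d \<sigma> = (1 / v0) *\<^sub>R (X (\<sigma>, v0) - X (\<sigma>, 0))" if "\<sigma> \<in> {a..b}" for \<sigma>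
      using env[OF that] v0 by (simp add: X_def)
  qed
  have X1c: "continuous_on {a..b} (\<lambda>s. X1 s v)" if "\<bar>v\<bar> < \<delta>" for v
    unfolding X1_def by (rule continuous_on_compose2[OF Xc]) (use that D in \<open>auto intro!: continuous_intros\<close>)
  have "continuous_on {a..b} d1" unfolding d1_def using v0 assms(2) by (intro continuous_intros X1c) auto
  then have "bounded (d1 ` {a..b})" by (intro compact_imp_bounded compact_continuous_image) auto
  then obtain L where L: "L > 0" "\<And>s. s \<in> {a..b} \<Longrightarrow> norm (d1 s) \<le> L" unfolding bounded_pos by auto
  have nt: "d s \<noteq> c *\<^sub>R t s" if s: "s \<in> {a..b}" for s c
  proof
    assume eq: "d s = c *\<^sub>R t s"
    let ?A = "frechet_derivative X (at (s, 0) within D)"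
    have sD: "(s, 0) \<in> D" using s assms(2) D by simp
    have l: "linear ?A" using Xd[OF sD] has_derivative_linear by blast
    have "((\<lambda>\<sigma>. X (\<sigma>, 0)) has_vector_derivative t s) (at s within {a..b})"
      by (rule has_vector_derivative_transform[OF s _ t[OF s]]) (simp add: X_def env)
    then have A1: "?A (1, 0) = t s"
      using X1d[OF s, of 0] assms(2,3) s vector_derivative_unique_within_closed_interval[of a b s "\<lambda>\<sigma>. X (\<sigma>, 0)"]
      by (simp add: X1_def)
    have "((\<lambda>v. (s, v)) has_vector_derivative (0, 1)) (at 0 within {-\<delta><..<\<delta>})"
      unfolding has_vector_derivative_def
      by (auto intro!: derivative_eq_intros simp: zero_prod_def)
    moreover have "(X has_derivative ?A) (at (s, 0) within (\<lambda>v. (s, v)) ` {-\<delta><..<\<delta>})"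
      by (rule has_derivative_subset[OF Xd[OF sD]]) (use s D in auto)
    ultimately have "((\<lambda>v. X (s, v)) has_vector_derivative ?A (0, 1)) (at 0 within {-\<delta><..<\<delta>})"
      using vector_derivative_diff_chain_within[of "\<lambda>v. (s, v)" "(0, 1)" 0 "{-\<delta><..<\<delta>}" X ?A] by (simp add: o_def)
    moreover have "at 0 within {-\<delta><..<\<delta>} = at 0" by (rule at_within_open) (use assms(2) in auto)
    ultimately have "((\<lambda>v. \<gamma> s + v *\<^sub>R d s) has_vector_derivative ?A (0, 1)) (at 0)"
      by (simp only: X_def env[OF s])
    moreover have "((\<lambda>v. \<gamma> s + v *\<^sub>R d s) has_vector_derivative d s) (at 0)"
      by (auto intro!: derivative_eq_intros)
    ultimately have A2: "?A (0, 1) = d s" using vector_derivative_unique_at by blast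
    have "(c, -1) = c *\<^sub>R (1, 0) - (0, 1 :: real)" by simp
    then have "?A (c, -1) = c *\<^sub>R ?A (1, 0) - ?A (0, 1)"
      using linear_diff[OF l] linear_cmul[OF l] by metis
    then have "?A (c, -1) = ?A (0, 0)" using A1 A2 eq linear_0[OF l] by (simp add: zero_prod_def)
    then show False using inj[OF sD] by (auto dest: injD)
  qed
  show ?thesis using that[OF d _ L(2) nt] L(1) by simp
qed

lemma norm_const_derivative_orthogonal:
  fixes n :: "real \<Rightarrow> 'a::real_inner"
  assumes "A < B" "s \<in> {A..B}" "(n has_vector_derivative n1) (at s within {A..B})"
    and "\<And>x. x \<in> {A..B} \<Longrightarrow> norm (n x) = c"
  shows "n s \<bullet> n1 = 0"
proof -
  have "((\<lambda>x. n x \<bullet> n x) has_vector_derivative (n s \<bullet> n1 + n1 \<bullet> n s)) (at s within {A..B})"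
    by (rule bounded_bilinear.has_vector_derivative[OF bounded_bilinear_inner assms(3,3)])
  then have "((\<lambda>x. c * c) has_vector_derivative (n s \<bullet> n1 + n1 \<bullet> n s)) (at s within {A..B})"
    by (rule has_vector_derivative_transform[OF assms(2), rotated]) (simp add: assms(4) dot_square_norm power2_eq_square)
  moreover have "((\<lambda>x. c * c) has_vector_derivative 0) (at s within {A..B})" by (rule has_vector_derivative_const)
  ultimately have "n s \<bullet> n1 + n1 \<bullet> n s = 0"
    using vector_derivative_unique_within_closed_interval[of A B s "\<lambda>x. c * c"] assms(1,2) by simp
  then show ?thesis by (simp add: inner_commute)
qed

text \<open>The function G extends the curve to a larger interval, on which every point is the translate
  of a point of the original interval by an element of Sh. For a closed curve this provides
  neighbourhoods of the two ends; for an arc Sh contains only 0.\<close>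

lemma total_curvature_strip:
  fixes N :: "real^3 \<Rightarrow> real^3" and \<gamma> G t t2 n1 :: "real \<Rightarrow> real^3"
  assumes ab: "a < b" "A \<le> a" "b \<le> B" and \<delta>: "0 < \<delta>" and surf: "strip_is_surface N a b \<gamma> \<delta>"
    and G: "\<And>s. s \<in> {A..B} \<Longrightarrow> (G has_vector_derivative t s) (at s within {A..B})"
    and t: "\<And>s. s \<in> {A..B} \<Longrightarrow> (t has_vector_derivative t2 s) (at s within {A..B})"
    and t2: "continuous_on {A..B} t2"
    and n: "\<And>s. s \<in> {A..B} \<Longrightarrow> ((\<lambda>s. N (G s)) has_vector_derivative n1 s) (at s within {A..B})"
    and norm_n: "\<And>s. s \<in> {A..B} \<Longrightarrow> norm (N (G s)) = 1"
    and n_t: "\<And>s. s \<in> {A..B} \<Longrightarrow> N (G s) \<bullet> t s = 0"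
    and G_eq: "\<And>s. s \<in> {a..b} \<Longrightarrow> G s = \<gamma> s"
    and speed: "\<And>s. s \<in> {a..b} \<Longrightarrow> norm (dot_on a b \<gamma> s) = 1"
    and n1_nz: "\<And>s. s \<in> {a..b} \<Longrightarrow> dot_on a b (N \<circ> \<gamma>) s \<noteq> 0"
    and Sh: "finite Sh" "0 \<in> Sh" "\<And>k. k \<in> Sh \<Longrightarrow> k = 0 \<or> \<bar>k\<bar> = b - a"
    and cover: "\<And>s. s \<in> {A..B} \<Longrightarrow> \<exists>k\<in>Sh. s - k \<in> {a..b}"
    and E: "finite E" "\<And>s. s \<in> {A<..<B} - E \<Longrightarrow> \<exists>k\<in>Sh. s - k \<in> {a<..<b}"
    and shift: "\<And>s k. \<lbrakk>s \<in> {a..b}; k \<in> Sh\<rbrakk> \<Longrightarrow> s + k \<in> {A..B} \<and> G (s + k) = G s \<and> t (s + k) = t s \<and> n1 (s + k) = n1 s"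
    and ident: "\<And>s s0. \<lbrakk>s \<in> {a..b}; s0 \<in> {a..b}; \<gamma> s = \<gamma> s0\<rbrakk> \<Longrightarrow> \<exists>k\<in>Sh. s + k = s0"
  shows "total_curvature (strip N a b \<gamma> \<delta>) a b \<gamma>
    = ennreal (integral {a..b} (\<lambda>s. \<bar>geodesic_curvature N a b \<gamma> s\<bar>))"
proof -
  define nn where "nn = (\<lambda>s. N (G s))"
  define d where "d = (\<lambda>s. (1 / norm (n1 s)) *\<^sub>R cross3 (nn s) (n1 s))"
  have AB: "A < B" using ab by simp
  have sub: "{a..b} \<subseteq> {A..B}" using ab by auto
  note within = has_vector_derivative_within_subset[OF _ sub]
  have \<gamma>d: "(\<gamma> has_vector_derivative t s) (at s within {a..b})" if "s \<in> {a..b}" for s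
    using that sub by (intro has_vector_derivative_transform[OF that _ within[OF G]]) (auto simp: G_eq)
  have dot1: "dot_on a b \<gamma> s = t s" if "s \<in> {a..b}" for s
    unfolding dot_on_def by (rule vector_derivative_within_closed_interval[OF ab(1) that \<gamma>d[OF that]])
  have dot2: "dot_on a b (dot_on a b \<gamma>) s = t2 s" if "s \<in> {a..b}" for s
    unfolding dot_on_def[of a b "dot_on a b \<gamma>"]
    using that sub by (intro vector_derivative_within_closed_interval[OF ab(1) that]
      has_vector_derivative_transform[OF that _ within[OF t]]) (auto simp: dot1)
  have dotn: "dot_on a b (N \<circ> \<gamma>) s = n1 s" if "s \<in> {a..b}" for s
    unfolding dot_on_def
    using that sub by (intro vector_derivative_within_closed_interval[OF ab(1) that]
      has_vector_derivative_transform[OF that _ within[OF n]]) (auto simp: G_eq)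
  have env: "envelope N a b \<gamma> (s, v) = \<gamma> s + v *\<^sub>R d s" if "s \<in> {a..b}" for s v
    using dotn[OF that] by (simp add: envelope_def Let_def d_def nn_def G_eq[OF that])
  have gc: "geodesic_curvature N a b \<gamma> s = t2 s \<bullet> cross3 (nn s) (t s)" if "s \<in> {a..b}" for s
    by (simp add: geodesic_curvature_def dot1[OF that] dot2[OF that] nn_def G_eq[OF that])
  \<comment> \<open>Speed and nonvanishing derivative of the normal are known on
    \<open>{a..b}\<close>; translations in Sh carry them over to \<open>{A..B}\<close>.\<close>
  have reduce: "\<exists>s'\<in>{a..b}. G s = G s' \<and> t s = t s' \<and> n1 s = n1 s'" if s: "s \<in> {A..B}" for s
  proof -
    obtain k where "k \<in> Sh" "s - k \<in> {a..b}" using cover[OF s] by blast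
    then show ?thesis using shift[of "s - k" k] by force
  qed
  have norm_t: "norm (t s) = 1" if "s \<in> {A..B}" for s
    using reduce[OF that] speed dot1 by metis
  have n1_nz': "n1 s \<noteq> 0" if "s \<in> {A..B}" for s
    using reduce[OF that] n1_nz dotn by metis
  have n_n1: "nn s \<bullet> n1 s = 0" if "s \<in> {A..B}" for s
    unfolding nn_def by (rule norm_const_derivative_orthogonal[OF AB that n[OF that] norm_n])
  have norm_d: "norm (d s) = 1" if "s \<in> {A..B}" for s
  proof -
    have "(norm (cross3 (nn s) (n1 s)))\<^sup>2 = (norm (n1 s))\<^sup>2"
      using norm_cross[of "nn s" "n1 s"] n_n1[OF that] norm_n[OF that] by (simp add: nn_def)
    then have "norm (cross3 (nn s) (n1 s)) = norm (n1 s)" by simp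
    then show ?thesis using n1_nz'[OF that] by (simp add: d_def)
  qed
  have d_perp: "d s \<bullet> nn s = 0" "d s \<bullet> n1 s = 0" for s
    by (auto simp: d_def dot_cross_self)
  have d_shift: "d (s + k) = d s" if "s \<in> {a..b}" "k \<in> Sh" for s k
    using shift[OF that] by (simp add: d_def nn_def)
  obtain d1 L where d1: "\<And>s. s \<in> {a..b} \<Longrightarrow> (d has_vector_derivative d1 s) (at s within {a..b})"
    "0 \<le> L" "\<And>s. s \<in> {a..b} \<Longrightarrow> norm (d1 s) \<le> L" "\<And>s c. s \<in> {a..b} \<Longrightarrow> d s \<noteq> c *\<^sub>R t s"
    using strip_ruling_C1[OF surf \<delta> ab(1) env \<gamma>d] by metis
  \<comment> \<open>In the plane orthogonal to \<open>nn s\<close>, a ruling without component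
    across the curve would be a multiple of \<open>t s\<close>.\<close>
  have transversal: "d s \<bullet> cross3 (nn s) (t s) \<noteq> 0" if s: "s \<in> {A..B}" for s
  proof
    assume "d s \<bullet> cross3 (nn s) (t s) = 0"
    then have dt: "d s = (d s \<bullet> t s) *\<^sub>R t s"
      using orthonormal_frame_expansion[of "nn s" "t s" "d s"] norm_n[OF s] norm_t[OF s] n_t[OF s] d_perp(1)[of s]
      by (simp add: nn_def)
    obtain k where k: "k \<in> Sh" "s - k \<in> {a..b}" using cover[OF s] by blast
    then have "d s = d (s - k)" "t s = t (s - k)" using d_shift[of "s - k" k] shift[of "s - k" k] by auto
    then show False using dt d1(4)[OF k(2)] by metis
  qed
  have nn_c: "continuous_on {A..B} nn" unfolding nn_def using continuous_on_vector_derivative[OF n] by blast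
  \<comment> \<open>Off E, some translate of s is an interior point of \<open>{a..b}\<close>, where
    the derivative within the interval is a full derivative.\<close>
  have d_int: "\<exists>y. (d has_vector_derivative y) (at s) \<and> norm y \<le> L" if s: "s \<in> {A<..<B} - E" for s
  proof -
    obtain k where k: "k \<in> Sh" "s - k \<in> {a<..<b}" using E(2)[OF s] by blast
    have "(d has_vector_derivative d1 (s - k)) (at (s - k))"
      using d1(1)[of "s - k"] k(2) at_within_Icc_at[of a "s - k" b] by simp
    then have "((\<lambda>x. d (x - k)) has_vector_derivative d1 (s - k)) (at s)" by (rule has_vector_derivative_translate)
    then have "(d has_vector_derivative d1 (s - k)) (at s)"
      by (rule has_vector_derivative_transform_within_open[of _ _ _ "{a + k<..<b + k}"])
        (use k d_shift[of _ k] in \<open>auto, metis add_diff_cancel_right' diff_add_cancel less_imp_le atLeastAtMost_iff diff_le_eq le_diff_eq\<close>)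
    then show ?thesis using d1(3)[of "s - k"] k(2) by auto
  qed
  then obtain d1' where d1': "\<And>s. s \<in> {A<..<B} - E \<Longrightarrow> (d has_vector_derivative d1' s) (at s) \<and> norm (d1' s) \<le> L"
    by metis
  \<comment> \<open>At exceptional points continuity comes from gluing: finitely many closed
    translates of \<open>{a..b}\<close> cover \<open>{A..B}\<close>, and d is continuous on
    each.\<close>
  have d_cont: "continuous_on {A..B} d"
  proof -
    have d_ab: "continuous_on {a..b} d" using continuous_on_vector_derivative[OF d1(1)] by blast
    have "continuous_on {a + k..b + k} d" if k: "k \<in> Sh" for k
    proof (rule continuous_on_eq)
      show "continuous_on {a + k..b + k} (\<lambda>x. d (x - k))"
        by (rule continuous_on_compose2[OF d_ab]) (auto intro!: continuous_intros)
      show "d (x - k) = d x" if "x \<in> {a + k..b + k}" for x using d_shift[of "x - k" k] k that by auto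
    qed
    then have "continuous_on (\<Union>k\<in>Sh. {a + k..b + k}) d"
      by (intro continuous_on_closed_Union Sh(1)) auto
    then show ?thesis
    proof (rule continuous_on_subset)
      show "{A..B} \<subseteq> (\<Union>k\<in>Sh. {a + k..b + k})" using cover by (fastforce simp: algebra_simps)
    qed
  qed
  interpret unrolled_strip A B L G t t2 nn n1 d d1' E
    by unfold_locales (use AB G t t2 n norm_t norm_n n_t norm_d d_perp transversal d_cont E(1) d1' d1(2) in \<open>auto simp: nn_def\<close>)
  have Xenv: "X s v = envelope N a b \<gamma> (s, v)" if "s \<in> {a..b}" for s v
    using env[OF that] by (simp add: X_def G_eq[OF that])
  have \<gamma>c: "continuous_on {a..b} \<gamma>" using continuous_on_vector_derivative[OF \<gamma>d] by blast
  interpret unrolled_strip_surface A B L G t t2 nn n1 d d1' E a b \<delta> "strip N a b \<gamma> \<delta>"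
  proof unfold_locales
    show "X s v \<in> strip N a b \<gamma> \<delta>" if "s \<in> {a..b}" "\<bar>v\<bar> < \<delta>" for s v
      unfolding strip_def Xenv[OF that(1)]
      by (rule imageI) (use that in \<open>auto simp: strip_domain_def\<close>)
    show "\<exists>r>0. \<forall>s0\<in>{a..b}. \<forall>p\<in>strip N a b \<gamma> \<delta>. dist p (G s0) < r \<longrightarrow>
      (\<exists>s\<in>{A..B}. \<exists>v. \<bar>s - s0\<bar> < \<rho> \<and> \<bar>v\<bar> < \<eta> \<and> p = X s v)" if "\<rho> > 0" "\<eta> > 0" for \<rho> \<eta>
    proof -
      have "\<exists>w>0. \<forall>s\<in>{a..b}. \<forall>s0\<in>{a..b}. dist (\<gamma> s) (\<gamma> s0) < w \<longrightarrow> (\<exists>k\<in>Sh. \<bar>s + k - s0\<bar> < \<rho>)"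
        by (rule near_shift[OF \<gamma>c Sh(1) that(1) ident])
      then obtain w where w: "w > 0" "\<forall>s\<in>{a..b}. \<forall>s0\<in>{a..b}. dist (\<gamma> s) (\<gamma> s0) < w \<longrightarrow> (\<exists>k\<in>Sh. \<bar>s + k - s0\<bar> < \<rho>)"
        by (elim exE conjE)
      from strip_lift[OF surf \<delta> that(2) w(1) \<gamma>c] obtain r where r: "r > 0"
        "\<forall>s0\<in>{a..b}. \<forall>p\<in>strip N a b \<gamma> \<delta>. dist p (\<gamma> s0) < r \<longrightarrow>
          (\<exists>s\<in>{a..b}. \<exists>v. \<bar>v\<bar> < \<eta> \<and> p = envelope N a b \<gamma> (s, v) \<and> dist (\<gamma> s) (\<gamma> s0) < w)"
        by (elim exE conjE)
      show ?thesis
      proof (intro exI[of _ r] conjI r(1) ballI impI)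
        fix s0 p assume h: "s0 \<in> {a..b}" "p \<in> strip N a b \<gamma> \<delta>" "dist p (G s0) < r"
        then have "dist p (\<gamma> s0) < r" by (simp add: G_eq)
        then obtain s v where sv: "s \<in> {a..b}" "\<bar>v\<bar> < \<eta>" "p = envelope N a b \<gamma> (s, v)" "dist (\<gamma> s) (\<gamma> s0) < w"
          using r(2) h by blast
        obtain k where k: "k \<in> Sh" "\<bar>s + k - s0\<bar> < \<rho>" using w(2) sv h(1) by blast
        \<comment> \<open>The parameter s of p may sit at the opposite end of \<open>{a..b}\<close>;
          the translation moves it next to s0 without changing the point.\<close>
        have "X (s + k) v = X s v" using shift[OF sv(1) k(1)] d_shift[OF sv(1) k(1)] by (simp add: X_def)
        then show "\<exists>s\<in>{A..B}. \<exists>v. \<bar>s - s0\<bar> < \<rho> \<and> \<bar>v\<bar> < \<eta> \<and> p = X s v"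
          using sv k Xenv[OF sv(1)] shift[OF sv(1) k(1)] by (intro bexI[of _ "s + k"] exI[of _ v]) auto
      qed
    qed
    show "\<exists>w>0. \<forall>x\<in>{a..b}. \<forall>y\<in>{a..b}. x \<le> y \<and> (\<forall>z\<in>{x..y}. dist (G x) (G z) < w) \<longrightarrow> y - x < \<rho>" if "\<rho> > 0" for \<rho>
      by (rule no_return[OF ab(1) continuous_on_eq[OF \<gamma>c] Sh(1) that Sh(3)]) (use ident in \<open>auto simp: G_eq\<close>)
  qed (use ab \<delta> in auto)
  have "total_curvature (strip N a b \<gamma> \<delta>) a b \<gamma> = total_curvature (strip N a b \<gamma> \<delta>) a b G"
    by (rule total_curvature_cong) (simp add: G_eq)
  also have "\<dots> = ennreal (integral {a..b} (\<lambda>s. \<bar>kg s\<bar>))" by (rule total_curvature_eq)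
  also have "integral {a..b} (\<lambda>s. \<bar>kg s\<bar>) = integral {a..b} (\<lambda>s. \<bar>geodesic_curvature N a b \<gamma> s\<bar>)"
    by (rule integral_cong) (simp add: gc kg_def u_def)
  finally show ?thesis .
qed

theorem proposition8p1:
  fixes M :: "(real^3) set" and N :: "real^3 \<Rightarrow> real^3"
    and \<gamma> :: "real \<Rightarrow> real^3" and a b \<delta> :: real
  assumes "regular_surface 3 M" and "compact M" and "unit_normal_field M N"
    and "a < b" and "simple_curve 3 a b \<gamma>" and "\<gamma> ` {a..b} \<subseteq> M"
    and "\<forall>s\<in>{a..b}. norm (dot_on a b \<gamma> s) = 1"
    and "\<forall>s\<in>{a..b}. dot_on a b (N \<circ> \<gamma>) s \<noteq> 0"
    and "0 < \<delta>" and "strip_is_surface N a b \<gamma> \<delta>"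
  shows "total_curvature (strip N a b \<gamma> \<delta>) a b \<gamma>
    = ennreal (integral {a..b} (\<lambda>s. \<bar>geodesic_curvature N a b \<gamma> s\<bar>))"
proof -
  have norm_N: "norm (N p) = 1" if "p \<in> M" for p
    using assms(3) that by (auto simp: unit_normal_field_def)
  note simple = assms(5)[unfolded simple_curve_def]
  show ?thesis
  proof (cases "inj_on \<gamma> {a..b}")
    case True
    obtain t t2 where t: "\<And>s. s \<in> {a..b} \<Longrightarrow> (\<gamma> has_vector_derivative t s) (at s within {a..b})"
      "\<And>s. s \<in> {a..b} \<Longrightarrow> (t has_vector_derivative t2 s) (at s within {a..b})" "continuous_on {a..b} t2"
      by (rule C_k_on_3_real) (use simple in blast)+
    have nb: "at s within {a..b} \<noteq> bot" if "s \<in> {a..b}" for s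
      using that assms(4) by (simp add: trivial_limit_within)
    note nac = normal_along_curve[OF assms(1,3) _ assms(6) t(1) nb]
    show ?thesis
    \<comment> \<open>An arc is kept on its own interval, with the zero translation only and without
      exceptional points.\<close>
    proof (rule total_curvature_strip[OF assms(4) order.refl order.refl assms(9,10) t, where Sh = "{0}" and E = "{}"])
      show "((\<lambda>s. N (\<gamma> s)) has_vector_derivative dot_on a b (N \<circ> \<gamma>) s) (at s within {a..b})" if "s \<in> {a..b}" for s
        using nac(1)[OF that that that] by (simp add: vector_derivative_works dot_on_def o_def)
      show "N (\<gamma> s) \<bullet> t s = 0" if "s \<in> {a..b}" for s by (rule nac(2)[OF that that that])
      show "norm (N (\<gamma> s)) = 1" if "s \<in> {a..b}" for s using assms(6) that by (intro norm_N) auto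
      show "\<exists>k\<in>{0}. s + k = s0" if "s \<in> {a..b}" "s0 \<in> {a..b}" "\<gamma> s = \<gamma> s0" for s s0
        using True that by (auto dest: inj_onD)
    qed (use assms(7,8) in auto)
  next
    case False
    then obtain \<Gamma> where inj: "inj_on \<gamma> {a..<b}" and ck: "C_k_on 3 \<Gamma> UNIV"
      and per: "\<And>s. \<Gamma> (s + (b - a)) = \<Gamma> s" and eq: "\<And>s. s \<in> {a..b} \<Longrightarrow> \<Gamma> s = \<gamma> s"
      using simple by blast
    define T where "T = b - a"
    have T: "T > 0" "b = a + T" using assms(4) by (auto simp: T_def)
    have perT: "\<Gamma> (s + T) = \<Gamma> s" "\<Gamma> (s - T) = \<Gamma> s" for s
      using per[of s] per[of "s - T"] by (auto simp: T_def)
    obtain t t2 where t: "\<And>s. (\<Gamma> has_vector_derivative t s) (at s)"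
      "\<And>s. (t has_vector_derivative t2 s) (at s)" "continuous_on UNIV t2"
      using C_k_on_3_real[OF ck] by auto
    \<comment> \<open>The normal is differentiated along all of \<Gamma>, so every parameter is
      reduced modulo T to \<open>{a..b}\<close> with the floor function.\<close>
    have \<Gamma>M: "range \<Gamma> \<subseteq> M"
    proof
      fix p assume "p \<in> range \<Gamma>"
      then obtain s where s: "p = \<Gamma> s" by blast
      have per_nat: "\<Gamma> (x + real m * T) = \<Gamma> x" for x m
      proof (induction m)
        case (Suc m) then show ?case using perT(1)[of "x + real m * T"] by (simp add: algebra_simps)
      qed simp
      have per_int: "\<Gamma> (x + of_int j * T) = \<Gamma> x" for x j
      proof (cases j rule: int_cases2)
        case (nonneg m) then show ?thesis using per_nat by simp
      next
        case (nonpos m) then show ?thesis using per_nat[of "x + of_int j * T" m] by simp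
      qed
      define x where "x = s + of_int (- \<lfloor>(s - a) / T\<rfloor>) * T"
      have "of_int \<lfloor>(s - a) / T\<rfloor> * T \<le> s - a" "s - a < (of_int \<lfloor>(s - a) / T\<rfloor> + 1) * T"
        using T(1) floor_correct[of "(s - a) / T"] by (auto simp: pos_le_divide_eq[symmetric] pos_divide_less_eq[symmetric])
      then have x: "x \<in> {a..b}" using T by (auto simp: x_def algebra_simps)
      have "p = \<Gamma> x" unfolding s x_def by (rule per_int[symmetric])
      then show "p \<in> M" using eq[OF x] assms(6) x by auto
    qed
    have nac: "(N \<circ> \<Gamma>) differentiable (at s)" "N (\<Gamma> s) \<bullet> t s = 0" for s
      by (rule normal_along_curve[OF assms(1,3) UNIV_I \<Gamma>M t(1)]; simp)+
    define n1 where "n1 = (\<lambda>s. vector_derivative (N \<circ> \<Gamma>) (at s))"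
    have n1: "((\<lambda>s. N (\<Gamma> s)) has_vector_derivative n1 s) (at s)" for s
      using nac(1)[of s] by (simp add: vector_derivative_works n1_def o_def)
    have shift: "t (s + k) = t s" "n1 (s + k) = n1 s" "\<Gamma> (s + k) = \<Gamma> s" if "k \<in> {- T, 0, T}" for s k
    proof -
      have p: "\<Gamma> (x - k) = \<Gamma> x" for x using that perT[of x] by auto
      have "((\<lambda>x. \<Gamma> (x - k)) has_vector_derivative t s) (at (s + k))"
        by (rule has_vector_derivative_translate) (use t(1) in simp)
      then show "t (s + k) = t s" using t(1)[of "s + k"] vector_derivative_unique_at unfolding p by blast
      have "((\<lambda>x. N (\<Gamma> (x - k))) has_vector_derivative n1 s) (at (s + k))"
        by (rule has_vector_derivative_translate) (use n1 in simp)
      then show "n1 (s + k) = n1 s" using n1[of "s + k"] vector_derivative_unique_at unfolding p by blast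
      show "\<Gamma> (s + k) = \<Gamma> s" using p[of "s + k"] by simp
    qed
    show ?thesis
    \<comment> \<open>One period added on each side makes a and b interior points. None of their
      translates lies in \<open>{a<..<b}\<close>, so they form the exceptional set.\<close>
    proof (rule total_curvature_strip[OF assms(4) _ _ assms(9,10), where A = "a - T" and B = "b + T"
          and G = \<Gamma> and t = t and ?t2.0 = t2 and ?n1.0 = n1 and Sh = "{- T, 0, T}" and E = "{a, b}"])
      show "(\<Gamma> has_vector_derivative t s) (at s within {a - T..b + T})"
        "(t has_vector_derivative t2 s) (at s within {a - T..b + T})"
        "((\<lambda>s. N (\<Gamma> s)) has_vector_derivative n1 s) (at s within {a - T..b + T})" for s
        using t(1,2) n1 by (auto intro: has_vector_derivative_at_within)
      show "continuous_on {a - T..b + T} t2" using t(3) continuous_on_subset by blast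
      show "norm (N (\<Gamma> s)) = 1" for s using \<Gamma>M by (intro norm_N) auto
      show "N (\<Gamma> s) \<bullet> t s = 0" for s by (rule nac(2))
      show "k = 0 \<or> \<bar>k\<bar> = b - a" if "k \<in> {- T, 0, T}" for k using that T by auto
      show "\<exists>k\<in>{- T, 0, T}. s - k \<in> {a..b}" if "s \<in> {a - T..b + T}" for s using that T by auto
      show "\<exists>k\<in>{- T, 0, T}. s - k \<in> {a<..<b}" if "s \<in> {a - T<..<b + T} - {a, b}" for s using that T by auto
      show "s + k \<in> {a - T..b + T} \<and> \<Gamma> (s + k) = \<Gamma> s \<and> t (s + k) = t s \<and> n1 (s + k) = n1 s"
        if "s \<in> {a..b}" "k \<in> {- T, 0, T}" for s k
        using that shift[OF that(2)] T by auto
      show "\<exists>k\<in>{- T, 0, T}. s + k = s0" if h: "s \<in> {a..b}" "s0 \<in> {a..b}" "\<gamma> s = \<gamma> s0" for s s0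
      proof -
        have ab: "\<gamma> a = \<gamma> b" using eq[of a] eq[of b] per[of a] assms(4) by auto
        \<comment> \<open>Injectivity is available on the half-open interval; f reaches it by
          sending b to a, which has the same image.\<close>
        define f where "f = (\<lambda>x. if x = b then a else x)"
        have "\<gamma> (f s) = \<gamma> (f s0)" using h(3) ab by (auto simp: f_def)
        moreover have "f s \<in> {a..<b}" "f s0 \<in> {a..<b}" using h assms(4) by (auto simp: f_def)
        ultimately have "f s = f s0" using inj by (auto dest: inj_onD)
        then show ?thesis using T by (auto simp: f_def split: if_splits)
      qed
    qed (use assms(7,8) T eq in auto)
  qed
qed

end
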